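(* Let the cost function satisfy $\$(k)\asymp k^s$ $(k\in\mathbb N)$ for some $s>0$. Assume that $\mathrm d^{\mathrm{low}}_{\boldsymbol\gamma}=\mathrm d^{\mathrm{up}}_{\boldsymbol\gamma}=:\mathrm d_{\boldsymbol\gamma}$ and that $1<\mathrm d_{\boldsymbol\gamma}<1+s$. Then, in the nested subspace sampling cost model, the convergence rate of $L^2$-approximation in ANOVA spaces is strictly larger than the one in non-ANOVA spaces; that is, if $H^{A}_{\boldsymbol\gamma}$ is the space $H_{\boldsymbol\gamma}$ built from an ANOVA kernel and $H^{N}_{\boldsymbol\gamma}$ is the space $H_{\boldsymbol\gamma}$ built from a non-ANOVA kernel, with the same weights $\boldsymbol\gamma$ and the same cost function, and with $\mathrm d^{\mathrm{low}}_{\boldsymbol\lambda}>1$ for each of the two kernels, then $$r_\infty(H^{A}_{\boldsymbol\gamma})>r_\infty(H^{N}_{\boldsymbol\gamma}).$$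
   Context: **Kernel and weights.** Let $(D,\Sigma,\rho)$ be a probability space, $D\ne\emptyset$. For a reproducing kernel $K$, $H(K)$ denotes its reproducing kernel Hilbert space (RKHS); $H(1)$ is the space of constant functions. Let $k:D\times D\to\mathbb R$ be a reproducing kernel with $H(1)\cap H(k)=\{0\}$, with measurable functions in $H(k)$, and $\int_D k(x,x)\,d\rho(x)<\infty$. Then $S:H(1+k)\to L^2(D,\rho)$, $f\mapsto f$, is compact; $\|S\|$ is its operator norm. The kernel $k$, assumed to satisfy $k(\cdot,x)\in L^2(D,\rho)$ for all $x$, is an *ANOVA kernel* if $\int_D k(y,x)\,d\rho(y)=0$ for all $x\in D$, and a *non-ANOVA kernel* otherwise. Let $1\ge\gamma_1\ge\gamma_2\ge\dots>0$ be a null sequence, $\mathcal U$ the set of finite subsets of $\mathbb N$, and $\gamma_{\boldsymbol u}=\prod_{j\in\boldsymbol u}\gamma_j$ (product weights; $\gamma_\emptyset=1$), $\boldsymbol u\in\mathcal U$. Assume $\gamma_{\boldsymbol u_j}\|S\|^{2|\boldsymbol u_j|}\to0$ for an enumeration $(\boldsymbol u_j)_j$ of $\mathcal U$. (Both kernels in the claim are assumed to satisfy all these assumptions.) **Spaces.** $k_{\boldsymbol u}(\boldsymbol x,\boldsymbol y)=\prod_{j\in\boldsymbol u}k(x_j,y_j)$, $H_{\boldsymbol u}=H(k_{\boldsymbol u})$ (its elements depend only on $x_j$, $j\in\boldsymbol u$); $\mathfrak X=\{\boldsymbol x\in D^{\mathbb N}:\sum_{\boldsymbol u\in\mathcal U}\gamma_{\boldsymbol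 u}k_{\boldsymbol u}(\boldsymbol x,\boldsymbol x)<\infty\}$; $K_{\boldsymbol\gamma}=\sum_{\boldsymbol u\in\mathcal U}\gamma_{\boldsymbol u}k_{\boldsymbol u}$ on $\mathfrak X\times\mathfrak X$; $H_{\boldsymbol\gamma}=H(K_{\boldsymbol\gamma})$. Each $f\in H_{\boldsymbol\gamma}$ has a unique decomposition $f=\sum_{\boldsymbol u}f_{\boldsymbol u}$, $f_{\boldsymbol u}\in H_{\boldsymbol u}$, and $\|f\|_{H_{\boldsymbol\gamma}}^2=\sum_{\boldsymbol u}\gamma_{\boldsymbol u}^{-1}\|f_{\boldsymbol u}\|_{H_{\boldsymbol u}}^2$. The solution operator is $\mathcal S:H_{\boldsymbol\gamma}\to L^2(\mathfrak X,\rho^{\mathbb N})$, $f\mapsto f$, where $\rho^{\mathbb N}$ is the product measure. $H_{\boldsymbol\gamma}$ is called an ANOVA space if $k$ is an ANOVA kernel and a non-ANOVA space otherwise. **Eigenvalues.** $W=S^*S$ on $H(1+k)$ is assumed to have infinitely many positive eigenvalues $\boldsymbol\lambda=(\lambda_j)_{j\in\mathbb N}$, $\lambda_1\ge\lambda_2\ge\dots>0$ (a null sequence), with eigenfunctions forming a complete orthonormal system of $H(1+k)$. **Decay rates.** For a null sequence $\boldsymbol x=(x_j)$ of positive reals, $\mathrm d^{\mathrm{low}}_{\boldsymbol x}=\operatorname{decay}(\boldsymbol x)=\sup\{\alpha>0:\sum_j x_j^{1/\alpha}<\infty\}$ ($\sup\emptyset=0$) and $\mathrm d^{\mathrm{up}}_{\boldsymbol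 x}=\inf\{\alpha\ge0:\inf_n x_nn^\alpha>0\}$ ($\inf\emptyset=\infty$). $\mathrm d_{\boldsymbol\gamma}$ refers to $(\gamma_j)_{j}$ and $\mathrm d_{\boldsymbol\lambda}$ to $(\lambda_j)_j$. **Algorithms, cost, errors.** Admissible algorithms are $\mathcal A(f)=\sum_{j=1}^nL_{\boldsymbol u_j}(f)\,g_j$ with $g_j\in L^2(\mathfrak X,\rho^{\mathbb N})$, $\boldsymbol u_j\in\mathcal U$, $L_{\boldsymbol u_j}\in H_{\boldsymbol\gamma}^*$ represented (Riesz) by an element of $\bigoplus_{\boldsymbol v\subseteq\boldsymbol u_j}H_{\boldsymbol v}$ (the zero algorithm, with cost $0$, is also allowed). Fix a non-decreasing cost function $\$:\mathbb N_0\to[1,\infty)$. In the nested subspace sampling model, a functional $L$ has cost $\$(\max\boldsymbol u)$, where $\boldsymbol u$ is the minimal finite set such that the representer of $L$ lies in $\bigoplus_{\boldsymbol v\subseteq\boldsymbol u}H_{\boldsymbol v}$ ($\max\emptyset=0$), and $\operatorname{cost}(\mathcal A)$ is the sum of the costs of its functionals. The worst-case error is $e(\mathcal A,H_{\boldsymbol\gamma})=\sup_{\|f\|_{H_{\boldsymbol\gamma}}\le1}\|\mathcal S(f)-\mathcal A(f)\|_{L^2(\mathfrak X,\rho^{\mathbb N})}$; $e(n,H_{\boldsymbol\gamma})=\inf\{e(\mathcal A,H_{\boldsymbol\gamma}):\mathcal A\text{ admissible},\ \operatorname{cost}(\mathcal A)\le n\}$; and $r_\infty(H_{\boldsymbol\gamma})=\operatorname{decay}((e(n,H_{\boldsymbol\gamma}))_{n\in\mathbb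 N})$. $\asymp$ means two-sided estimates up to positive constants independent of $k$. *)

theory Defs
  imports "HOL-Probability.Probability"
begin

text \<open>
  A real function on a set \<open>D\<close> is represented by a total function that vanishes outside \<open>D\<close>;
  an inner product is set to \<open>0\<close> outside the space, so that the space determines the record.
\<close>

record 'x fun_space =
  elems :: "('x \<Rightarrow> real) set"
  ip :: "('x \<Rightarrow> real) \<Rightarrow> ('x \<Rightarrow> real) \<Rightarrow> real"

definition hnorm :: "'x fun_space \<Rightarrow> ('x \<Rightarrow> real) \<Rightarrow> real" where
  "hnorm H f = sqrt (ip H f f)"

definition hilbert_fun_space :: "'x set \<Rightarrow> 'x fun_space \<Rightarrow> bool" where
  "hilbert_fun_space D H \<longleftrightarrow>
     (\<forall>f\<in>elems H. \<forall>x. x \<notin> D \<longrightarrow> f x = 0) \<and>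
     (\<lambda>_. 0) \<in> elems H \<and>
     (\<forall>f\<in>elems H. \<forall>g\<in>elems H. (\<lambda>x. f x + g x) \<in> elems H) \<and>
     (\<forall>a. \<forall>f\<in>elems H. (\<lambda>x. a * f x) \<in> elems H) \<and>
     (\<forall>f g. f \<notin> elems H \<or> g \<notin> elems H \<longrightarrow> ip H f g = 0) \<and>
     (\<forall>f\<in>elems H. \<forall>g\<in>elems H. ip H f g = ip H g f) \<and>
     (\<forall>f\<in>elems H. \<forall>g\<in>elems H. \<forall>h\<in>elems H.
        ip H (\<lambda>x. f x + g x) h = ip H f h + ip H g h) \<and>
     (\<forall>a. \<forall>f\<in>elems H. \<forall>g\<in>elems H. ip H (\<lambda>x. a * f x) g = a * ip H f g) \<and>
     (\<forall>f\<in>elems H. 0 \<le> ip H f f \<and> (ip H f f = 0 \<longrightarrow> f = (\<lambda>_. 0))) \<and>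
     (\<forall>s::nat \<Rightarrow> 'x \<Rightarrow> real. range s \<subseteq> elems H \<and>
        (\<forall>\<epsilon>>0. \<exists>N. \<forall>m\<ge>N. \<forall>n\<ge>N. hnorm H (\<lambda>x. s m x - s n x) < \<epsilon>) \<longrightarrow>
        (\<exists>f\<in>elems H. (\<lambda>n. hnorm H (\<lambda>x. s n x - f x)) \<longlonglongrightarrow> 0))"

definition kernel_section :: "'x set \<Rightarrow> ('x \<Rightarrow> 'x \<Rightarrow> real) \<Rightarrow> 'x \<Rightarrow> 'x \<Rightarrow> real" where
  "kernel_section D K x = (\<lambda>y. if y \<in> D then K y x else 0)"

definition is_rkhs :: "'x set \<Rightarrow> ('x \<Rightarrow> 'x \<Rightarrow> real) \<Rightarrow> 'x fun_space \<Rightarrow> bool" where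
  "is_rkhs D K H \<longleftrightarrow> hilbert_fun_space D H \<and>
     (\<forall>x\<in>D. kernel_section D K x \<in> elems H \<and>
        (\<forall>f\<in>elems H. ip H f (kernel_section D K x) = f x))"

definition reproducing_kernel :: "'x set \<Rightarrow> ('x \<Rightarrow> 'x \<Rightarrow> real) \<Rightarrow> bool" where
  "reproducing_kernel D K \<longleftrightarrow> (\<exists>H. is_rkhs D K H)"

text \<open>The space \<open>H(K)\<close>; it is unique by the Moore--Aronszajn theorem.\<close>

definition rkhs :: "'x set \<Rightarrow> ('x \<Rightarrow> 'x \<Rightarrow> real) \<Rightarrow> 'x fun_space" where
  "rkhs D K = (THE H. is_rkhs D K H)"

text \<open>\<open>L\<^sup>2\<close> is represented by functions rather than by classes of functions.\<close>

definition L2 :: "'x measure \<Rightarrow> ('x \<Rightarrow> real) set" where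
  "L2 M = {f \<in> borel_measurable M. integrable M (\<lambda>x. (f x)\<^sup>2)}"

definition L2_norm :: "'x measure \<Rightarrow> ('x \<Rightarrow> real) \<Rightarrow> real" where
  "L2_norm M f = sqrt (\<integral>x. (f x)\<^sup>2 \<partial>M)"

text \<open>
  \<open>emb_norm\<close> and \<open>emb_adjoint\<close> belong to the embedding \<open>S: H \<rightarrow> L\<^sup>2(M), f \<mapsto> f\<close>. Since
  \<open>Sf = f\<close> as functions, \<open>W = S\<^sup>*S\<close> applies the adjoint to \<open>f\<close> itself.
\<close>

definition emb_norm :: "'x measure \<Rightarrow> 'x fun_space \<Rightarrow> real" where
  "emb_norm M H = (SUP f\<in>{f \<in> elems H. hnorm H f \<le> 1}. L2_norm M f)"

definition emb_adjoint :: "'x measure \<Rightarrow> 'x fun_space \<Rightarrow> ('x \<Rightarrow> real) \<Rightarrow> ('x \<Rightarrow> real)" where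
  "emb_adjoint M H g =
     (THE h. h \<in> elems H \<and> (\<forall>f\<in>elems H. ip H f h = (\<integral>x. f x * g x \<partial>M)))"

definition emb_W :: "'x measure \<Rightarrow> 'x fun_space \<Rightarrow> ('x \<Rightarrow> real) \<Rightarrow> ('x \<Rightarrow> real)" where
  "emb_W M H f = emb_adjoint M H f"

text \<open>
  All sequences are indexed by \<open>1, 2, \<dots>\<close>; the value at \<open>0\<close> is irrelevant.
  In \<^typ>\<open>ennreal\<close> the supremum of the empty set is \<open>0\<close> and its infimum is \<open>\<infinity>\<close>.
\<close>

definition decay :: "(nat \<Rightarrow> real) \<Rightarrow> ennreal" where
  "decay x = Sup {ennreal \<alpha> |\<alpha>. 0 < \<alpha> \<and> summable (\<lambda>j. x (Suc j) powr (1 / \<alpha>))}"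

abbreviation d_low :: "(nat \<Rightarrow> real) \<Rightarrow> ennreal" where
  "d_low \<equiv> decay"

definition d_up :: "(nat \<Rightarrow> real) \<Rightarrow> ennreal" where
  "d_up x = Inf {ennreal \<alpha> |\<alpha>. 0 \<le> \<alpha> \<and> 0 < (INF n\<in>{1..}. x n * real n powr \<alpha>)}"

definition fin_sets :: "nat set set" where
  "fin_sets = {u. finite u \<and> u \<subseteq> {1..}}"

definition weight :: "(nat \<Rightarrow> real) \<Rightarrow> nat set \<Rightarrow> real" where
  "weight \<gamma> u = (\<Prod>j\<in>u. \<gamma> j)"

definition one_plus :: "('a \<Rightarrow> 'a \<Rightarrow> real) \<Rightarrow> 'a \<Rightarrow> 'a \<Rightarrow> real" where
  "one_plus k = (\<lambda>x y. 1 + k x y)"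

definition weight_sequence :: "(nat \<Rightarrow> real) \<Rightarrow> bool" where
  "weight_sequence \<gamma> \<longleftrightarrow>
     \<gamma> 1 \<le> 1 \<and> (\<forall>j\<ge>1. \<gamma> (Suc j) \<le> \<gamma> j) \<and> (\<forall>j\<ge>1. 0 < \<gamma> j) \<and> \<gamma> \<longlonglongrightarrow> 0"

definition standing_kernel ::
    "'a measure \<Rightarrow> (nat \<Rightarrow> real) \<Rightarrow> ('a \<Rightarrow> 'a \<Rightarrow> real) \<Rightarrow> bool" where
  "standing_kernel \<rho> \<gamma> k \<longleftrightarrow>
     reproducing_kernel (space \<rho>) k \<and>
     elems (rkhs (space \<rho>) (\<lambda>_ _. 1)) \<inter> elems (rkhs (space \<rho>) k) = {\<lambda>_. 0} \<and>
     elems (rkhs (space \<rho>) k) \<subseteq> borel_measurable \<rho> \<and>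
     integrable \<rho> (\<lambda>x. k x x) \<and>
     (\<forall>x\<in>space \<rho>. (\<lambda>y. k y x) \<in> L2 \<rho>) \<and>
     (\<exists>U::nat \<Rightarrow> nat set. bij_betw U UNIV fin_sets \<and>
        (\<lambda>j. weight \<gamma> (U j) * emb_norm \<rho> (rkhs (space \<rho>) (one_plus k)) ^ (2 * card (U j)))
          \<longlonglongrightarrow> 0)"

definition anova_kernel :: "'a measure \<Rightarrow> ('a \<Rightarrow> 'a \<Rightarrow> real) \<Rightarrow> bool" where
  "anova_kernel \<rho> k \<longleftrightarrow> (\<forall>x\<in>space \<rho>. (\<integral>y. k y x \<partial>\<rho>) = 0)"

definition eigenvalue_sequence ::
    "'a measure \<Rightarrow> ('a \<Rightarrow> 'a \<Rightarrow> real) \<Rightarrow> (nat \<Rightarrow> real) \<Rightarrow> bool" where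
  "eigenvalue_sequence \<rho> k lam \<longleftrightarrow>
     (\<forall>j\<ge>1. lam (Suc j) \<le> lam j) \<and> (\<forall>j\<ge>1. 0 < lam j) \<and> lam \<longlonglongrightarrow> 0 \<and>
     (let H = rkhs (space \<rho>) (one_plus k) in
      \<exists>e::nat \<Rightarrow> 'a \<Rightarrow> real.
        (\<forall>j\<ge>1. e j \<in> elems H) \<and>
        (\<forall>i\<ge>1. \<forall>j\<ge>1. ip H (e i) (e j) = (if i = j then 1 else 0)) \<and>
        (\<forall>f\<in>elems H. (\<forall>j\<ge>1. ip H f (e j) = 0) \<longrightarrow> f = (\<lambda>_. 0)) \<and>
        (\<forall>j\<ge>1. emb_W \<rho> H (e j) = (\<lambda>x. lam j * e j x)))"

definition k_u :: "('a \<Rightarrow> 'a \<Rightarrow> real) \<Rightarrow> nat set \<Rightarrow> (nat \<Rightarrow> 'a) \<Rightarrow> (nat \<Rightarrow> 'a) \<Rightarrow> real" where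
  "k_u k u x y = (\<Prod>j\<in>u. k (x j) (y j))"

definition X_dom ::
    "'a measure \<Rightarrow> (nat \<Rightarrow> real) \<Rightarrow> ('a \<Rightarrow> 'a \<Rightarrow> real) \<Rightarrow> (nat \<Rightarrow> 'a) set" where
  "X_dom \<rho> \<gamma> k =
     {x \<in> {1..} \<rightarrow>\<^sub>E space \<rho>. (\<lambda>u. weight \<gamma> u * k_u k u x x) summable_on fin_sets}"

definition K_gamma ::
    "(nat \<Rightarrow> real) \<Rightarrow> ('a \<Rightarrow> 'a \<Rightarrow> real) \<Rightarrow> (nat \<Rightarrow> 'a) \<Rightarrow> (nat \<Rightarrow> 'a) \<Rightarrow> real" where
  "K_gamma \<gamma> k x y = (\<Sum>\<^sub>\<infinity>u\<in>fin_sets. weight \<gamma> u * k_u k u x y)"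

definition H_gamma ::
    "'a measure \<Rightarrow> (nat \<Rightarrow> real) \<Rightarrow> ('a \<Rightarrow> 'a \<Rightarrow> real) \<Rightarrow> (nat \<Rightarrow> 'a) fun_space" where
  "H_gamma \<rho> \<gamma> k = rkhs (X_dom \<rho> \<gamma> k) (K_gamma \<gamma> k)"

definition H_u ::
    "'a measure \<Rightarrow> (nat \<Rightarrow> real) \<Rightarrow> ('a \<Rightarrow> 'a \<Rightarrow> real) \<Rightarrow> nat set \<Rightarrow> (nat \<Rightarrow> 'a) fun_space" where
  "H_u \<rho> \<gamma> k u = rkhs (X_dom \<rho> \<gamma> k) (k_u k u)"

definition prod_meas ::
    "'a measure \<Rightarrow> (nat \<Rightarrow> real) \<Rightarrow> ('a \<Rightarrow> 'a \<Rightarrow> real) \<Rightarrow> (nat \<Rightarrow> 'a) measure" where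
  "prod_meas \<rho> \<gamma> k = restrict_space (\<Pi>\<^sub>M j\<in>{1..}. \<rho>) (X_dom \<rho> \<gamma> k)"

text \<open>
  \<open>sum_space \<rho> \<gamma> k u\<close> is \<open>\<Oplus>\<^bsub>v \<subseteq> u\<^esub> H\<^sub>v\<close>; the sum is direct because
  \<open>H(1) \<inter> H(k) = {0}\<close>.
\<close>

definition sum_space ::
    "'a measure \<Rightarrow> (nat \<Rightarrow> real) \<Rightarrow> ('a \<Rightarrow> 'a \<Rightarrow> real) \<Rightarrow> nat set \<Rightarrow> ((nat \<Rightarrow> 'a) \<Rightarrow> real) set" where
  "sum_space \<rho> \<gamma> k u =
     {f. \<exists>g. (\<forall>v\<in>Pow u. g v \<in> elems (H_u \<rho> \<gamma> k v)) \<and> f = (\<lambda>x. \<Sum>v\<in>Pow u. g v x)}"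

text \<open>
  An algorithm is a list of pairs \<open>(h, g)\<close>, where \<open>h\<close> is the Riesz representer of the functional
  \<open>L\<close> and \<open>g\<close> is its coefficient; the empty list is the zero algorithm.
\<close>

type_synonym 'x alg = "(('x \<Rightarrow> real) \<times> ('x \<Rightarrow> real)) list"

definition admissible ::
    "'a measure \<Rightarrow> (nat \<Rightarrow> real) \<Rightarrow> ('a \<Rightarrow> 'a \<Rightarrow> real) \<Rightarrow> (nat \<Rightarrow> 'a) alg \<Rightarrow> bool" where
  "admissible \<rho> \<gamma> k A \<longleftrightarrow>
     (\<forall>(h, g)\<in>set A. (\<exists>u\<in>fin_sets. h \<in> sum_space \<rho> \<gamma> k u) \<and> g \<in> L2 (prod_meas \<rho> \<gamma> k))"

definition apply_alg :: "'x fun_space \<Rightarrow> 'x alg \<Rightarrow> ('x \<Rightarrow> real) \<Rightarrow> 'x \<Rightarrow> real" where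
  "apply_alg H A f = (\<lambda>x. \<Sum>(h, g)\<leftarrow>A. ip H f h * g x)"

text \<open>
  Minimality is with respect to inclusion. By uniqueness of the decomposition the family of
  admissible sets \<open>u\<close> is closed under intersection, so that a least element exists.
\<close>

definition active_vars ::
    "'a measure \<Rightarrow> (nat \<Rightarrow> real) \<Rightarrow> ('a \<Rightarrow> 'a \<Rightarrow> real) \<Rightarrow> ((nat \<Rightarrow> 'a) \<Rightarrow> real) \<Rightarrow> nat set" where
  "active_vars \<rho> \<gamma> k h = (LEAST u. u \<in> fin_sets \<and> h \<in> sum_space \<rho> \<gamma> k u)"

definition nested_cost ::
    "'a measure \<Rightarrow> (nat \<Rightarrow> real) \<Rightarrow> ('a \<Rightarrow> 'a \<Rightarrow> real) \<Rightarrow> (nat \<Rightarrow> real) \<Rightarrow> (nat \<Rightarrow> 'a) alg \<Rightarrow> real" where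
  "nested_cost \<rho> \<gamma> k c A = (\<Sum>(h, g)\<leftarrow>A. c (Max (insert 0 (active_vars \<rho> \<gamma> k h))))"

definition wc_error ::
    "'a measure \<Rightarrow> (nat \<Rightarrow> real) \<Rightarrow> ('a \<Rightarrow> 'a \<Rightarrow> real) \<Rightarrow> (nat \<Rightarrow> 'a) alg \<Rightarrow> real" where
  "wc_error \<rho> \<gamma> k A =
     (let H = H_gamma \<rho> \<gamma> k in
      SUP f\<in>{f \<in> elems H. hnorm H f \<le> 1}.
        L2_norm (prod_meas \<rho> \<gamma> k) (\<lambda>x. f x - apply_alg H A f x))"

definition min_error ::
    "'a measure \<Rightarrow> (nat \<Rightarrow> real) \<Rightarrow> ('a \<Rightarrow> 'a \<Rightarrow> real) \<Rightarrow> (nat \<Rightarrow> real) \<Rightarrow> nat \<Rightarrow> real" where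
  "min_error \<rho> \<gamma> k c n =
     (INF A\<in>{A. admissible \<rho> \<gamma> k A \<and> nested_cost \<rho> \<gamma> k c A \<le> real n}. wc_error \<rho> \<gamma> k A)"

definition r_infty ::
    "'a measure \<Rightarrow> (nat \<Rightarrow> real) \<Rightarrow> ('a \<Rightarrow> 'a \<Rightarrow> real) \<Rightarrow> (nat \<Rightarrow> real) \<Rightarrow> ennreal" where
  "r_infty \<rho> \<gamma> k c = decay (min_error \<rho> \<gamma> k c)"

end

theory Submission
  imports Defs
begin

text \<open>
  Write \<open>g\<close> for the decay rate of the weights. The two rates are separated by \<open>(g - 1) / (2 s)\<close>.

  \<^emph>\<open>Kernels with nonzero mean.\<close> With budget \<open>n\<close> only functionals of the coordinates up to some
  \<open>d\<close> of order \<open>n\<^bsup>1/s\<^esup>\<close> are affordable. The function \<open>\<Sum>\<^bsub>d<j\<le>2d\<^esub> \<gamma>\<^sub>j k(x\<^sub>j, t)\<close> is orthogonal to all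
  their representers, and its squared norm is at most \<open>k(t,t) \<Sum> \<gamma>\<^sub>j\<close>. If \<open>k(\<cdot>, t)\<close> has nonzero mean,
  the coordinates reinforce each other in \<open>L\<^sup>2\<close>: the \<open>L\<^sup>2\<close> norm is at least a constant times \<open>\<Sum> \<gamma>\<^sub>j\<close>.
  The error is therefore at least of order \<open>(\<Sum> \<gamma>\<^sub>j)\<^bsup>1/2\<^esup>\<close>, roughly \<open>d\<^bsup>-(g-1)/2\<^esup>\<close>, and the rate is at most
  \<open>(g - 1) / (2 s)\<close> (\<open>error_lower_bound\<close>, \<open>nonzero_mean_rate\<close>).

  \<^emph>\<open>Kernels with mean zero.\<close> Here the components of a function for different sets of coordinates
  are orthogonal in \<open>L\<^sup>2\<close>. Products of eigenfunctions give an expansion of \<open>K\<^sub>\<gamma>\<close> into orthogonal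
  functions with squared norms at most \<open>\<gamma>\<^sub>u \<Prod>\<^bsub>j\<in>u\<^esub> \<mu>(i\<^sub>j)\<close>, and the squared error of a truncated
  expansion is at most the largest omitted one of these numbers instead of their sum
  (\<open>spectral_remainder\<close>). If all terms with
  numbers above \<open>\<epsilon>\<close> are kept, the cost is at most \<open>\<epsilon>\<^bsup>-\<tau>\<^esup>\<close> times the sum of \<open>(\<gamma>\<^sub>u \<Prod>\<^bsub>j\<in>u\<^esub> \<mu>(i\<^sub>j))\<^bsup>\<tau>\<^esup> $(max u)\<close>,
  which is finite when \<open>\<tau> > (s + 1) / g\<close> (\<open>weighted_eigenvalue_sum\<close>). So the rate is at
  least \<open>1 / (2 \<tau>)\<close> (\<open>zero_mean_rate\<close>), and \<open>(s + 1) / g < s / (g - 1)\<close> because \<open>g < 1 + s\<close>.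

  The reproducing kernel Hilbert spaces are handled through one formula: the squared norm of \<open>f\<close> is the
  supremum of \<open>2 f(a) - K(a,a)\<close> over finitely supported signed measures \<open>a\<close>. It yields existence and
  uniqueness of \<open>H(K)\<close>, Riesz representation and the decomposition for sums of kernels with little
  effort. Orthogonality of the coordinate subspaces, and with it the existence of a least set of
  active variables, rests on \<open>depends_on_imp_zero\<close>: since \<open>1\<close> is not in \<open>H(k)\<close>, there are measures of
  mass one and arbitrarily small energy, which act like an anchor at which \<open>k\<close> vanishes.
\<close>

section \<open>Reproducing kernel Hilbert spaces through point combinations\<close>

text \<open>
  A finitely supported signed measure is encoded as a list of pairs of a coefficient and a point.
  Repeated points do no harm, and concatenation is addition.
\<close>

definition ev :: "('x \<Rightarrow> real) \<Rightarrow> (real \<times> 'x) list \<Rightarrow> real" where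
  "ev f a = (\<Sum>(c, x)\<leftarrow>a. c * f x)"

definition combs :: "'x set \<Rightarrow> (real \<times> 'x) list set" where
  "combs D = lists (UNIV \<times> D)"

definition scl :: "real \<Rightarrow> (real \<times> 'x) list \<Rightarrow> (real \<times> 'x) list" where
  "scl t a = map (\<lambda>(c, x). (t * c, x)) a"

definition pairing :: "('x \<Rightarrow> 'x \<Rightarrow> real) \<Rightarrow> (real \<times> 'x) list \<Rightarrow> (real \<times> 'x) list \<Rightarrow> real" where
  "pairing K a b = ev (\<lambda>x. ev (K x) b) a"

lemma ev_Nil [simp]: "ev f [] = 0"
  and ev_Cons [simp]: "ev f (p # a) = fst p * f (snd p) + ev f a"
  by (auto simp: ev_def split: prod.splits)

lemma ev_append [simp]: "ev f (a @ b) = ev f a + ev f b"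
  by (induction a) auto

lemma ev_scl [simp]: "ev f (scl t a) = t * ev f a"
  by (induction a) (auto simp: scl_def algebra_simps)

lemma ev_add: "ev (\<lambda>x. f x + g x) a = ev f a + ev g a"
  by (induction a) (auto simp: algebra_simps)

lemma ev_diff: "ev (\<lambda>x. f x - g x) a = ev f a - ev g a"
  by (induction a) (auto simp: algebra_simps)

lemma ev_mult: "ev (\<lambda>x. c * f x) a = c * ev f a"
  by (induction a) (auto simp: algebra_simps)

lemma ev_mult_right: "ev (\<lambda>x. f x * c) a = ev f a * c"
  by (induction a) (auto simp: algebra_simps)

lemma ev_zero [simp]: "ev (\<lambda>x. 0) a = 0"
  by (induction a) auto

lemma ev_sum: "ev (\<lambda>x. \<Sum>i\<in>I. f i x) a = (\<Sum>i\<in>I. ev (f i) a)"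
  by (induction a) (auto simp: sum.distrib sum_distrib_left)

lemma ev_commute: "ev (\<lambda>x. ev (\<lambda>y. K x y) b) a = ev (\<lambda>y. ev (\<lambda>x. K x y) a) b"
  by (induction a) (auto simp: ev_add ev_mult)

lemma combs_Nil [simp]: "[] \<in> combs D"
  and combs_Cons [simp]: "p # a \<in> combs D \<longleftrightarrow> snd p \<in> D \<and> a \<in> combs D"
  and combs_append [simp]: "a @ b \<in> combs D \<longleftrightarrow> a \<in> combs D \<and> b \<in> combs D"
  by (auto simp: combs_def mem_Times_iff)

lemma combs_scl [simp]: "a \<in> combs D \<Longrightarrow> scl t a \<in> combs D"
  by (induction a) (auto simp: scl_def)

lemma ev_cong: "a \<in> combs D \<Longrightarrow> (\<And>x. x \<in> D \<Longrightarrow> f x = g x) \<Longrightarrow> ev f a = ev g a"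
  by (induction a) auto

lemma tendsto_ev:
  "a \<in> combs D \<Longrightarrow> (\<And>x. x \<in> D \<Longrightarrow> ((\<lambda>n. f n x) \<longlongrightarrow> g x) F) \<Longrightarrow> ((\<lambda>n. ev (f n) a) \<longlongrightarrow> ev g a) F"
  by (induction a) (auto intro!: tendsto_intros)

lemma pairing_append_left [simp]: "pairing K (a @ b) c = pairing K a c + pairing K b c"
  and pairing_append_right [simp]: "pairing K c (a @ b) = pairing K c a + pairing K c b"
  and pairing_scl_left [simp]: "pairing K (scl t a) c = t * pairing K a c"
  and pairing_scl_right [simp]: "pairing K c (scl t a) = t * pairing K c a"
  and pairing_Nil [simp]: "pairing K [] c = 0"
  and pairing_Nil2 [simp]: "pairing K c [] = 0"
  by (auto simp: pairing_def ev_add ev_mult)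

lemma pairing_add: "pairing (\<lambda>x y. K x y + L x y) a b = pairing K a b + pairing L a b"
  and pairing_mult: "pairing (\<lambda>x y. c * K x y) a b = c * pairing K a b"
  and pairing_rank_one: "pairing (\<lambda>x y. h x * g y) a b = ev h a * ev g b"
  by (auto simp: pairing_def ev_add ev_mult ev_mult_right)

text \<open>
  A function is identified with the functional \<open>a \<mapsto> f(a)\<close> on point combinations. It belongs to \<open>H(K)\<close>
  if this functional is bounded for the seminorm given by the energy \<open>K(a,a)\<close>, and the squared dual
  norm is the supremum of \<open>2 f(a) - K(a,a)\<close>.
\<close>

definition dominated :: "'x set \<Rightarrow> ('x \<Rightarrow> 'x \<Rightarrow> real) \<Rightarrow> ('x \<Rightarrow> real) \<Rightarrow> real \<Rightarrow> bool" where
  "dominated D K f C \<longleftrightarrow> (\<forall>a\<in>combs D. 2 * ev f a - pairing K a a \<le> C)"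

definition dom_fun :: "'x set \<Rightarrow> ('x \<Rightarrow> 'x \<Rightarrow> real) \<Rightarrow> ('x \<Rightarrow> real) set" where
  "dom_fun D K = {f. (\<forall>x. x \<notin> D \<longrightarrow> f x = 0) \<and> (\<exists>C. dominated D K f C)}"

definition sqn :: "'x set \<Rightarrow> ('x \<Rightarrow> 'x \<Rightarrow> real) \<Rightarrow> ('x \<Rightarrow> real) \<Rightarrow> real" where
  "sqn D K f = (SUP a\<in>combs D. 2 * ev f a - pairing K a a)"

definition dual_space :: "'x set \<Rightarrow> ('x \<Rightarrow> 'x \<Rightarrow> real) \<Rightarrow> 'x fun_space" where
  "dual_space D K = \<lparr>elems = dom_fun D K,
     ip = (\<lambda>f g. if f \<in> dom_fun D K \<and> g \<in> dom_fun D K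
       then (sqn D K (\<lambda>x. f x + g x) - sqn D K (\<lambda>x. f x - g x)) / 4 else 0)\<rparr>"

definition comb_fun :: "'x set \<Rightarrow> ('x \<Rightarrow> 'x \<Rightarrow> real) \<Rightarrow> (real \<times> 'x) list \<Rightarrow> 'x \<Rightarrow> real" where
  "comb_fun D K a = (\<lambda>y. if y \<in> D then ev (K y) a else 0)"

lemma quadratic_nonneg_discriminant:
  fixes A B C :: real
  assumes "\<And>t. 0 \<le> A * t\<^sup>2 - 2 * B * t + C" and "0 \<le> A"
  shows "B\<^sup>2 \<le> A * C"
proof (cases "A = 0")
  case True
  have "B = 0"
  proof (rule ccontr)
    assume "B \<noteq> 0"
    with assms(1)[of "(C + 1) / (2 * B)"] True show False by simp
  qed
  with True show ?thesis by simp
next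
  case False
  with assms(1)[of "B / A"] \<open>0 \<le> A\<close> show ?thesis
    by (simp add: power2_eq_square field_simps)
qed

text \<open>
  This turns additivity of the inner product into homogeneity, as in the theorem of Jordan and
  von Neumann.
\<close>

lemma additive_bounded_imp_linear:
  fixes \<phi> :: "real \<Rightarrow> real"
  assumes add: "\<And>s t. \<phi> (s + t) = \<phi> s + \<phi> t" and bd: "\<And>t. 0 \<le> t \<Longrightarrow> t \<le> 1 \<Longrightarrow> \<bar>\<phi> t\<bar> \<le> B"
  shows "\<phi> t = t * \<phi> 1"
proof -
  define \<psi> where "\<psi> t = \<phi> t - t * \<phi> 1" for t
  have add': "\<psi> (s + t) = \<psi> s + \<psi> t" for s t
    by (simp add: \<psi>_def add algebra_simps)
  have nat: "\<psi> (real n * t) = real n * \<psi> t" for n t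
  proof (induction n)
    case 0
    show ?case using add'[of 0 0] by simp
  next
    case (Suc n)
    have "\<psi> (real (Suc n) * t) = \<psi> (real n * t + t)" by (simp add: algebra_simps)
    then show ?case using Suc by (simp add: add' algebra_simps)
  qed
  have neg: "\<psi> (- t) = - \<psi> t" for t
    using add'[of t "-t"] add'[of 0 0] by simp
  have one: "\<psi> 1 = 0" by (simp add: \<psi>_def)
  have int: "\<psi> (of_int m) = 0" for m
    by (cases m rule: int_cases2) (use nat[of _ 1] one neg in auto)
  \<comment> \<open>Having period one, \<open>\<psi>\<close> is bounded on the whole line, hence zero.\<close>
  have bound: "\<bar>\<psi> t\<bar> \<le> B + \<bar>\<phi> 1\<bar>" for t
  proof -
    have "\<psi> t = \<psi> (frac t + of_int \<lfloor>t\<rfloor>)" by (simp add: frac_def)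
    then have "\<psi> t = \<psi> (frac t)" by (simp only: add' int add_0_right)
    moreover have "\<bar>\<psi> (frac t)\<bar> \<le> \<bar>\<phi> (frac t)\<bar> + \<bar>frac t * \<phi> 1\<bar>" unfolding \<psi>_def by linarith
    moreover have "\<bar>frac t * \<phi> 1\<bar> \<le> \<bar>\<phi> 1\<bar>"
      using frac_ge_0[of t] frac_lt_1[of t] by (simp add: abs_mult mult_left_le_one_le)
    ultimately show ?thesis using bd[of "frac t"] frac_ge_0[of t] frac_lt_1[of t] by linarith
  qed
  have "\<psi> t = 0"
  proof (rule ccontr)
    assume "\<psi> t \<noteq> 0"
    then obtain n where "real n * \<bar>\<psi> t\<bar> > B + \<bar>\<phi> 1\<bar>"
      using reals_Archimedean3[of "\<bar>\<psi> t\<bar>"] by auto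
    moreover have "real n * \<bar>\<psi> t\<bar> = \<bar>\<psi> (real n * t)\<bar>" by (simp add: nat abs_mult)
    ultimately show False using bound[of "real n * t"] by simp
  qed
  then show ?thesis by (simp add: \<psi>_def)
qed

locale psd_kernel =
  fixes D :: "'x set" and K :: "'x \<Rightarrow> 'x \<Rightarrow> real"
  assumes sym: "x \<in> D \<Longrightarrow> y \<in> D \<Longrightarrow> K x y = K y x"
    and psd: "a \<in> combs D \<Longrightarrow> 0 \<le> pairing K a a"
begin

abbreviation E where "E a \<equiv> pairing K a a"
abbreviation V where "V \<equiv> dom_fun D K"
abbreviation q where "q \<equiv> sqn D K"

lemma pairing_sym: "a \<in> combs D \<Longrightarrow> b \<in> combs D \<Longrightarrow> pairing K a b = pairing K b a"
  unfolding pairing_def by (subst ev_commute) (intro ev_cong[of _ D], auto simp: sym)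

lemma dominated_sq:
  assumes "dominated D K f C" "a \<in> combs D"
  shows "(ev f a)\<^sup>2 \<le> C * E a"
proof -
  have "0 \<le> E a * t\<^sup>2 - 2 * ev f a * t + C" for t
    using assms(1) combs_scl[OF assms(2), of t] unfolding dominated_def
    by (fastforce simp: power2_eq_square algebra_simps)
  from quadratic_nonneg_discriminant[OF this psd[OF assms(2)]] show ?thesis
    by (simp add: mult.commute)
qed

lemma dominated_of_sq:
  assumes "0 \<le> C" "\<And>a. a \<in> combs D \<Longrightarrow> (ev f a)\<^sup>2 \<le> C * E a"
  shows "dominated D K f C"
  unfolding dominated_def
proof
  fix a assume a: "a \<in> combs D"
  have "(2 * ev f a)\<^sup>2 \<le> 4 * (C * E a)" using assms(2)[OF a] by (simp add: power_mult_distrib)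
  also have "\<dots> \<le> (C + E a)\<^sup>2"
    using zero_le_power2[of "C - E a"] by (simp add: power2_eq_square algebra_simps)
  finally have "2 * ev f a \<le> C + E a"
    by (rule power2_le_imp_le) (use assms(1) psd[OF a] in auto)
  then show "2 * ev f a - E a \<le> C" by simp
qed

lemma q_upper: "f \<in> V \<Longrightarrow> a \<in> combs D \<Longrightarrow> 2 * ev f a - E a \<le> q f"
  unfolding sqn_def by (rule cSUP_upper) (auto simp: dom_fun_def dominated_def bdd_above_def)

lemma q_least: "dominated D K f C \<Longrightarrow> q f \<le> C"
  unfolding sqn_def by (rule cSUP_least) (auto simp: dominated_def intro: combs_Nil)

lemma q_dominated: "f \<in> V \<Longrightarrow> dominated D K f (q f)"
  using q_upper by (auto simp: dominated_def)

lemma q_nonneg: "f \<in> V \<Longrightarrow> 0 \<le> q f"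
  using q_upper[of f "[]"] by simp

lemma q_approx: "f \<in> V \<Longrightarrow> e > 0 \<Longrightarrow> \<exists>a\<in>combs D. q f - e < 2 * ev f a - E a"
proof (rule ccontr)
  assume f: "f \<in> V" and e: "0 < e" and "\<not> (\<exists>a\<in>combs D. q f - e < 2 * ev f a - E a)"
  then have "dominated D K f (q f - e)" by (auto simp: dominated_def not_less)
  from q_least[OF this] e show False by simp
qed

lemma V_outside: "f \<in> V \<Longrightarrow> x \<notin> D \<Longrightarrow> f x = 0"
  by (simp add: dom_fun_def)

lemma zero_in_V: "(\<lambda>_. 0) \<in> V"
  using psd by (auto simp: dom_fun_def dominated_def intro!: exI[of _ 0])

lemma q_zero: "q (\<lambda>_. 0) = 0"
  using q_nonneg[OF zero_in_V] q_least[of "\<lambda>_. 0" 0] psd by (fastforce simp: dominated_def)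

lemma assumes "f \<in> V" shows mult_in_V: "(\<lambda>x. t * f x) \<in> V" and q_mult_le: "q (\<lambda>x. t * f x) \<le> t\<^sup>2 * q f"
proof -
  have "dominated D K (\<lambda>x. t * f x) (t\<^sup>2 * q f)"
  proof (rule dominated_of_sq)
    show "0 \<le> t\<^sup>2 * q f" using q_nonneg[OF assms] by simp
    fix a assume a: "a \<in> combs D"
    show "(ev (\<lambda>x. t * f x) a)\<^sup>2 \<le> t\<^sup>2 * q f * E a"
      using mult_left_mono[OF dominated_sq[OF q_dominated[OF assms] a], of "t\<^sup>2"]
      by (simp add: ev_mult power_mult_distrib mult.assoc)
  qed
  then show "(\<lambda>x. t * f x) \<in> V" "q (\<lambda>x. t * f x) \<le> t\<^sup>2 * q f"
    using assms q_least by (auto simp: dom_fun_def)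
qed

lemma q_minus: assumes "f \<in> V" shows "q (\<lambda>x. - f x) = q f"
proof -
  have "q (\<lambda>x. - f x) \<le> q f" using q_mult_le[OF assms, of "-1"] by simp
  moreover have "q f \<le> q (\<lambda>x. - f x)"
    using q_mult_le[OF mult_in_V[OF assms, of "-1"], of "-1"] by simp
  ultimately show ?thesis by simp
qed

text \<open>The substitution \<open>a = c + d\<close>, \<open>b = c - d\<close> decouples the two suprema.\<close>

lemma parallelogram_dominated:
  assumes f: "dominated D K f A" and g: "dominated D K g B"
  and a: "a \<in> combs D" and b: "b \<in> combs D"
  shows "(2 * ev (\<lambda>x. f x + g x) a - E a) + (2 * ev (\<lambda>x. f x - g x) b - E b) \<le> 2 * A + 2 * B"
proof -
  define c where "c = scl (1/2) (a @ b)"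
  define d where "d = scl (1/2) (a @ scl (-1) b)"
  have cd: "c \<in> combs D" "d \<in> combs D" using a b by (auto simp: c_def d_def)
  have "(2 * ev (\<lambda>x. f x + g x) a - E a) + (2 * ev (\<lambda>x. f x - g x) b - E b)
      = 2 * (2 * ev f c - E c) + 2 * (2 * ev g d - E d)"
    using pairing_sym[OF a b] by (simp add: c_def d_def ev_add ev_diff algebra_simps)
  also have "\<dots> \<le> 2 * A + 2 * B"
    using f g cd unfolding dominated_def by (intro add_mono) auto
  finally show ?thesis .
qed

lemma add_in_V: assumes "f \<in> V" "g \<in> V" shows "(\<lambda>x. f x + g x) \<in> V"
proof -
  have "dominated D K (\<lambda>x. f x + g x) (2 * q f + 2 * q g)"
    using parallelogram_dominated[OF q_dominated[OF assms(1)] q_dominated[OF assms(2)], of _ "[]"]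
    by (auto simp: dominated_def)
  with assms show ?thesis by (auto simp: dom_fun_def)
qed

lemma diff_in_V: assumes "f \<in> V" "g \<in> V" shows "(\<lambda>x. f x - g x) \<in> V"
  using add_in_V[OF assms(1) mult_in_V[OF assms(2), of "-1"]] by simp

lemma parallelogram_le:
  assumes "f \<in> V" "g \<in> V"
  shows "q (\<lambda>x. f x + g x) + q (\<lambda>x. f x - g x) \<le> 2 * q f + 2 * q g"
proof -
  note P = parallelogram_dominated[OF q_dominated[OF assms(1)] q_dominated[OF assms(2)]]
  have "q (\<lambda>x. f x + g x) \<le> 2 * q f + 2 * q g - (2 * ev (\<lambda>x. f x - g x) b - E b)"
    if "b \<in> combs D" for b
    by (rule q_least) (use P[OF _ that] in \<open>auto simp: dominated_def algebra_simps\<close>)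
  then have "dominated D K (\<lambda>x. f x - g x) (2 * q f + 2 * q g - q (\<lambda>x. f x + g x))"
    by (fastforce simp: dominated_def)
  from q_least[OF this] show ?thesis by simp
qed

lemma parallelogram:
  assumes "f \<in> V" "g \<in> V"
  shows "q (\<lambda>x. f x + g x) + q (\<lambda>x. f x - g x) = 2 * q f + 2 * q g"
proof (rule antisym[OF parallelogram_le[OF assms]])
  have s: "(\<lambda>x. f x + g x) \<in> V" "(\<lambda>x. f x - g x) \<in> V" using add_in_V diff_in_V assms by auto
  have "(\<lambda>x. (f x + g x) + (f x - g x)) = (\<lambda>x. 2 * f x)"
    "(\<lambda>x. (f x + g x) - (f x - g x)) = (\<lambda>x. 2 * g x)" by auto
  with parallelogram_le[OF s]
  have "q (\<lambda>x. 2 * f x) + q (\<lambda>x. 2 * g x)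
     \<le> 2 * q (\<lambda>x. f x + g x) + 2 * q (\<lambda>x. f x - g x)" by simp
  moreover have "4 * q f \<le> q (\<lambda>x. 2 * f x)" "4 * q g \<le> q (\<lambda>x. 2 * g x)"
    using q_mult_le[OF mult_in_V[OF assms(1), of 2], of "1/2"]
      q_mult_le[OF mult_in_V[OF assms(2), of 2], of "1/2"] by (auto simp: power2_eq_square)
  ultimately show "2 * q f + 2 * q g \<le> q (\<lambda>x. f x + g x) + q (\<lambda>x. f x - g x)" by simp
qed

abbreviation S where "S \<equiv> dual_space D K"

lemma ip_dual: "f \<in> V \<Longrightarrow> g \<in> V \<Longrightarrow> ip S f g = (q (\<lambda>x. f x + g x) - q (\<lambda>x. f x - g x)) / 4"
  by (simp add: dual_space_def)

lemma q_double: "f \<in> V \<Longrightarrow> q (\<lambda>x. 2 * f x) = 4 * q f"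
  using parallelogram[of f f] q_zero by simp

lemma ip_self_dual: "f \<in> V \<Longrightarrow> ip S f f = q f"
  using q_double q_zero by (simp add: ip_dual)

lemma ip_add_dual:
  assumes f: "f \<in> V" and h: "h \<in> V" and g: "g \<in> V"
  shows "ip S (\<lambda>x. f x + h x) g = ip S f g + ip S h g"
proof -
  \<comment> \<open>Both sides are compared through \<open>(f + g) \<plusminus> h\<close> and \<open>(f - g) \<plusminus> h\<close>, and likewise with \<open>f\<close> and \<open>h\<close> exchanged.\<close>
  note I = add_in_V diff_in_V f g h
  have 1: "q (\<lambda>x. f x + g x + h x) + q (\<lambda>x. f x + g x - h x) = 2 * q (\<lambda>x. f x + g x) + 2 * q h"
    by (rule parallelogram) (intro I)+
  have 2: "q (\<lambda>x. f x - g x + h x) + q (\<lambda>x. f x - g x - h x) = 2 * q (\<lambda>x. f x - g x) + 2 * q h"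
    by (rule parallelogram) (intro I)+
  have 3: "q (\<lambda>x. h x + g x + f x) + q (\<lambda>x. h x + g x - f x) = 2 * q (\<lambda>x. h x + g x) + 2 * q f"
    by (rule parallelogram) (intro I)+
  have 4: "q (\<lambda>x. h x - g x + f x) + q (\<lambda>x. h x - g x - f x) = 2 * q (\<lambda>x. h x - g x) + 2 * q f"
    by (rule parallelogram) (intro I)+
  have 5: "q (\<lambda>x. h x - g x - f x) = q (\<lambda>x. f x + g x - h x)"
  proof -
    have "(\<lambda>x. h x - g x - f x) = (\<lambda>x. - (f x + g x - h x))" by auto
    then show ?thesis using q_minus[of "\<lambda>x. f x + g x - h x"] by (simp add: I)
  qed
  have 6: "q (\<lambda>x. f x - g x - h x) = q (\<lambda>x. h x + g x - f x)"
  proof -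
    have "(\<lambda>x. f x - g x - h x) = (\<lambda>x. - (h x + g x - f x))" by auto
    then show ?thesis using q_minus[of "\<lambda>x. h x + g x - f x"] by (simp add: I)
  qed
  have e: "(\<lambda>x. h x + g x + f x) = (\<lambda>x. f x + g x + h x)"
    "(\<lambda>x. f x + h x + g x) = (\<lambda>x. f x + g x + h x)"
    "(\<lambda>x. f x + h x - g x) = (\<lambda>x. f x - g x + h x)"
    "(\<lambda>x. h x - g x + f x) = (\<lambda>x. f x - g x + h x)" by auto
  have alg: "(P - Q) / 4 = (a - b) / 4 + (c - d) / 4"
    if "P + R = 2 * a + 2 * u" "Q + T = 2 * b + 2 * u" "P + T = 2 * c + 2 * v" "Q + R = 2 * d + 2 * v"
    for P Q R T a b c d u v :: real
  proof -
    have "P - Q = (a - b) + (c - d)" using that by algebra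
    then show ?thesis by (simp only: add_divide_distrib)
  qed
  show ?thesis
    unfolding ip_dual[OF add_in_V[OF f h] g] ip_dual[OF f g] ip_dual[OF h g] e
    by (rule alg[OF 1 2[unfolded 6] 3[unfolded e] 4[unfolded e 5]])
qed

lemma ip_sym_dual: assumes "f \<in> V" "g \<in> V" shows "ip S f g = ip S g f"
proof -
  have "(\<lambda>x. f x - g x) = (\<lambda>x. - (g x - f x))" by auto
  then have "q (\<lambda>x. f x - g x) = q (\<lambda>x. g x - f x)" using q_minus[OF diff_in_V[OF assms(2,1)]] by simp
  then show ?thesis using assms by (simp add: ip_dual add.commute)
qed

lemma ip_mult_dual: assumes f: "f \<in> V" and g: "g \<in> V"
  shows "ip S (\<lambda>x. t * f x) g = t * ip S f g"
proof -
  define \<phi> where "\<phi> t = ip S (\<lambda>x. t * f x) g" for t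
  have "\<phi> t = t * \<phi> 1"
  proof (rule additive_bounded_imp_linear[where B = "q f + q g"])
    fix s t show "\<phi> (s + t) = \<phi> s + \<phi> t"
      using ip_add_dual[OF mult_in_V[OF f, of s] mult_in_V[OF f, of t] g]
      by (simp add: \<phi>_def distrib_right)
  next
    fix t :: real assume t: "0 \<le> t" "t \<le> 1"
    note m = mult_in_V[OF f, of t]
    have "q (\<lambda>x. t * f x) \<le> t\<^sup>2 * q f" by (rule q_mult_le[OF f])
    also have "\<dots> \<le> q f" using t q_nonneg[OF f] by (simp add: mult_left_le_one_le power_le_one)
    finally have "q (\<lambda>x. t * f x) \<le> q f" .
    with parallelogram[OF m g] q_nonneg[OF add_in_V[OF m g]] q_nonneg[OF diff_in_V[OF m g]]
      q_nonneg[OF f] q_nonneg[OF g]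
    show "\<bar>\<phi> t\<bar> \<le> q f + q g" by (simp add: \<phi>_def ip_dual m g)
  qed
  then show ?thesis by (simp add: \<phi>_def)
qed

lemma point_bound: assumes "dominated D K f C" "x \<in> D" shows "(f x)\<^sup>2 \<le> C * K x x"
  using dominated_sq[OF assms(1), of "[(1, x)]"] assms(2) by (simp add: pairing_def)

lemma q_eq_0D: assumes "f \<in> V" "q f = 0" shows "f = (\<lambda>_. 0)"
proof
  fix x show "f x = 0"
    using point_bound[OF q_dominated[OF assms(1)], of x] assms by (cases "x \<in> D") (auto simp: dom_fun_def)
qed

text \<open>
  Adding the function of a combination \<open>c\<close> shifts the variable of the supremum by \<open>c\<close>. This computes
  the inner product with point combinations and thereby the reproducing property.
\<close>

lemma q_shift:
  assumes "f \<in> V" "c \<in> combs D"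
  shows "dominated D K (\<lambda>x. f x + comb_fun D K c x) (q f + 2 * ev f c + E c)"
  unfolding dominated_def
proof
  fix a assume a: "a \<in> combs D"
  let ?b = "a @ scl (-1) c"
  have "ev (comb_fun D K c) a = pairing K a c"
    unfolding pairing_def by (rule ev_cong[OF a]) (simp add: comb_fun_def)
  then have "2 * ev (\<lambda>x. f x + comb_fun D K c x) a - E a = 2 * ev f ?b - E ?b + 2 * ev f c + E c"
    using pairing_sym[OF a assms(2)] by (simp add: ev_add)
  also have "\<dots> \<le> q f + 2 * ev f c + E c" using q_upper[OF assms(1), of ?b] a assms(2) by simp
  finally show "2 * ev (\<lambda>x. f x + comb_fun D K c x) a - E a \<le> q f + 2 * ev f c + E c" .
qed

lemma comb_in_V: assumes "c \<in> combs D" shows "comb_fun D K c \<in> V"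
  using q_shift[OF zero_in_V assms] unfolding dom_fun_def by (auto simp: comb_fun_def)

lemma comb_fun_scl: "comb_fun D K (scl t c) = (\<lambda>x. t * comb_fun D K c x)"
  by (auto simp: comb_fun_def)

lemma q_shift_eq:
  assumes f: "f \<in> V" and c: "c \<in> combs D"
  shows "q (\<lambda>x. f x + comb_fun D K c x) = q f + 2 * ev f c + E c"
proof (rule antisym[OF q_least[OF q_shift[OF assms]]])
  have "ev (comb_fun D K c) c = E c" 
    unfolding pairing_def by (rule ev_cong[OF c]) (simp add: comb_fun_def)
  then show "q f + 2 * ev f c + E c \<le> q (\<lambda>x. f x + comb_fun D K c x)"
    using q_least[OF q_shift[OF add_in_V[OF f comb_in_V[OF c]] combs_scl[OF c, of "-1"]]]
    by (simp add: ev_add comb_fun_scl)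
qed

lemma ip_comb_dual: assumes f: "f \<in> V" and c: "c \<in> combs D" shows "ip S f (comb_fun D K c) = ev f c"
  using q_shift_eq[OF f c] q_shift_eq[OF f combs_scl[OF c, of "-1"]]
  by (simp add: ip_dual f comb_in_V c comb_fun_scl)

lemma dual_complete:
  assumes s: "\<And>n. s n \<in> V" and cauchy: "\<And>e. e > 0 \<Longrightarrow> \<exists>N. \<forall>m\<ge>N. \<forall>n\<ge>N. q (\<lambda>x. s m x - s n x) < e"
  shows "\<exists>f\<in>V. (\<lambda>n. q (\<lambda>x. s n x - f x)) \<longlonglongrightarrow> 0"
proof -
  have sd: "(\<lambda>x. s m x - s n x) \<in> V" for m n by (intro diff_in_V s)
  have "convergent (\<lambda>n. s n x)" for x
  proof (cases "x \<in> D")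
    case True
    have "Cauchy (\<lambda>n. s n x)"
    proof (rule metric_CauchyI)
      fix e :: real assume "e > 0"
      define \<delta> where "\<delta> = e\<^sup>2 / (K x x + 1)"
      have K: "0 \<le> K x x" using psd[of "[(1, x)]"] True by (simp add: pairing_def)
      then have "\<delta> > 0" using \<open>e > 0\<close> by (simp add: \<delta>_def)
      then obtain N where N: "\<And>m n. m \<ge> N \<Longrightarrow> n \<ge> N \<Longrightarrow> q (\<lambda>x. s m x - s n x) < \<delta>" using cauchy by blast
      have "\<bar>s m x - s n x\<bar> < e" if "m \<ge> N" "n \<ge> N" for m n
      proof -
        have "(s m x - s n x)\<^sup>2 \<le> q (\<lambda>x. s m x - s n x) * K x x"
          by (rule point_bound[OF q_dominated[OF sd] True])
        also have "\<dots> \<le> \<delta> * K x x" using N[OF that] K by (intro mult_right_mono) auto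
        also have "\<dots> < e\<^sup>2" using K \<open>e > 0\<close> by (simp add: \<delta>_def field_simps)
        finally show ?thesis using \<open>e > 0\<close> abs_le_square_iff[of e "s m x - s n x"] by auto
      qed
      then show "\<exists>M. \<forall>m\<ge>M. \<forall>n\<ge>M. dist (s m x) (s n x) < e" by (auto simp: dist_real_def)
    qed
    then show ?thesis by (simp add: Cauchy_convergent_iff)
  next
    case False
    then have "s n x = 0" for n using s[of n] by (auto simp: dom_fun_def)
    then show ?thesis by (simp add: convergent_const)
  qed
  then obtain f where f: "\<And>x. (\<lambda>n. s n x) \<longlonglongrightarrow> f x" unfolding convergent_def by metis
  have f0: "f x = 0" if "x \<notin> D" for x
  proof -
    have "s n x = 0" for n using s[of n] that by (auto simp: dom_fun_def)
    with f[of x] show ?thesis by (simp add: LIMSEQ_const_iff)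
  qed
  \<comment> \<open>\<open>q\<close> is lower semicontinuous along pointwise limits, being a supremum of point evaluations.\<close>
  have key: "dominated D K (\<lambda>x. s m x - f x) e"
    if N: "\<And>m n. m \<ge> N \<Longrightarrow> n \<ge> N \<Longrightarrow> q (\<lambda>x. s m x - s n x) < e" and m: "m \<ge> N" for N m e
    unfolding dominated_def
  proof
    fix a assume a: "a \<in> combs D"
    have "(\<lambda>n. 2 * ev (\<lambda>x. s m x - s n x) a - E a) \<longlonglongrightarrow> 2 * ev (\<lambda>x. s m x - f x) a - E a"
      by (intro tendsto_intros tendsto_ev[OF a] f)
    then show "2 * ev (\<lambda>x. s m x - f x) a - E a \<le> e"
    proof (rule tendsto_upperbound)
      show "\<forall>\<^sub>F n in sequentially. 2 * ev (\<lambda>x. s m x - s n x) a - E a \<le> e"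
        using eventually_ge_at_top[of N]
        by eventually_elim (rule order_trans[OF q_upper[OF sd a] less_imp_le[OF N[OF m]]])
    qed simp
  qed
  obtain N where "\<And>m n. m \<ge> N \<Longrightarrow> n \<ge> N \<Longrightarrow> q (\<lambda>x. s m x - s n x) < 1" using cauchy[of 1] by auto
  from key[OF this order_refl] have "(\<lambda>x. s N x - f x) \<in> V"
    using f0 s[of N] by (auto simp: dom_fun_def)
  from diff_in_V[OF s[of N] this] have fV: "f \<in> V" by simp
  have "(\<lambda>n. q (\<lambda>x. s n x - f x)) \<longlonglongrightarrow> 0"
  proof (rule LIMSEQ_I)
    fix e :: real assume "e > 0"
    then obtain N where N: "\<And>m n. m \<ge> N \<Longrightarrow> n \<ge> N \<Longrightarrow> q (\<lambda>x. s m x - s n x) < e / 2"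
      using cauchy[of "e/2"] by auto
    have "norm (q (\<lambda>x. s n x - f x) - 0) < e" if "n \<ge> N" for n
      using q_least[OF key[OF N that]] q_nonneg[OF diff_in_V[OF s[of n] fV]] \<open>e > 0\<close> by simp
    then show "\<exists>no. \<forall>n\<ge>no. norm (q (\<lambda>x. s n x - f x) - 0) < e" by blast
  qed
  with fV show ?thesis by blast
qed

lemma hnorm_dual: "f \<in> V \<Longrightarrow> hnorm S f = sqrt (q f)"
  by (simp add: hnorm_def ip_self_dual)

lemma elems_dual [simp]: "elems S = V" by (simp add: dual_space_def)

lemma hilbert_dual: "hilbert_fun_space D S"
proof -
  have "\<exists>f\<in>V. (\<lambda>n. hnorm S (\<lambda>x. s n x - f x)) \<longlonglongrightarrow> 0"
    if s: "range s \<subseteq> V" and c: "\<forall>\<epsilon>>0. \<exists>N. \<forall>m\<ge>N. \<forall>n\<ge>N. hnorm S (\<lambda>x. s m x - s n x) < \<epsilon>" for s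
  proof -
    have sV: "s n \<in> V" for n using s by auto
    have "\<exists>N. \<forall>m\<ge>N. \<forall>n\<ge>N. q (\<lambda>x. s m x - s n x) < e" if "e > 0" for e
      using c[rule_format, of "sqrt e"] that by (simp add: hnorm_dual diff_in_V sV)
    from dual_complete[OF sV this] obtain f where f: "f \<in> V" "(\<lambda>n. q (\<lambda>x. s n x - f x)) \<longlonglongrightarrow> 0" by blast
    with tendsto_real_sqrt[OF f(2)] show ?thesis
      by (intro bexI[of _ f]) (simp_all add: hnorm_dual diff_in_V sV)
  qed
  moreover have "ip S f g = 0" if "f \<notin> V \<or> g \<notin> V" for f g
    using that by (auto simp: dual_space_def)
  ultimately show ?thesis
    unfolding hilbert_fun_space_def elems_dual
    using zero_in_V add_in_V mult_in_V ip_sym_dual ip_add_dual ip_mult_dual ip_self_dual q_nonneg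
      q_eq_0D V_outside by (intro conjI ballI allI impI) simp_all
qed

lemma section_eq_comb: "x \<in> D \<Longrightarrow> kernel_section D K x = comb_fun D K [(1, x)]"
  by (auto simp: kernel_section_def comb_fun_def)

lemma is_rkhs_dual: "is_rkhs D K S"
  unfolding is_rkhs_def using hilbert_dual by (simp add: section_eq_comb comb_in_V ip_comb_dual)

end

lemma bij_betw_Suc: "bij_betw Suc UNIV {1::nat..}"
  by (auto simp: bij_betw_def image_iff intro: Suc_le_D)

locale hilbert_functions =
  fixes D :: "'x set" and H :: "'x fun_space"
  assumes hilbert: "hilbert_fun_space D H"
begin

lemmas hilbert_laws = hilbert[unfolded hilbert_fun_space_def]

lemma outside: "f \<in> elems H \<Longrightarrow> x \<notin> D \<Longrightarrow> f x = 0"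
  using hilbert_laws[THEN conjunct1] by simp

lemma zero [simp]: "(\<lambda>_. 0) \<in> elems H"
  using hilbert_laws[THEN conjunct2, THEN conjunct1] .

lemmas add = hilbert_laws[THEN conjunct2, THEN conjunct2, THEN conjunct1, rule_format]

lemmas mult = hilbert_laws[THEN conjunct2, THEN conjunct2, THEN conjunct2, THEN conjunct1, rule_format]

lemmas ip_laws = hilbert_laws[THEN conjunct2, THEN conjunct2, THEN conjunct2, THEN conjunct2]

lemmas ip_outside = ip_laws[THEN conjunct1, rule_format]

lemmas ip_add = ip_laws[THEN conjunct2, THEN conjunct2, THEN conjunct1, rule_format]

lemmas ip_mult = ip_laws[THEN conjunct2, THEN conjunct2, THEN conjunct2, THEN conjunct1, rule_format]

lemmas ip_pos = ip_laws[THEN conjunct2, THEN conjunct2, THEN conjunct2, THEN conjunct2, THEN conjunct1, rule_format]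

lemmas complete_hnorm = ip_laws[THEN conjunct2, THEN conjunct2, THEN conjunct2, THEN conjunct2, THEN conjunct2, rule_format]

lemma ip_definite: "f \<in> elems H \<Longrightarrow> ip H f f = 0 \<Longrightarrow> f = (\<lambda>_. 0)"
  using ip_pos[of f, THEN conjunct2] by (rule mp)

lemma ip_commute: "ip H f g = ip H g f"
proof (cases "f \<in> elems H \<and> g \<in> elems H")
  case True
  then show ?thesis using ip_laws[THEN conjunct2, THEN conjunct1] by simp
next
  case False
  then show ?thesis using ip_outside[of f g] ip_outside[of g f] by auto
qed

lemma ip_nonneg: "0 \<le> ip H f f"
  using ip_pos[of f, THEN conjunct1] ip_outside[of f f] by (cases "f \<in> elems H") auto

lemma diff: "f \<in> elems H \<Longrightarrow> g \<in> elems H \<Longrightarrow> (\<lambda>x. f x - g x) \<in> elems H"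
  using add[of f "\<lambda>x. (-1) * g x"] mult[of g "-1"] by simp

lemma ip_diff: "f \<in> elems H \<Longrightarrow> g \<in> elems H \<Longrightarrow> h \<in> elems H
    \<Longrightarrow> ip H (\<lambda>x. f x - g x) h = ip H f h - ip H g h"
  using ip_add[of f "\<lambda>x. (-1) * g x" h] ip_mult[of g h "-1"] mult[of g "-1"] by simp

lemma ip_add_right: "f \<in> elems H \<Longrightarrow> g \<in> elems H \<Longrightarrow> h \<in> elems H
    \<Longrightarrow> ip H h (\<lambda>x. f x + g x) = ip H h f + ip H h g"
  and ip_diff_right: "f \<in> elems H \<Longrightarrow> g \<in> elems H \<Longrightarrow> h \<in> elems H
    \<Longrightarrow> ip H h (\<lambda>x. f x - g x) = ip H h f - ip H h g"
  and ip_mult_right: "f \<in> elems H \<Longrightarrow> g \<in> elems H \<Longrightarrow> ip H g (\<lambda>x. t * f x) = t * ip H g f"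
  using ip_add[of f g h] ip_diff[of f g h] ip_mult[of f g t] by (simp_all add: ip_commute)

lemma ip_zero [simp]: "ip H (\<lambda>_. 0) f = 0" "ip H f (\<lambda>_. 0) = 0"
proof -
  show "ip H (\<lambda>_. 0) f = 0"
    using ip_mult[of "\<lambda>_. 0" f 0] ip_outside[of "\<lambda>_. 0" f] by (cases "f \<in> elems H") auto
  then show "ip H f (\<lambda>_. 0) = 0" by (simp add: ip_commute)
qed

lemma sum_mem: "(\<And>i. i \<in> I \<Longrightarrow> f i \<in> elems H) \<Longrightarrow> (\<lambda>x. \<Sum>i\<in>I. f i x) \<in> elems H"
  by (induction I rule: infinite_finite_induct) (auto intro: add)

lemma ip_sum_right: "(\<And>i. i \<in> I \<Longrightarrow> f i \<in> elems H) \<Longrightarrow> g \<in> elems H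
    \<Longrightarrow> ip H g (\<lambda>x. \<Sum>i\<in>I. f i x) = (\<Sum>i\<in>I. ip H g (f i))"
  by (induction I rule: infinite_finite_induct) (auto simp: ip_add_right sum_mem)

lemma ip_diff_self: "f \<in> elems H \<Longrightarrow> g \<in> elems H
    \<Longrightarrow> ip H (\<lambda>x. f x - g x) (\<lambda>x. f x - g x) = ip H f f - 2 * ip H f g + ip H g g"
  by (simp add: ip_diff ip_diff_right diff ip_commute[of g f])

lemma ip_add_self: "f \<in> elems H \<Longrightarrow> g \<in> elems H
    \<Longrightarrow> ip H (\<lambda>x. f x + g x) (\<lambda>x. f x + g x) = ip H f f + 2 * ip H f g + ip H g g"
  by (simp add: ip_add ip_add_right add ip_commute[of g f])

lemma Cauchy_Schwarz: "(ip H f g)\<^sup>2 \<le> ip H f f * ip H g g"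
proof (cases "f \<in> elems H \<and> g \<in> elems H")
  case True
  have "0 \<le> ip H f f * t\<^sup>2 - 2 * ip H f g * t + ip H g g" for t
    using ip_nonneg[of "\<lambda>x. t * f x - g x"] True
    by (simp add: ip_diff_self mult ip_mult ip_mult_right power2_eq_square algebra_simps)
  from quadratic_nonneg_discriminant[OF this ip_nonneg] show ?thesis .
next
  case False
  then have "ip H f g = 0" using ip_outside[of f g] by simp
  then show ?thesis using ip_nonneg[of f] ip_nonneg[of g] by simp
qed

lemma complete:
  assumes s: "\<And>n. s n \<in> elems H"
    and c: "\<And>e. e > 0 \<Longrightarrow> \<exists>N. \<forall>m\<ge>N. \<forall>n\<ge>N. ip H (\<lambda>x. s m x - s n x) (\<lambda>x. s m x - s n x) < e"
  obtains f where "f \<in> elems H" "(\<lambda>n. ip H (\<lambda>x. s n x - f x) (\<lambda>x. s n x - f x)) \<longlonglongrightarrow> 0"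
proof -
  have "\<exists>N. \<forall>m\<ge>N. \<forall>n\<ge>N. hnorm H (\<lambda>x. s m x - s n x) < e" if e: "e > 0" for e
  proof -
    obtain N where "\<forall>m\<ge>N. \<forall>n\<ge>N. ip H (\<lambda>x. s m x - s n x) (\<lambda>x. s m x - s n x) < e\<^sup>2"
      using c[of "e\<^sup>2"] zero_less_power[OF e] by blast
    then have "\<forall>m\<ge>N. \<forall>n\<ge>N. hnorm H (\<lambda>x. s m x - s n x) < e"
      unfolding hnorm_def using e by (auto intro: real_less_lsqrt)
    then show ?thesis by blast
  qed
  moreover have "range s \<subseteq> elems H" using s by auto
  ultimately obtain f where f: "f \<in> elems H" "(\<lambda>n. hnorm H (\<lambda>x. s n x - f x)) \<longlonglongrightarrow> 0"
    using complete_hnorm[of s] by blast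
  have "(\<lambda>n. ip H (\<lambda>x. s n x - f x) (\<lambda>x. s n x - f x)) \<longlonglongrightarrow> 0"
    using tendsto_power[OF f(2), of 2] by (simp add: hnorm_def ip_nonneg)
  with f(1) that show ?thesis by blast
qed

text \<open>
  By Bessel's inequality the partial sums of the expansion form a Cauchy sequence; the difference
  of \<open>f\<close> and their limit is orthogonal to the system.
\<close>

lemma parseval:
  fixes e :: "nat \<Rightarrow> 'x \<Rightarrow> real"
  assumes e: "\<And>j. j \<ge> 1 \<Longrightarrow> e j \<in> elems H"
    and orth: "\<And>i j. i \<ge> 1 \<Longrightarrow> j \<ge> 1 \<Longrightarrow> ip H (e i) (e j) = (if i = j then 1 else 0)"
    and total: "\<And>f. f \<in> elems H \<Longrightarrow> \<forall>j\<ge>1. ip H f (e j) = 0 \<Longrightarrow> f = (\<lambda>_. 0)"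
    and f: "f \<in> elems H" and g: "g \<in> elems H"
  shows "((\<lambda>j. ip H f (e j) * ip H g (e j)) has_sum ip H f g) {1..}"
proof -
  have sq: "((\<lambda>j. (ip H f (e j))\<^sup>2) has_sum ip H f f) {1..}" if f: "f \<in> elems H" for f
  proof -
    define c where "c j = ip H f (e j)" for j
    define s where "s n = (\<lambda>x. \<Sum>j\<in>{1..n}. c j * e j x)" for n
    have s: "s n \<in> elems H" for n unfolding s_def using e by (intro sum_mem mult) auto
    have se: "ip H (e j) (s n) = (if j \<le> n then c j else 0)" if "j \<ge> 1" for j n
    proof -
      have "ip H (e j) (s n) = (\<Sum>i\<in>{1..n}. c i * ip H (e j) (e i))"
        unfolding s_def using e that by (subst ip_sum_right) (auto intro: mult simp: ip_mult_right)
      also have "\<dots> = (\<Sum>i\<in>{1..n}. if i = j then c i else 0)"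
        using orth that by (intro sum.cong) auto
      finally show ?thesis using that by (simp add: sum.delta)
    qed
    have gs: "ip H g (s n) = (\<Sum>i\<in>{1..n}. c i * ip H g (e i))" if "g \<in> elems H" for g n
      unfolding s_def using e that by (subst ip_sum_right) (auto intro: mult simp: ip_mult_right)
    have ss: "ip H (s m) (s n) = (\<Sum>i\<in>{1..min m n}. (c i)\<^sup>2)" for m n
    proof -
      have "ip H (s m) (s n) = (\<Sum>i\<in>{1..n}. c i * ip H (e i) (s m))"
        using gs[OF s] by (simp add: ip_commute)
      also have "\<dots> = (\<Sum>i\<in>{1..n}. if i \<le> m then (c i)\<^sup>2 else 0)"
        using se by (intro sum.cong) (auto simp: power2_eq_square)
      also have "\<dots> = (\<Sum>i\<in>{1..min m n}. (c i)\<^sup>2)"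
        by (intro sum.mono_neutral_cong_right) auto
      finally show ?thesis .
    qed
    have fs: "ip H f (s n) = (\<Sum>i\<in>{1..n}. (c i)\<^sup>2)" for n
      using gs[OF f] by (simp add: c_def power2_eq_square)
    define S where "S n = (\<Sum>i\<in>{1..n}. (c i)\<^sup>2)" for n
    have bessel: "S n \<le> ip H f f" for n
      using ip_nonneg[of "\<lambda>x. f x - s n x"] ss[of n n] fs[of n] by (simp add: ip_diff_self f s S_def)
    have "incseq S" unfolding S_def by (intro incseq_SucI) simp
    from incseq_convergent[OF this, of "ip H f f"] bessel obtain L where L: "S \<longlonglongrightarrow> L" by blast
    have dist: "ip H (\<lambda>x. s m x - s n x) (\<lambda>x. s m x - s n x) = \<bar>S m - S n\<bar>" for m n
    proof -
      have "ip H (\<lambda>x. s m x - s n x) (\<lambda>x. s m x - s n x) = S m - 2 * S (min m n) + S n"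
        using s by (simp add: ip_diff_self ss S_def)
      then show ?thesis
        using incseqD[OF \<open>incseq S\<close>, of m n] incseqD[OF \<open>incseq S\<close>, of n m]
        by (cases "m \<le> n") (auto simp: min_def)
    qed
    have "\<exists>N. \<forall>m\<ge>N. \<forall>n\<ge>N. ip H (\<lambda>x. s m x - s n x) (\<lambda>x. s m x - s n x) < e" if "e > 0" for e
      using metric_CauchyD[OF LIMSEQ_imp_Cauchy[OF L] that] by (simp add: dist dist_real_def)
    from complete[OF s this] obtain g where g: "g \<in> elems H"
      and lim: "(\<lambda>n. ip H (\<lambda>x. s n x - g x) (\<lambda>x. s n x - g x)) \<longlonglongrightarrow> 0" by blast
    have "f = g"
    proof -
      have "ip H (\<lambda>x. f x - g x) (e j) = 0" if j: "j \<ge> 1" for j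
      proof -
        have "(ip H (\<lambda>x. f x - g x) (e j))\<^sup>2 \<le> ip H (\<lambda>x. s n x - g x) (\<lambda>x. s n x - g x)"
          if n: "n \<ge> j" for n
        proof -
          have "ip H (\<lambda>x. f x - g x) (e j) = ip H (\<lambda>x. s n x - g x) (e j)"
            using se[OF j, of n] n e[OF j] f g s by (simp add: ip_diff c_def ip_commute[of "s n"])
          also have "(\<dots>)\<^sup>2 \<le> ip H (\<lambda>x. s n x - g x) (\<lambda>x. s n x - g x) * ip H (e j) (e j)"
            by (rule Cauchy_Schwarz)
          finally show ?thesis using orth[OF j j] by simp
        qed
        then have "(ip H (\<lambda>x. f x - g x) (e j))\<^sup>2 \<le> 0"
          by (intro LIMSEQ_le_const[OF lim]) blast
        then show ?thesis by simp
      qed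
      then have "(\<lambda>x. f x - g x) = (\<lambda>_. 0)" by (intro total diff f g) auto
      then show ?thesis by (metis (no_types) eq_iff_diff_eq_0 ext)
    qed
    have "ip H (\<lambda>x. s n x - g x) (\<lambda>x. s n x - g x) = ip H f f - S n" for n
      using ip_diff_self[OF s[of n] f] ss[of n n] fs[of n] ip_commute[of f "s n"]
      by (simp add: \<open>f = g\<close> S_def)
    with lim have "(\<lambda>n. ip H f f - S n) \<longlonglongrightarrow> 0" by simp
    then have "(\<lambda>n. ip H f f - (ip H f f - S n)) \<longlonglongrightarrow> ip H f f - 0"
      by (intro tendsto_diff tendsto_const)
    then have "S \<longlonglongrightarrow> ip H f f" by simp
    moreover have "S = (\<lambda>n. \<Sum>i<n. (c (Suc i))\<^sup>2)"
      by (rule ext) (simp add: S_def sum.atLeast1_atMost_eq)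
    ultimately have "(\<lambda>i. (c (Suc i))\<^sup>2) sums ip H f f" by (simp add: sums_def)
    then have "((\<lambda>i. (c (Suc i))\<^sup>2) has_sum ip H f f) UNIV"
      by (subst sums_nonneg_imp_has_sum) auto
    then show ?thesis
      using has_sum_reindex_bij_betw[OF bij_betw_Suc, of "\<lambda>j. (c j)\<^sup>2" "ip H f f"] by (simp add: c_def)
  qed
  have "((\<lambda>j. (ip H (\<lambda>x. f x + g x) (e j))\<^sup>2 * (1/4) + (ip H (\<lambda>x. f x - g x) (e j))\<^sup>2 * (-1/4))
     has_sum (ip H (\<lambda>x. f x + g x) (\<lambda>x. f x + g x) * (1/4)
       + ip H (\<lambda>x. f x - g x) (\<lambda>x. f x - g x) * (-1/4))) {1..}"
    by (intro has_sum_add has_sum_cmult_left sq add diff f g)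
  also have "ip H (\<lambda>x. f x + g x) (\<lambda>x. f x + g x) * (1/4)
       + ip H (\<lambda>x. f x - g x) (\<lambda>x. f x - g x) * (-1/4) = ip H f g"
    by (simp add: ip_add_self ip_diff_self f g field_simps)
  finally show ?thesis
  proof (rule has_sum_cong[THEN iffD1, rotated])
    fix j :: nat assume "j \<in> {1..}"
    then show "(ip H (\<lambda>x. f x + g x) (e j))\<^sup>2 * (1/4) + (ip H (\<lambda>x. f x - g x) (e j))\<^sup>2 * (-1/4)
       = ip H f (e j) * ip H g (e j)"
      using e f g by (simp add: ip_add ip_diff power2_eq_square algebra_simps)
  qed
qed

end

lemma (in psd_kernel) comb_fun_add: "comb_fun D K (a @ b) = (\<lambda>x. comb_fun D K a x + comb_fun D K b x)"
  by (auto simp: comb_fun_def)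

lemma comb_fun_Cons:
  "x \<in> D \<Longrightarrow> comb_fun D K ((c, x) # a) = (\<lambda>y. c * kernel_section D K x y + comb_fun D K a y)"
  by (auto simp: comb_fun_def kernel_section_def)

lemma comb_fun_Nil [simp]: "comb_fun D K [] = (\<lambda>_. 0)"
  by (auto simp: comb_fun_def)

lemma ev_comb_fun: "a \<in> combs D \<Longrightarrow> ev (comb_fun D K b) a = pairing K a b"
  unfolding pairing_def by (rule ev_cong) (auto simp: comb_fun_def)

lemma is_rkhs_comb:
  assumes "is_rkhs D K H" and "a \<in> combs D"
  shows "comb_fun D K a \<in> elems H" and "f \<in> elems H \<Longrightarrow> ip H f (comb_fun D K a) = ev f a"
proof -
  interpret hilbert_functions D H using assms(1) by (simp add: hilbert_functions_def is_rkhs_def)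
  have "comb_fun D K a \<in> elems H \<and> (\<forall>f\<in>elems H. ip H f (comb_fun D K a) = ev f a)"
    using assms(2)
  proof (induction a)
    case (Cons p a)
    then show ?case using assms(1)
      by (cases p) (auto simp: comb_fun_Cons is_rkhs_def add mult ip_add_right ip_mult_right)
  qed auto
  then show "comb_fun D K a \<in> elems H" "f \<in> elems H \<Longrightarrow> ip H f (comb_fun D K a) = ev f a"
    by blast+
qed

lemma is_rkhs_imp_psd_kernel:
  assumes H: "is_rkhs D K H"
  shows "psd_kernel D K"
proof
  interpret hilbert_functions D H using assms(1) by (simp add: hilbert_functions_def is_rkhs_def)
  fix x y assume "x \<in> D" "y \<in> D"
  then show "K x y = K y x"
    using H ip_commute[of "kernel_section D K x" "kernel_section D K y"]
    by (simp add: is_rkhs_def) (simp add: kernel_section_def)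
next
  interpret hilbert_functions D H using assms(1) by (simp add: hilbert_functions_def is_rkhs_def)
  fix a assume "a \<in> combs D"
  then show "0 \<le> pairing K a a"
    using ip_nonneg[of "comb_fun D K a"] is_rkhs_comb[OF H] by (simp add: ev_comb_fun)
qed

context psd_kernel
begin

lemma q_diff_comb:
  "f \<in> V \<Longrightarrow> c \<in> combs D \<Longrightarrow> q (\<lambda>x. f x - comb_fun D K c x) = q f - 2 * ev f c + E c"
  using q_shift_eq[of f "scl (-1) c"] by (simp add: comb_fun_scl)

text \<open>
  In any Hilbert space with kernel \<open>K\<close> the norms of point combinations are the energies, and
  the energies determine \<open>sqn\<close>. A function in \<open>dom_fun D K\<close> is a limit of point combinations,
  so completeness puts it into the given space.
\<close>

lemma rkhs_unique:
  assumes H: "is_rkhs D K H"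
  shows "H = S"
proof -
  interpret hilbert_functions D H using H by (simp add: hilbert_functions_def is_rkhs_def)
  note comb = is_rkhs_comb[OF H]
  have 1: "f \<in> V" if f: "f \<in> elems H" for f
  proof -
    have "2 * ev f a - E a \<le> ip H f f" if "a \<in> combs D" for a
      using ip_nonneg[of "\<lambda>x. f x - comb_fun D K a x"] that f comb[OF that]
      by (simp add: ip_diff_self ev_comb_fun)
    then show ?thesis using f outside by (auto simp: dom_fun_def dominated_def)
  qed
  have 2: "f \<in> elems H \<and> ip H f f = q f" if f: "f \<in> V" for f
  proof -
    have "\<forall>n. \<exists>a\<in>combs D. q f - inverse (real (Suc n)) < 2 * ev f a - E a"
      using q_approx[OF f] by simp
    then obtain a where a: "\<And>n. a n \<in> combs D"
      and app: "\<And>n. q f - inverse (real (Suc n)) < 2 * ev f (a n) - E (a n)" by metis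
    define s where "s n = comb_fun D K (a n)" for n
    have s: "s n \<in> V" "s n \<in> elems H" for n using a comb comb_in_V by (auto simp: s_def)
    have qs: "q (\<lambda>x. f x - s n x) < inverse (real (Suc n))" for n
      using app[of n] q_diff_comb[OF f a] by (simp add: s_def)
    have sd: "ip H (\<lambda>x. s m x - s n x) (\<lambda>x. s m x - s n x) = q (\<lambda>x. s m x - s n x)" for m n
    proof -
      have eq: "(\<lambda>x. s m x - s n x) = comb_fun D K (a m @ scl (-1) (a n))"
        by (auto simp: s_def comb_fun_add comb_fun_scl)
      have m: "a m @ scl (-1) (a n) \<in> combs D" using a by simp
      show ?thesis unfolding eq using comb[OF m] q_shift_eq[OF zero_in_V m]
        by (simp only: ev_comb_fun[OF m] q_zero) simp
    qed
    have qsd: "q (\<lambda>x. s m x - s n x) \<le> 2 * inverse (real (Suc m)) + 2 * inverse (real (Suc n))" for m n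
    proof -
      have "q (\<lambda>x. (f x - s n x) - (f x - s m x))
          \<le> 2 * q (\<lambda>x. f x - s n x) + 2 * q (\<lambda>x. f x - s m x)"
        using parallelogram[OF diff_in_V[OF f s(1)[of n]] diff_in_V[OF f s(1)[of m]]]
          q_nonneg[OF add_in_V[OF diff_in_V[OF f s(1)[of n]] diff_in_V[OF f s(1)[of m]]]] by linarith
      moreover have "(\<lambda>x. (f x - s n x) - (f x - s m x)) = (\<lambda>x. s m x - s n x)" by auto
      ultimately show ?thesis using qs[of n] qs[of m] by simp
    qed
    have "\<exists>N. \<forall>m\<ge>N. \<forall>n\<ge>N. ip H (\<lambda>x. s m x - s n x) (\<lambda>x. s m x - s n x) < e" if e: "e > 0" for e
    proof -
      obtain N where N: "inverse (real (Suc N)) < e / 4"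
        using reals_Archimedean[of "e/4"] e by auto
      have inv: "inverse (real (Suc n)) < e / 4" if "n \<ge> N" for n
        by (rule le_less_trans[OF _ N]) (use that in simp)
      have "ip H (\<lambda>x. s m x - s n x) (\<lambda>x. s m x - s n x) < e" if "m \<ge> N" "n \<ge> N" for m n
        using qsd[of m n] inv[OF that(1)] inv[OF that(2)] unfolding sd by linarith
      then show ?thesis by blast
    qed
    from complete[OF s(2) this] obtain g where g: "g \<in> elems H"
      and lim: "(\<lambda>n. ip H (\<lambda>x. s n x - g x) (\<lambda>x. s n x - g x)) \<longlonglongrightarrow> 0" by blast
    have lim': "(\<lambda>n. q (\<lambda>x. f x - s n x)) \<longlonglongrightarrow> 0"
    proof (rule tendsto_sandwich[OF _ _ tendsto_const LIMSEQ_inverse_real_of_nat])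
      show "\<forall>\<^sub>F n in sequentially. 0 \<le> q (\<lambda>x. f x - s n x)"
        using q_nonneg[OF diff_in_V[OF f s(1)]] by simp
      show "\<forall>\<^sub>F n in sequentially. q (\<lambda>x. f x - s n x) \<le> inverse (real (Suc n))"
        using qs by (simp add: less_imp_le)
    qed
    have "f = g"
    proof
      fix x show "f x = g x"
      proof (cases "x \<in> D")
        case True
        have "(\<lambda>n. (s n x - g x)\<^sup>2) \<longlonglongrightarrow> 0"
        proof (rule tendsto_sandwich[OF _ _ tendsto_const])
          show "(\<lambda>n. ip H (\<lambda>x. s n x - g x) (\<lambda>x. s n x - g x) * K x x) \<longlonglongrightarrow> 0"
            using tendsto_mult_left_zero[OF lim] .
          have "(s n x - g x)\<^sup>2 \<le> ip H (\<lambda>x. s n x - g x) (\<lambda>x. s n x - g x) * K x x" for n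
            using Cauchy_Schwarz[of "\<lambda>x. s n x - g x" "kernel_section D K x"] H True
              diff[OF s(2)[of n] g] by (simp add: is_rkhs_def) (simp add: kernel_section_def)
          then show "\<forall>\<^sub>F n in sequentially. (s n x - g x)\<^sup>2
              \<le> ip H (\<lambda>x. s n x - g x) (\<lambda>x. s n x - g x) * K x x" by simp
        qed simp
        moreover have "(\<lambda>n. (f x - s n x)\<^sup>2) \<longlonglongrightarrow> 0"
        proof (rule tendsto_sandwich[OF _ _ tendsto_const])
          show "(\<lambda>n. q (\<lambda>x. f x - s n x) * K x x) \<longlonglongrightarrow> 0"
            using tendsto_mult_left_zero[OF lim'] .
          show "\<forall>\<^sub>F n in sequentially. (f x - s n x)\<^sup>2 \<le> q (\<lambda>x. f x - s n x) * K x x"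
            using point_bound[OF q_dominated[OF diff_in_V[OF f s(1)]] True] by simp
        qed simp
        ultimately have "(\<lambda>n. 2 * ((s n x - g x)\<^sup>2 + (f x - s n x)\<^sup>2)) \<longlonglongrightarrow> 2 * (0 + 0)"
          by (intro tendsto_intros)
        moreover have "(f x - g x)\<^sup>2 \<le> 2 * ((s n x - g x)\<^sup>2 + (f x - s n x)\<^sup>2)" for n
          using zero_le_power2[of "(s n x - g x) - (f x - s n x)"]
          by (simp add: power2_eq_square algebra_simps)
        ultimately have "(f x - g x)\<^sup>2 \<le> 2 * (0 + 0)" by (intro LIMSEQ_le_const) blast+
        then show ?thesis by simp
      qed (simp add: outside[OF g] V_outside[OF f])
    qed
    with g have fH: "f \<in> elems H" by simp
    have "(\<lambda>n. ip H (\<lambda>x. s n x - f x) (\<lambda>x. s n x - f x) - q (\<lambda>x. f x - s n x)) \<longlonglongrightarrow> 0 - 0"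
      using lim lim' \<open>f = g\<close> by (intro tendsto_diff) auto
    moreover have "ip H (\<lambda>x. s n x - f x) (\<lambda>x. s n x - f x) - q (\<lambda>x. f x - s n x) = ip H f f - q f" for n
      using q_diff_comb[OF f a[of n]] comb[OF a[of n]] fH ip_commute[of f "s n"] a[of n]
      by (simp add: s_def ip_diff_self ev_comb_fun)
    ultimately have "ip H f f = q f" by (simp add: LIMSEQ_const_iff)
    with fH show ?thesis by blast
  qed
  have el: "elems H = elems S" using 1 2 by auto
  have "ip H f g = ip S f g" for f g
  proof (cases "f \<in> V \<and> g \<in> V")
    case True
    then have "f \<in> elems H" "g \<in> elems H" using 2 by auto
    then have "ip H f g = (ip H (\<lambda>x. f x + g x) (\<lambda>x. f x + g x) - ip H (\<lambda>x. f x - g x) (\<lambda>x. f x - g x)) / 4"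
      by (simp add: ip_add_self ip_diff_self)
    with True show ?thesis using 2 by (simp add: ip_dual add_in_V diff_in_V)
  next
    case False
    then show ?thesis using ip_outside el by (auto simp: dual_space_def)
  qed
  then have "ip H = ip S" by (intro ext)
  with el show ?thesis by (intro fun_space.equality) auto
qed

lemma rkhs_eq_dual: "rkhs D K = S"
  unfolding rkhs_def using is_rkhs_dual rkhs_unique by (rule the_equality)

lemma is_rkhs: "is_rkhs D K (rkhs D K)"
  by (simp add: rkhs_eq_dual is_rkhs_dual)

end

context psd_kernel
begin

abbreviation H where "H \<equiv> rkhs D K"

sublocale hilbert_functions D H
  using is_rkhs by (simp add: hilbert_functions_def is_rkhs_def)

lemma mem_rkhs: "f \<in> elems H \<longleftrightarrow> (\<forall>x. x \<notin> D \<longrightarrow> f x = 0) \<and> (\<exists>C. dominated D K f C)"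
  by (simp add: rkhs_eq_dual dom_fun_def)

lemma dominated_self: "f \<in> elems H \<Longrightarrow> dominated D K f (ip H f f)"
  by (simp add: rkhs_eq_dual ip_self_dual q_dominated)

lemma ip_self_least: "f \<in> elems H \<Longrightarrow> dominated D K f C \<Longrightarrow> ip H f f \<le> C"
  by (simp add: rkhs_eq_dual ip_self_dual q_least)

lemma comb_mem [simp]: "a \<in> combs D \<Longrightarrow> comb_fun D K a \<in> elems H"
  and ip_comb: "a \<in> combs D \<Longrightarrow> f \<in> elems H \<Longrightarrow> ip H f (comb_fun D K a) = ev f a"
  using is_rkhs_comb[OF is_rkhs] by auto

lemma section_mem: "x \<in> D \<Longrightarrow> kernel_section D K x \<in> elems H"
  and ip_section: "x \<in> D \<Longrightarrow> f \<in> elems H \<Longrightarrow> ip H f (kernel_section D K x) = f x"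
  using is_rkhs by (auto simp: is_rkhs_def)

lemma diag_nonneg: "x \<in> D \<Longrightarrow> 0 \<le> K x x"
  using psd[of "[(1, x)]"] by (simp add: pairing_def)

lemma mem_sq_le: "f \<in> elems H \<Longrightarrow> x \<in> D \<Longrightarrow> (f x)\<^sup>2 \<le> ip H f f * K x x"
  using point_bound[OF dominated_self] .

text \<open>
  By \<open>q_diff_comb\<close>, the difference of the supremum and the value at \<open>a\<close> is the squared distance of \<open>f\<close>
  to the combination \<open>a\<close>.
\<close>

lemma dense:
  assumes f: "f \<in> elems H" and e: "e > 0"
  obtains a where "a \<in> combs D" "ip H (\<lambda>x. f x - comb_fun D K a x) (\<lambda>x. f x - comb_fun D K a x) < e"
proof -
  from f have "f \<in> V" by (simp add: rkhs_eq_dual)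
  from q_approx[OF this e] obtain a where a: "a \<in> combs D" "q f - e < 2 * ev f a - E a" by blast
  have "q f = ip H f f" using \<open>f \<in> V\<close> by (simp add: rkhs_eq_dual ip_self_dual)
  with a f show ?thesis by (intro that[OF a(1)]) (simp add: ip_diff_self ip_comb ev_comb_fun)
qed

text \<open>
  A bounded functional is represented by the function of its values on the kernel sections:
  the two functionals agree on point combinations, which are dense.
\<close>

lemma riesz:
  fixes L :: "('x \<Rightarrow> real) \<Rightarrow> real"
  assumes L_add: "\<And>f g. f \<in> elems H \<Longrightarrow> g \<in> elems H \<Longrightarrow> L (\<lambda>x. f x + g x) = L f + L g"
    and L_mult: "\<And>t f. f \<in> elems H \<Longrightarrow> L (\<lambda>x. t * f x) = t * L f"
    and bound: "\<And>f. f \<in> elems H \<Longrightarrow> (L f)\<^sup>2 \<le> C * ip H f f" and C: "0 \<le> C"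
  defines "h \<equiv> \<lambda>x. if x \<in> D then L (kernel_section D K x) else 0"
  shows "h \<in> elems H" and "\<And>f. f \<in> elems H \<Longrightarrow> ip H f h = L f"
proof -
  have Lcomb: "L (comb_fun D K a) = ev h a" if "a \<in> combs D" for a
    using that
  proof (induction a)
    case Nil
    then show ?case using L_mult[of "\<lambda>_. 0" 0] by simp
  next
    case (Cons p a)
    then show ?case
      by (cases p) (simp add: comb_fun_Cons L_add L_mult mult section_mem h_def)
  qed
  have "dominated D K h C"
  proof (rule dominated_of_sq[OF C])
    fix a assume a: "a \<in> combs D"
    show "(ev h a)\<^sup>2 \<le> C * E a"
      using bound[OF comb_mem[OF a]] a by (simp add: Lcomb ip_comb ev_comb_fun)
  qed
  then show h: "h \<in> elems H" by (auto simp: mem_rkhs h_def)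
  fix f assume f: "f \<in> elems H"
  define M where "M f = ip H f h - L f" for f
  have M_bound: "(M g)\<^sup>2 \<le> 2 * (ip H h h + C) * ip H g g" if "g \<in> elems H" for g
  proof -
    have "(M g)\<^sup>2 \<le> 2 * ((ip H g h)\<^sup>2 + (L g)\<^sup>2)"
      using zero_le_power2[of "ip H g h + L g"] by (simp add: M_def power2_eq_square algebra_simps)
    also have "\<dots> \<le> 2 * (ip H g g * ip H h h + C * ip H g g)"
      using Cauchy_Schwarz[of g h] bound[OF that] by simp
    finally show ?thesis by (simp add: algebra_simps)
  qed
  have "(M f)\<^sup>2 \<le> 0"
  proof (rule field_le_epsilon)
    fix e :: real assume "e > 0"
    define B where "B = 2 * (ip H h h + C) + 1"
    have B: "B > 0" using C ip_nonneg[of h] by (simp add: B_def)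
    with \<open>e > 0\<close> obtain a where a: "a \<in> combs D"
      and d: "ip H (\<lambda>x. f x - comb_fun D K a x) (\<lambda>x. f x - comb_fun D K a x) < e / B"
      using dense[OF f, of "e / B"] by auto
    let ?g = "\<lambda>x. f x - comb_fun D K a x"
    have g: "?g \<in> elems H" using f a by (intro diff) auto
    have "L f = L ?g + L (comb_fun D K a)" using L_add[OF g comb_mem[OF a]] by simp
    then have "M f = M ?g"
      using f a h by (simp add: M_def ip_diff Lcomb ip_commute[of "comb_fun D K a"] ip_comb)
    also have "(M ?g)\<^sup>2 \<le> 2 * (ip H h h + C) * ip H ?g ?g" by (rule M_bound[OF g])
    also have "\<dots> \<le> B * ip H ?g ?g" using ip_nonneg[of ?g] by (intro mult_right_mono) (auto simp: B_def)
    also have "\<dots> \<le> B * (e / B)" using d B by (intro mult_left_mono) auto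
    finally show "(M f)\<^sup>2 \<le> 0 + e" using B by simp
  qed
  then show "ip H f h = L f" by (simp add: M_def)
qed

end

subsection \<open>Sums of kernels\<close>

lemma dominated_mono:
  assumes "dominated D K1 f C" "\<And>a. a \<in> combs D \<Longrightarrow> pairing K1 a a \<le> pairing K2 a a"
  shows "dominated D K2 f C"
  using assms by (fastforce simp: dominated_def)

locale two_kernels = K1: psd_kernel D K1 + K2: psd_kernel D K2
  for D :: "'x set" and K1 K2 :: "'x \<Rightarrow> 'x \<Rightarrow> real"
begin

abbreviation K12 where "K12 \<equiv> \<lambda>x y. K1 x y + K2 x y"

sublocale K12: psd_kernel D K12
  by standard (simp_all add: K1.sym K2.sym pairing_add K1.psd K2.psd)

lemma left_mem: "f \<in> elems K1.H \<Longrightarrow> f \<in> elems K12.H" "f \<in> elems K1.H \<Longrightarrow> ip K12.H f f \<le> ip K1.H f f"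
  and right_mem: "f \<in> elems K2.H \<Longrightarrow> f \<in> elems K12.H" "f \<in> elems K2.H \<Longrightarrow> ip K12.H f f \<le> ip K2.H f f"
proof -
  have 1: "dominated D K12 f C" if "dominated D K1 f C" for f C
    using that by (rule dominated_mono) (simp add: pairing_add K2.psd)
  have 2: "dominated D K12 f C" if "dominated D K2 f C" for f C
    using that by (rule dominated_mono) (simp add: pairing_add K1.psd)
  show l: "f \<in> elems K1.H \<Longrightarrow> f \<in> elems K12.H" and r: "f \<in> elems K2.H \<Longrightarrow> f \<in> elems K12.H"
    unfolding K1.mem_rkhs K2.mem_rkhs K12.mem_rkhs using 1 2 by blast+
  show "f \<in> elems K1.H \<Longrightarrow> ip K12.H f f \<le> ip K1.H f f"
    "f \<in> elems K2.H \<Longrightarrow> ip K12.H f f \<le> ip K2.H f f"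
    using l r 1 2 K1.dominated_self K2.dominated_self by (auto intro: K12.ip_self_least)
qed

text \<open>
  The two components of \<open>f\<close> are \<open>f\<^sub>i(x) = \<langle>f, K\<^sub>i(\<cdot>,x)\<rangle>\<close>, the inner product being the one for the
  sum of the kernels. Testing \<open>f\<close> against \<open>K\<^sub>1(\<cdot>,a) + K\<^sub>2(\<cdot>,b)\<close> with independent \<open>a\<close> and \<open>b\<close>
  bounds the two norms simultaneously.
\<close>

lemma split:
  assumes f: "f \<in> elems K12.H"
  obtains f1 f2 where "f1 \<in> elems K1.H" "f2 \<in> elems K2.H" "f = (\<lambda>x. f1 x + f2 x)"
    "ip K1.H f1 f1 + ip K2.H f2 f2 \<le> ip K12.H f f"
proof -
  let ?c1 = "comb_fun D K1" and ?c2 = "comb_fun D K2"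
  have c1: "?c1 a \<in> elems K12.H" if "a \<in> combs D" for a using left_mem K1.comb_mem that by blast
  have c2: "?c2 a \<in> elems K12.H" if "a \<in> combs D" for a using right_mem K2.comb_mem that by blast
  define f1 where "f1 x = (if x \<in> D then ip K12.H f (?c1 [(1, x)]) else 0)" for x
  define f2 where "f2 x = (if x \<in> D then ip K12.H f (?c2 [(1, x)]) else 0)" for x
  have ev1: "ev f1 a = ip K12.H f (?c1 a)" if "a \<in> combs D" for a using that
  proof (induction a)
    case (Cons p a)
    have eq: "?c1 (p # a) = (\<lambda>x. fst p * ?c1 [(1, snd p)] x + ?c1 a x)" by (auto simp: comb_fun_def)
    from Cons show ?case unfolding eq using f c1
      by (simp add: K12.ip_add_right K12.ip_mult_right K12.mult f1_def)
  qed simp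
  have ev2: "ev f2 a = ip K12.H f (?c2 a)" if "a \<in> combs D" for a using that
  proof (induction a)
    case (Cons p a)
    have eq: "?c2 (p # a) = (\<lambda>x. fst p * ?c2 [(1, snd p)] x + ?c2 a x)" by (auto simp: comb_fun_def)
    from Cons show ?case unfolding eq using f c2
      by (simp add: K12.ip_add_right K12.ip_mult_right K12.mult f2_def)
  qed simp
  have key: "(2 * ev f1 a - pairing K1 a a) + (2 * ev f2 b - pairing K2 b b) \<le> ip K12.H f f"
    if a: "a \<in> combs D" and b: "b \<in> combs D" for a b
  proof -
    let ?p = "\<lambda>x. ?c1 a x + ?c2 b x"
    have p: "?p \<in> elems K12.H" using c1 c2 a b by (intro K12.add) auto
    have "dominated D K12 ?p (pairing K1 a a + pairing K2 b b)"
      unfolding dominated_def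
    proof
      fix c assume c: "c \<in> combs D"
      have "2 * ev (?c1 a) c - pairing K1 c c \<le> pairing K1 a a"
        "2 * ev (?c2 b) c - pairing K2 c c \<le> pairing K2 b b"
        using K1.dominated_self[OF K1.comb_mem[OF a]] K2.dominated_self[OF K2.comb_mem[OF b]] c a b
        by (simp_all add: dominated_def K1.ip_comb K2.ip_comb ev_comb_fun)
      then show "2 * ev ?p c - pairing K12 c c \<le> pairing K1 a a + pairing K2 b b"
        by (simp add: ev_add pairing_add)
    qed
    from K12.ip_self_least[OF p this] K12.ip_nonneg[of "\<lambda>x. f x - ?p x"]
    have "2 * ip K12.H f ?p - pairing K1 a a - pairing K2 b b \<le> ip K12.H f f"
      by (simp add: K12.ip_diff_self f p)
    then show ?thesis using ev1[OF a] ev2[OF b] c1[OF a] c2[OF b] f by (simp add: K12.ip_add_right)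
  qed
  have "dominated D K1 f1 (ip K12.H f f)" "dominated D K2 f2 (ip K12.H f f)"
    using key[of _ "[]"] key[of "[]"] by (auto simp: dominated_def)
  then have f1: "f1 \<in> elems K1.H" and f2: "f2 \<in> elems K2.H"
    by (auto simp: K1.mem_rkhs K2.mem_rkhs f1_def f2_def)
  have "ip K1.H f1 f1 \<le> ip K12.H f f - (2 * ev f2 b - pairing K2 b b)" if "b \<in> combs D" for b
    by (rule K1.ip_self_least[OF f1]) (use key[OF _ that] in \<open>auto simp: dominated_def algebra_simps\<close>)
  then have "dominated D K2 f2 (ip K12.H f f - ip K1.H f1 f1)" by (fastforce simp: dominated_def)
  from K2.ip_self_least[OF f2 this] have le: "ip K1.H f1 f1 + ip K2.H f2 f2 \<le> ip K12.H f f" by simp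
  have "f x = f1 x + f2 x" for x
  proof (cases "x \<in> D")
    case True
    have "kernel_section D K12 x = (\<lambda>y. ?c1 [(1, x)] y + ?c2 [(1, x)] y)"
      by (auto simp: kernel_section_def comb_fun_def)
    then show ?thesis using K12.ip_section[OF True f] c1[of "[(1, x)]"] c2[of "[(1, x)]"] True f
      by (simp add: f1_def f2_def K12.ip_add_right)
  qed (use K12.outside[OF f] in \<open>simp add: f1_def f2_def\<close>)
  with that f1 f2 le show ?thesis by blast
qed

text \<open>
  If the two spaces meet only in zero, the components are unique, and the inequality of
  \<open>split\<close> applied to \<open>f \<plusminus> g\<close> leaves no room for a nonzero inner product.
\<close>

lemma orthogonal:
  assumes disj: "\<And>f. f \<in> elems K1.H \<Longrightarrow> f \<in> elems K2.H \<Longrightarrow> f = (\<lambda>_. 0)"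
    and f: "f \<in> elems K1.H" and g: "g \<in> elems K2.H"
  shows "ip K12.H f g = 0"
proof -
  have fg: "f \<in> elems K12.H" "g \<in> elems K12.H" using left_mem right_mem f g by blast+
  have main: "0 \<le> ip K12.H f h" if h: "h \<in> elems K2.H" for h
  proof -
    have hK: "h \<in> elems K12.H" using right_mem h by blast
    obtain f1 h2 where *: "f1 \<in> elems K1.H" "h2 \<in> elems K2.H"
      "(\<lambda>x. f x + h x) = (\<lambda>x. f1 x + h2 x)"
      "ip K1.H f1 f1 + ip K2.H h2 h2 \<le> ip K12.H (\<lambda>x. f x + h x) (\<lambda>x. f x + h x)"
      using split[OF K12.add[OF fg(1) hK]] by blast
    have "(\<lambda>x. f x - f1 x) = (\<lambda>x. h2 x - h x)"
      using fun_cong[OF *(3)] by (auto simp: algebra_simps)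
    moreover have "(\<lambda>x. f x - f1 x) \<in> elems K1.H" "(\<lambda>x. h2 x - h x) \<in> elems K2.H"
      using f h * by (auto intro: K1.diff K2.diff)
    ultimately have z: "(\<lambda>x. f x - f1 x) = (\<lambda>_. 0)" "(\<lambda>x. h2 x - h x) = (\<lambda>_. 0)"
      using disj by metis+
    have "f1 = f" using fun_cong[OF z(1)] by auto
    moreover have "h2 = h" using fun_cong[OF z(2)] by auto
    ultimately have "ip K1.H f f + ip K2.H h h \<le> ip K12.H f f + 2 * ip K12.H f h + ip K12.H h h"
      using *(4) fg hK by (simp add: K12.ip_add_self)
    then show ?thesis using left_mem(2)[OF f] right_mem(2)[OF h] by simp
  qed
  from main[OF g] main[OF K2.mult[OF g, of "-1"]] K12.ip_mult_right[OF fg(2,1), of "-1"] show ?thesis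
    by simp
qed

end

subsection \<open>Series of rank-one kernels\<close>

lemma has_sum_ev:
  "a \<in> combs D \<Longrightarrow> (\<And>x. x \<in> D \<Longrightarrow> ((\<lambda>i. f i x) has_sum g x) I) \<Longrightarrow> ((\<lambda>i. ev (f i) a) has_sum ev g a) I"
  by (induction a) (auto intro!: has_sum_add has_sum_cmult_right)

lemma has_sum_pairing:
  assumes "a \<in> combs D" "b \<in> combs D"
    "\<And>x y. x \<in> D \<Longrightarrow> y \<in> D \<Longrightarrow> ((\<lambda>i. \<kappa> i x y) has_sum K x y) I"
  shows "((\<lambda>i. pairing (\<kappa> i) a b) has_sum pairing K a b) I"
  unfolding pairing_def using assms by (intro has_sum_ev[of _ D]) auto

lemma psd_kernel_has_sum:
  assumes "\<And>i. i \<in> I \<Longrightarrow> psd_kernel D (\<kappa> i)"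
    and s: "\<And>x y. x \<in> D \<Longrightarrow> y \<in> D \<Longrightarrow> ((\<lambda>i. \<kappa> i x y) has_sum K x y) I"
  shows "psd_kernel D K"
proof
  fix x y assume xy: "x \<in> D" "y \<in> D"
  have "((\<lambda>i. \<kappa> i x y) has_sum K y x) I"
    using s[OF xy(2,1)] by (rule has_sum_cong[THEN iffD1, rotated])
      (use psd_kernel.sym[OF assms(1)] xy in auto)
  from has_sum_unique[OF s[OF xy] this] show "K x y = K y x" .
next
  fix a assume a: "a \<in> combs D"
  show "0 \<le> pairing K a a"
    by (rule has_sum_nonneg[OF has_sum_pairing[OF a a s]]) (use psd_kernel.psd[OF assms(1) a] in auto)
qed

lemma psd_rank_one: "psd_kernel D (\<lambda>x y. h x * h y)"
  by standard (simp_all add: pairing_rank_one)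

text \<open>
  For a kernel \<open>\<Sum>\<^sub>i \<eta>\<^sub>i(x) \<eta>\<^sub>i(y)\<close> the functions \<open>\<eta>\<^sub>i\<close> need not be orthogonal in \<open>H(K)\<close>; they
  always form a Parseval frame, and that is enough for the expansion of every element.
\<close>

locale kernel_series =
  fixes D :: "'x set" and K :: "'x \<Rightarrow> 'x \<Rightarrow> real" and I :: "'i set" and \<eta> :: "'i \<Rightarrow> 'x \<Rightarrow> real"
  assumes series: "x \<in> D \<Longrightarrow> y \<in> D \<Longrightarrow> ((\<lambda>i. \<eta> i x * \<eta> i y) has_sum K x y) I"
    and eta_outside: "i \<in> I \<Longrightarrow> x \<notin> D \<Longrightarrow> \<eta> i x = 0"
begin

sublocale psd_kernel D K
  by (rule psd_kernel_has_sum[OF psd_rank_one series])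

lemma energy_series: "a \<in> combs D \<Longrightarrow> ((\<lambda>i. (ev (\<eta> i) a)\<^sup>2) has_sum pairing K a a) I"
  using has_sum_pairing[of a D a "\<lambda>i x y. \<eta> i x * \<eta> i y" I K] series
  by (simp add: pairing_rank_one power2_eq_square)

lemma finite_combination:
  assumes F: "finite F" "F \<subseteq> I"
  shows "(\<lambda>x. \<Sum>i\<in>F. b i * \<eta> i x) \<in> elems H"
    and "ip H (\<lambda>x. \<Sum>i\<in>F. b i * \<eta> i x) (\<lambda>x. \<Sum>i\<in>F. b i * \<eta> i x) \<le> (\<Sum>i\<in>F. (b i)\<^sup>2)"
proof -
  have "dominated D K (\<lambda>x. \<Sum>i\<in>F. b i * \<eta> i x) (\<Sum>i\<in>F. (b i)\<^sup>2)"
    unfolding dominated_def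
  proof
    fix a assume a: "a \<in> combs D"
    have "2 * ev (\<lambda>x. \<Sum>i\<in>F. b i * \<eta> i x) a = (\<Sum>i\<in>F. 2 * b i * ev (\<eta> i) a)"
      by (simp add: ev_sum ev_mult sum_distrib_left mult.assoc)
    also have "\<dots> \<le> (\<Sum>i\<in>F. (b i)\<^sup>2 + (ev (\<eta> i) a)\<^sup>2)"
      by (intro sum_mono sum_squares_bound)
    also have "\<dots> \<le> (\<Sum>i\<in>F. (b i)\<^sup>2) + pairing K a a"
      using has_sum_mono_neutral[OF has_sum_finite[OF F(1)] energy_series[OF a], of "\<lambda>i. (ev (\<eta> i) a)\<^sup>2"] F(2)
      by (auto simp: sum.distrib)
    finally show "2 * ev (\<lambda>x. \<Sum>i\<in>F. b i * \<eta> i x) a - pairing K a a \<le> (\<Sum>i\<in>F. (b i)\<^sup>2)" by simp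
  qed
  moreover from this show "(\<lambda>x. \<Sum>i\<in>F. b i * \<eta> i x) \<in> elems H"
    using F eta_outside by (auto simp: mem_rkhs intro!: sum.neutral)
  ultimately show "ip H (\<lambda>x. \<Sum>i\<in>F. b i * \<eta> i x) (\<lambda>x. \<Sum>i\<in>F. b i * \<eta> i x) \<le> (\<Sum>i\<in>F. (b i)\<^sup>2)"
    by (intro ip_self_least)
qed

lemma eta_mem: "i \<in> I \<Longrightarrow> \<eta> i \<in> elems H"
  using finite_combination(1)[of "{i}" "\<lambda>_. 1"] by simp

lemma ip_finite_combination:
  assumes "finite F" "F \<subseteq> I" "f \<in> elems H"
  shows "ip H f (\<lambda>x. \<Sum>i\<in>F. b i * \<eta> i x) = (\<Sum>i\<in>F. b i * ip H f (\<eta> i))"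
  using assms eta_mem by (subst ip_sum_right) (auto intro: mult simp: ip_mult_right subset_iff)

lemma bessel:
  assumes F: "finite F" "F \<subseteq> I" and f: "f \<in> elems H"
  shows "(\<Sum>i\<in>F. (ip H f (\<eta> i))\<^sup>2) \<le> ip H f f"
  using ip_nonneg[of "\<lambda>x. f x - (\<Sum>i\<in>F. ip H f (\<eta> i) * \<eta> i x)"]
    finite_combination[OF F, of "\<lambda>i. ip H f (\<eta> i)"] f
  by (simp add: ip_diff_self ip_finite_combination[OF F f] power2_eq_square)

text \<open>
  The remainder at \<open>x\<close> is the inner product of \<open>f\<close> with the section at \<open>x\<close> minus its partial sum, and
  the squared norm of that difference is at most the tail of the series for \<open>K(x,x)\<close>.
\<close>

lemma expansion:
  assumes f: "f \<in> elems H" and x: "x \<in> D"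
  shows "((\<lambda>i. ip H f (\<eta> i) * \<eta> i x) has_sum f x) I"
proof -
  define r where "r F = K x x - (\<Sum>i\<in>F. (\<eta> i x)\<^sup>2)" for F
  have "((\<lambda>F. K x x - (\<Sum>i\<in>F. (\<eta> i x)\<^sup>2)) \<longlongrightarrow> K x x - K x x) (finite_subsets_at_top I)"
    using series[OF x x] unfolding has_sum_def by (intro tendsto_intros) (simp add: power2_eq_square)
  then have r0: "(r \<longlongrightarrow> 0) (finite_subsets_at_top I)" by (simp add: r_def[abs_def])
  have bound: "(f x - (\<Sum>i\<in>F. ip H f (\<eta> i) * \<eta> i x))\<^sup>2 \<le> ip H f f * r F" if F: "finite F" "F \<subseteq> I" for F
  proof -
    let ?s = "\<lambda>y. \<Sum>i\<in>F. \<eta> i x * \<eta> i y" and ?k = "kernel_section D K x"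
    have s: "?s \<in> elems H" "ip H ?s ?s \<le> (\<Sum>i\<in>F. (\<eta> i x)\<^sup>2)"
      using finite_combination[OF F, of "\<lambda>i. \<eta> i x"] by auto
    have "ip H ?k ?s = (\<Sum>i\<in>F. (\<eta> i x)\<^sup>2)"
      using ip_section[OF x s(1)] by (simp add: ip_commute[of ?k] power2_eq_square)
    moreover have "ip H ?k ?k = K x x"
      using ip_section[OF x section_mem[OF x]] x by (simp add: kernel_section_def)
    ultimately have "ip H (\<lambda>y. ?k y - ?s y) (\<lambda>y. ?k y - ?s y) \<le> r F"
      using s by (simp add: ip_diff_self section_mem x r_def)
    then have "ip H f f * ip H (\<lambda>y. ?k y - ?s y) (\<lambda>y. ?k y - ?s y) \<le> ip H f f * r F"
      by (intro mult_left_mono ip_nonneg)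
    moreover have "ip H f (\<lambda>y. ?k y - ?s y) = f x - (\<Sum>i\<in>F. ip H f (\<eta> i) * \<eta> i x)"
      using ip_section[OF x f] f s section_mem[OF x]
      by (subst ip_diff_right, (simp_all add: ip_finite_combination[OF F f])[4]) (simp add: mult.commute)
    ultimately show ?thesis using Cauchy_Schwarz[of f "\<lambda>y. ?k y - ?s y"] by simp
  qed
  have "((\<lambda>F. (f x - (\<Sum>i\<in>F. ip H f (\<eta> i) * \<eta> i x))\<^sup>2) \<longlongrightarrow> 0) (finite_subsets_at_top I)"
  proof (rule tendsto_sandwich[OF _ _ tendsto_const])
    show "((\<lambda>F. ip H f f * r F) \<longlongrightarrow> 0) (finite_subsets_at_top I)"
      using tendsto_mult_right_zero[OF r0] .
    show "\<forall>\<^sub>F F in finite_subsets_at_top I. (f x - (\<Sum>i\<in>F. ip H f (\<eta> i) * \<eta> i x))\<^sup>2 \<le> ip H f f * r F"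
      using bound by (intro eventually_finite_subsets_at_top_weakI) auto
  qed simp
  from tendsto_real_sqrt[OF this]
  have "((\<lambda>F. \<bar>f x - (\<Sum>i\<in>F. ip H f (\<eta> i) * \<eta> i x)\<bar>) \<longlongrightarrow> 0) (finite_subsets_at_top I)" by simp
  then have "((\<lambda>F. f x - (\<Sum>i\<in>F. ip H f (\<eta> i) * \<eta> i x)) \<longlongrightarrow> 0) (finite_subsets_at_top I)"
    by (simp add: tendsto_rabs_zero_iff)
  then have "((\<lambda>F. f x - (f x - (\<Sum>i\<in>F. ip H f (\<eta> i) * \<eta> i x))) \<longlongrightarrow> f x - 0) (finite_subsets_at_top I)"
    by (intro tendsto_diff tendsto_const)
  then show ?thesis by (simp add: has_sum_def)
qed

end

section \<open>Sums over finite sets of coordinates\<close>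

lemma has_sum_mult_Times:
  fixes f :: "'i \<Rightarrow> real" and g :: "'j \<Rightarrow> real"
  assumes f: "(f has_sum a) A" and g: "(g has_sum b) B"
  shows "((\<lambda>(x, y). f x * g y) has_sum a * b) (A \<times> B)"
proof -
  have "(\<lambda>x. norm (f x)) summable_on A" "(\<lambda>y. norm (g y)) summable_on B"
    by (rule summable_on_iff_abs_summable_on_real[THEN iffD1], rule has_sum_imp_summable, rule f g)+
  then obtain a' b' where ab: "((\<lambda>x. \<bar>f x\<bar>) has_sum a') A" "((\<lambda>y. \<bar>g y\<bar>) has_sum b') B"
    by (auto simp: summable_on_def)
  have "(\<lambda>z. \<bar>f (fst z)\<bar> * \<bar>g (snd z)\<bar>) summable_on A \<times> B"
    using ab by (intro summable_on_SigmaI[where g = "\<lambda>x. \<bar>f x\<bar> * b'"])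
      (auto intro!: has_sum_cmult_right has_sum_imp_summable has_sum_cmult_left)
  then have "(\<lambda>z. norm (f (fst z) * g (snd z))) summable_on A \<times> B" by (simp add: abs_mult)
  then have "(\<lambda>z. f (fst z) * g (snd z)) summable_on A \<times> B"
    by (rule summable_on_iff_abs_summable_on_real[THEN iffD2])
  then have "((\<lambda>z. f (fst z) * g (snd z)) has_sum a * b) (A \<times> B)"
    by (intro has_sum_SigmaI[where g = "\<lambda>x. f x * b"]) (auto intro!: has_sum_cmult_right has_sum_cmult_left f g)
  then show ?thesis by (simp add: case_prod_unfold)
qed

lemma has_sum_prod_PiE:
  fixes f :: "'a \<Rightarrow> 'b \<Rightarrow> real"
  assumes "finite A" and "\<And>x. x \<in> A \<Longrightarrow> (f x has_sum S x) (B x)"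
  shows "((\<lambda>g. \<Prod>x\<in>A. f x (g x)) has_sum (\<Prod>x\<in>A. S x)) (PiE A B)"
  using assms
proof (induction A)
  case empty
  then show ?case by (simp add: has_sum_finiteI)
next
  case (insert x F)
  have "((\<lambda>(y, g). f x y * (\<Prod>z\<in>F. f z (g z))) has_sum (S x * prod S F)) (B x \<times> PiE F B)"
    by (intro has_sum_mult_Times insert) auto
  moreover have "(\<Prod>z\<in>insert x F. f z ((g(x := y)) z)) = f x y * (\<Prod>z\<in>F. f z (g z))" for g y
    using insert.hyps by (auto intro!: prod.cong arg_cong2[where f = "(*)"])
  ultimately have "(((\<lambda>g. \<Prod>z\<in>insert x F. f z (g z)) \<circ> (\<lambda>(y, g). g(x := y))) has_sum (S x * prod S F))
      (B x \<times> PiE F B)"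
    by (simp add: o_def case_prod_unfold)
  then show ?case
    using insert.hyps by (subst PiE_insert_eq) (simp add: has_sum_reindex inj_combinator)
qed

text \<open>
  Summing \<open>\<Prod>\<^bsub>j\<in>u\<^esub> t\<^sub>j\<close> over all subsets \<open>u\<close> of a set \<open>J\<close> gives \<open>\<Prod>\<^bsub>j\<in>J\<^esub> (1 + t\<^sub>j) \<le> exp (\<Sum>\<^bsub>j\<in>J\<^esub> t\<^sub>j)\<close>.
\<close>

lemma sum_fin_sets_le_exp:
  fixes t :: "nat \<Rightarrow> real"
  assumes F: "finite F" "F \<subseteq> fin_sets" and t: "\<And>j. j \<ge> 1 \<Longrightarrow> 0 \<le> t j"
    and T: "\<And>J. finite J \<Longrightarrow> J \<subseteq> {1..} \<Longrightarrow> sum t J \<le> T"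
  shows "(\<Sum>u\<in>F. \<Prod>j\<in>u. t j) \<le> exp T"
proof -
  define J where "J = \<Union>F"
  have J: "finite J" "J \<subseteq> {1..}" using F by (auto simp: J_def fin_sets_def)
  have "(\<Sum>u\<in>F. \<Prod>j\<in>u. t j) \<le> (\<Sum>u\<in>Pow J. \<Prod>j\<in>u. t j)"
  proof (rule sum_mono2)
    fix u assume "u \<in> Pow J - F"
    then show "0 \<le> (\<Prod>j\<in>u. t j)" using J t by (intro prod_nonneg) fastforce
  qed (use J in \<open>auto simp: J_def\<close>)
  also have "\<dots> = (\<Prod>j\<in>J. t j + 1)" using J by (simp add: prod_add)
  also have "\<dots> \<le> (\<Prod>j\<in>J. exp (t j))"
    using t J by (intro prod_mono) (auto simp: add.commute exp_ge_add_one_self)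
  also have "\<dots> = exp (sum t J)" using J by (simp add: exp_sum)
  also have "\<dots> \<le> exp T" using T[OF J] by simp
  finally show ?thesis .
qed

lemma summable_on_fin_sets_iff:
  fixes t :: "nat \<Rightarrow> real"
  assumes t: "\<And>j. j \<ge> 1 \<Longrightarrow> 0 \<le> t j"
  shows "(\<lambda>u. \<Prod>j\<in>u. t j) summable_on fin_sets \<longleftrightarrow> t summable_on {1..}"
proof
  assume "t summable_on {1..}"
  then have "sum t J \<le> infsum t {1..}" if "finite J" "J \<subseteq> {1..}" for J
    using that t by (intro finite_sum_le_infsum) auto
  then have "(\<Sum>u\<in>F. \<Prod>j\<in>u. t j) \<le> exp (infsum t {1..})" if "finite F" "F \<subseteq> fin_sets" for F
    using that t by (intro sum_fin_sets_le_exp)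
  then have "bdd_above (sum (\<lambda>u. \<Prod>j\<in>u. t j) ` {F. F \<subseteq> fin_sets \<and> finite F})"
    by (intro bdd_aboveI2[where M = "exp (infsum t {1..})"]) simp
  moreover have "0 \<le> (\<Prod>j\<in>u. t j)" if "u \<in> fin_sets" for u
    using that t by (intro prod_nonneg) (auto simp: fin_sets_def)
  ultimately show "(\<lambda>u. \<Prod>j\<in>u. t j) summable_on fin_sets"
    by (rule nonneg_bdd_above_summable_on[rotated])
next
  assume "(\<lambda>u. \<Prod>j\<in>u. t j) summable_on fin_sets"
  then have "(\<lambda>u. \<Prod>j\<in>u. t j) summable_on (\<lambda>j. {j}) ` {1..}"
    by (rule summable_on_subset) (auto simp: fin_sets_def)
  then show "t summable_on {1..}" by (subst (asm) summable_on_reindex) (auto simp: o_def)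
qed

section \<open>The weighted space and its coordinate subspaces\<close>

lemma is_rkhs_cong:
  assumes eq: "\<And>x y. x \<in> D \<Longrightarrow> y \<in> D \<Longrightarrow> K x y = L x y" and H: "is_rkhs D K H"
  shows "is_rkhs D L H"
proof -
  have ks: "kernel_section D L x = kernel_section D K x" if "x \<in> D" for x
    using eq[OF _ that] by (intro ext) (simp add: kernel_section_def)
  show ?thesis
    unfolding is_rkhs_def
  proof (intro conjI ballI)
    show "hilbert_fun_space D H" using H by (simp add: is_rkhs_def)
    fix x assume x: "x \<in> D"
    show "kernel_section D L x \<in> elems H" using H x unfolding ks[OF x] is_rkhs_def by blast
    fix f assume "f \<in> elems H"
    then show "ip H f (kernel_section D L x) = f x" using H x unfolding ks[OF x] is_rkhs_def by blast
  qed
qed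

lemma rkhs_cong:
  assumes eq: "\<And>x y. x \<in> D \<Longrightarrow> y \<in> D \<Longrightarrow> K x y = L x y"
  shows "rkhs D K = rkhs D L"
proof -
  have "is_rkhs D K = is_rkhs D L"
    using is_rkhs_cong[of D K L, OF eq] is_rkhs_cong[of D L K, OF eq[symmetric]] by (intro ext iffI)
  then show ?thesis by (simp add: rkhs_def)
qed

definition fam_kernel ::
    "('a \<Rightarrow> 'a \<Rightarrow> real) \<Rightarrow> (nat set \<Rightarrow> real) \<Rightarrow> nat set set \<Rightarrow> (nat \<Rightarrow> 'a) \<Rightarrow> (nat \<Rightarrow> 'a) \<Rightarrow> real" where
  "fam_kernel k c V x y = (\<Sum>\<^sub>\<infinity>u\<in>V. c u * k_u k u x y)"

lemma K_gamma_eq: "K_gamma \<gamma> k = fam_kernel k (weight \<gamma>) fin_sets"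
  by (intro ext) (simp add: K_gamma_def fam_kernel_def)

text \<open>
  The functions \<open>\<phi>\<close> supply the positive definiteness of the products \<open>k\<^sub>u\<close>: these are again series of
  rank-one kernels. Summability of the weights makes the constant sequences points of the domain.
\<close>

locale weighted_kernel =
  fixes \<rho> :: "'a measure" and \<gamma> :: "nat \<Rightarrow> real" and k :: "'a \<Rightarrow> 'a \<Rightarrow> real"
    and \<phi> :: "nat \<Rightarrow> 'a \<Rightarrow> real"
  assumes nonempty: "space \<rho> \<noteq> {}"
    and frame: "x \<in> space \<rho> \<Longrightarrow> y \<in> space \<rho> \<Longrightarrow> ((\<lambda>i. \<phi> i x * \<phi> i y) has_sum k x y) UNIV"
    and gamma_pos: "j \<ge> 1 \<Longrightarrow> 0 < \<gamma> j"
    and gamma_summable: "\<gamma> summable_on {1..}"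
    and no_const: "(\<lambda>x. if x \<in> space \<rho> then 1 else 0) \<notin> elems (rkhs (space \<rho>) k)"
begin

abbreviation D where "D \<equiv> space \<rho>"
abbreviation X where "X \<equiv> X_dom \<rho> \<gamma> k"

sublocale k: psd_kernel D k
  by (rule psd_kernel_has_sum[OF psd_rank_one frame])

lemma weight_pos: "u \<in> fin_sets \<Longrightarrow> 0 < weight \<gamma> u"
  unfolding weight_def using gamma_pos by (intro prod_pos) (auto simp: fin_sets_def)

lemma weighted_diag: "weight \<gamma> u * k_u k u x x = (\<Prod>j\<in>u. \<gamma> j * k (x j) (x j))"
  by (simp add: weight_def k_u_def prod.distrib)

text \<open>
  As \<open>\<Sum>\<^sub>u \<Prod>\<^bsub>j\<in>u\<^esub> t\<^sub>j\<close> converges if and only if \<open>\<Sum>\<^sub>j t\<^sub>j\<close> does, finitely many coordinates of a point can be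
  changed without leaving the domain.
\<close>

lemma mem_X_iff: "x \<in> X \<longleftrightarrow> x \<in> {1..} \<rightarrow>\<^sub>E D \<and> (\<lambda>j. \<gamma> j * k (x j) (x j)) summable_on {1..}"
proof (cases "x \<in> {1..} \<rightarrow>\<^sub>E D")
  case True
  then have "0 \<le> \<gamma> j * k (x j) (x j)" if "j \<ge> 1" for j
    using that gamma_pos[OF that] k.diag_nonneg[of "x j"] by (simp add: PiE_iff less_imp_le)
  from summable_on_fin_sets_iff[of "\<lambda>j. \<gamma> j * k (x j) (x j)", OF this] True
  show ?thesis by (simp add: X_dom_def weighted_diag)
qed (auto simp: X_dom_def)

lemma X_coord: "x \<in> X \<Longrightarrow> j \<ge> 1 \<Longrightarrow> x j \<in> D"
  by (auto simp: X_dom_def)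

lemma const_mem_X: assumes "c \<in> D" shows "(\<lambda>j\<in>{1..}. c) \<in> X"
  unfolding mem_X_iff
proof
  show "(\<lambda>j\<in>{1..}. c) \<in> {1..} \<rightarrow>\<^sub>E D" using assms by simp
  have "(\<lambda>j. \<gamma> j * k c c) summable_on {1..}" by (intro summable_on_cmult_left gamma_summable)
  then show "(\<lambda>j. \<gamma> j * k ((\<lambda>j\<in>{1..}. c) j) ((\<lambda>j\<in>{1..}. c) j)) summable_on {1..}"
    by (rule summable_on_cong[THEN iffD1, rotated]) simp
qed

lemma update_mem_X:
  assumes x: "x \<in> X" and j: "j \<ge> 1" and t: "t \<in> D"
  shows "x(j := t) \<in> X"
  unfolding mem_X_iff
proof
  show "x(j := t) \<in> {1..} \<rightarrow>\<^sub>E D"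
    using x t by (simp add: X_dom_def PiE_iff extensional_def) (use j in auto)
  have "(\<lambda>i. \<gamma> i * k (x i) (x i)) summable_on {1..} - {j}"
    using x[unfolded mem_X_iff, THEN conjunct2] by (rule summable_on_subset) auto
  then have "(\<lambda>i. \<gamma> i * k ((x(j := t)) i) ((x(j := t)) i)) summable_on {1..} - {j}"
    by (rule summable_on_cong[THEN iffD1, rotated]) simp
  then have "(\<lambda>i. \<gamma> i * k ((x(j := t)) i) ((x(j := t)) i)) summable_on insert j ({1..} - {j})"
    by (rule summable_on_insert_iff[THEN iffD2])
  moreover have "insert j ({1..} - {j}) = {1..}" using j by auto
  ultimately show "(\<lambda>i. \<gamma> i * k ((x(j := t)) i) ((x(j := t)) i)) summable_on {1..}" by (simp only:)
qed

definition frame_u :: "nat set \<Rightarrow> (nat \<Rightarrow> nat) \<Rightarrow> (nat \<Rightarrow> 'a) \<Rightarrow> real" where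
  "frame_u u i x = (if x \<in> X then \<Prod>j\<in>u. \<phi> (i j) (x j) else 0)"

lemma frame_u_series:
  assumes u: "u \<in> fin_sets" and x: "x \<in> X" and y: "y \<in> X"
  shows "((\<lambda>i. frame_u u i x * frame_u u i y) has_sum k_u k u x y) (PiE u (\<lambda>_. UNIV))"
proof -
  have "((\<lambda>i. \<Prod>j\<in>u. \<phi> (i j) (x j) * \<phi> (i j) (y j)) has_sum (\<Prod>j\<in>u. k (x j) (y j))) (PiE u (\<lambda>_. UNIV))"
    using u by (intro has_sum_prod_PiE frame X_coord x y) (auto simp: fin_sets_def)
  then show ?thesis using x y by (simp add: frame_u_def k_u_def prod.distrib)
qed

lemma kernel_series_u: "u \<in> fin_sets \<Longrightarrow> kernel_series X (k_u k u) (PiE u (\<lambda>_. UNIV)) (frame_u u)"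
  by unfold_locales (simp_all add: frame_u_series, simp add: frame_u_def)

lemma psd_u: "u \<in> fin_sets \<Longrightarrow> psd_kernel X (k_u k u)"
  by (rule psd_kernel_has_sum[OF psd_rank_one frame_u_series])

lemma k_u_abs_le:
  assumes u: "u \<in> fin_sets" and x: "x \<in> X" and y: "y \<in> X"
  shows "\<bar>k_u k u x y\<bar> \<le> k_u k u x x + k_u k u y y"
proof -
  interpret u: psd_kernel X "k_u k u" by (rule psd_u[OF u])
  have "0 \<le> k_u k u x x + 2 * t * k_u k u x y + t\<^sup>2 * k_u k u y y" for t
    using u.psd[of "[(1, x), (t, y)]"] x y u.sym[OF x y]
    by (simp add: pairing_def power2_eq_square algebra_simps)
  from this[of 1] this[of "-1"] show ?thesis
    using u.diag_nonneg[OF x] u.diag_nonneg[OF y] by simp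
qed

lemma diag_summable: "x \<in> X \<Longrightarrow> (\<lambda>u. weight \<gamma> u * k_u k u x x) summable_on fin_sets"
  by (simp add: X_dom_def)

text \<open>
  Two kinds of sums of the kernels \<open>k\<^sub>u\<close> occur: with the product weights over arbitrary families, and with
  unit weights over finite families, where only the linear span of the spaces matters.
\<close>

definition good_family :: "(nat set \<Rightarrow> real) \<Rightarrow> nat set set \<Rightarrow> bool" where
  "good_family c V \<longleftrightarrow> V \<subseteq> fin_sets \<and> (\<forall>u\<in>V. 0 < c u)
     \<and> (\<forall>x\<in>X. (\<lambda>u. c u * k_u k u x x) summable_on V)"

lemma good_family_weight: "V \<subseteq> fin_sets \<Longrightarrow> good_family (weight \<gamma>) V"
  unfolding good_family_def
  by (intro conjI ballI weight_pos summable_on_subset[OF diag_summable]) (auto dest: subsetD)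

lemma good_family_finite: "V \<subseteq> fin_sets \<Longrightarrow> finite V \<Longrightarrow> good_family (\<lambda>_. 1) V"
  by (auto simp: good_family_def)

lemma fam_has_sum:
  assumes G: "good_family c V" and x: "x \<in> X" and y: "y \<in> X"
  shows "((\<lambda>u. c u * k_u k u x y) has_sum fam_kernel k c V x y) V"
proof -
  have "(\<lambda>u. c u * k_u k u x x + c u * k_u k u y y) summable_on V"
    using G x y by (intro summable_on_add) (auto simp: good_family_def)
  then have "(\<lambda>u. norm (c u * k_u k u x y)) summable_on V"
  proof (rule summable_on_comparison_test)
    fix u assume u: "u \<in> V"
    with G have "0 < c u" "u \<in> fin_sets" by (auto simp: good_family_def)
    with k_u_abs_le[OF _ x y, of u] mult_left_mono[of "\<bar>k_u k u x y\<bar>" "k_u k u x x + k_u k u y y" "c u"]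
    show "norm (c u * k_u k u x y) \<le> c u * k_u k u x x + c u * k_u k u y y"
      by (simp add: abs_mult distrib_left)
  qed simp
  then have "(\<lambda>u. c u * k_u k u x y) summable_on V"
    by (rule summable_on_iff_abs_summable_on_real[THEN iffD2])
  then show ?thesis by (simp add: fam_kernel_def has_sum_infsum)
qed

lemma psd_scaled: "psd_kernel Y L \<Longrightarrow> 0 \<le> c \<Longrightarrow> psd_kernel Y (\<lambda>x y. c * L x y)"
  unfolding psd_kernel_def by (simp add: pairing_mult)

lemma psd_fam: assumes "good_family c V" shows "psd_kernel X (fam_kernel k c V)"
proof (rule psd_kernel_has_sum[OF psd_scaled[OF psd_u] fam_has_sum[OF assms]])
qed (use assms in \<open>auto simp: good_family_def less_imp_le\<close>)

lemma fam_energy: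
  assumes "good_family c V" "a \<in> combs X"
  shows "((\<lambda>u. c u * pairing (k_u k u) a a) has_sum pairing (fam_kernel k c V) a a) V"
  using has_sum_pairing[OF assms(2,2) fam_has_sum[OF assms(1)]] by (simp add: pairing_mult)

lemma mem_fam:
  assumes G: "good_family c V" and u: "u \<in> V" and f: "f \<in> elems (rkhs X (k_u k u))"
  shows "f \<in> elems (rkhs X (fam_kernel k c V))"
proof -
  from G u have u': "u \<in> fin_sets" and c: "0 < c u" by (auto simp: good_family_def)
  interpret u: psd_kernel X "k_u k u" by (rule psd_u[OF u'])
  interpret G: psd_kernel X "fam_kernel k c V" by (rule psd_fam[OF G])
  from f obtain C where C: "dominated X (k_u k u) f C" and f0: "\<forall>x. x \<notin> X \<longrightarrow> f x = 0"
    unfolding u.mem_rkhs by blast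
  have "0 \<le> C" using C[unfolded dominated_def, rule_format, of "[]"] by simp
  have "dominated X (fam_kernel k c V) f (C / c u)"
  proof (rule G.dominated_of_sq)
    show "0 \<le> C / c u" using \<open>0 \<le> C\<close> c by simp
    fix a assume a: "a \<in> combs X"
    have "c u * pairing (k_u k u) a a \<le> pairing (fam_kernel k c V) a a"
    proof -
      have "0 \<le> c v * pairing (k_u k v) a a" if "v \<in> V" for v
        using G that psd_kernel.psd[OF psd_u a, of v]
        by (intro mult_nonneg_nonneg) (auto simp: good_family_def less_imp_le)
      with finite_sum_le_has_sum[OF fam_energy[OF G a], of "{u}"] u show ?thesis by simp
    qed
    then have "C / c u * (c u * pairing (k_u k u) a a) \<le> C / c u * pairing (fam_kernel k c V) a a"
      using \<open>0 \<le> C\<close> c by (intro mult_left_mono) auto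
    moreover have "(ev f a)\<^sup>2 \<le> C * pairing (k_u k u) a a" by (rule u.dominated_sq[OF C a])
    ultimately show "(ev f a)\<^sup>2 \<le> C / c u * pairing (fam_kernel k c V) a a" using c by simp
  qed
  with f0 show ?thesis by (auto simp: G.mem_rkhs)
qed

definition depends_on :: "nat set \<Rightarrow> ((nat \<Rightarrow> 'a) \<Rightarrow> real) \<Rightarrow> bool" where
  "depends_on w f \<longleftrightarrow> (\<forall>x\<in>X. \<forall>y\<in>X. (\<forall>j\<in>w. x j = y j) \<longrightarrow> f x = f y)"

text \<open>
  As \<open>1\<close> is not in \<open>H(k)\<close>, it is not bounded in terms of the energy: there are point combinations of total
  mass one and arbitrarily small energy. They play the role of an anchor point, at which \<open>k\<close>
  would vanish. The bound relative to \<open>k b b\<close> also covers the case \<open>k b b = 0\<close>.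
\<close>

lemma approximate_anchor:
  assumes b: "b \<in> D" and \<theta>: "0 < \<theta>" "\<theta> \<le> 1"
  obtains a where "a \<in> combs D" "ev (\<lambda>_. 1) a = 1" "pairing k a a \<le> \<theta> * k b b"
proof (cases "k b b = 0")
  case True
  then show ?thesis using b by (intro that[of "[(1, b)]"]) (auto simp: pairing_def)
next
  case False
  with k.diag_nonneg[OF b] have pos: "0 < k b b" by simp
  let ?one = "\<lambda>x. if x \<in> D then 1 else (0::real)"
  define C where "C = 1 / (\<theta> * k b b)"
  have C: "C > 0" using pos \<theta> by (simp add: C_def)
  have "\<not> dominated D k ?one C" using no_const by (auto simp: k.mem_rkhs)
  then obtain a where a: "a \<in> combs D" and gt: "C < 2 * ev ?one a - pairing k a a"
    by (auto simp: dominated_def not_le)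
  define s where "s = ev (\<lambda>_. 1) a"
  have s: "ev ?one a = s" unfolding s_def by (rule ev_cong[OF a]) simp
  have spos: "s > 0" using gt k.psd[OF a] C by (simp add: s)
  have "C * (2 * s - C) \<le> s\<^sup>2"
    using zero_le_power2[of "s - C"] by (simp add: power2_eq_square algebra_simps)
  moreover have "C * pairing k a a \<le> C * (2 * s - C)" using gt C by (intro mult_left_mono) (auto simp: s)
  ultimately have "C * pairing k a a \<le> s\<^sup>2" by linarith
  then have "pairing k a a / s\<^sup>2 \<le> 1 / C" using C spos by (simp add: field_simps)
  then have "pairing k (scl (1 / s) a) (scl (1 / s) a) \<le> \<theta> * k b b"
    by (simp add: power2_eq_square C_def)
  then show ?thesis
    using a spos by (intro that[of "scl (1 / s) a"]) (auto simp: s_def)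
qed

definition subst_coord :: "nat \<Rightarrow> (real \<times> 'a) list \<Rightarrow> (real \<times> (nat \<Rightarrow> 'a)) list \<Rightarrow> (real \<times> (nat \<Rightarrow> 'a)) list" where
  "subst_coord j a c = concat (map (\<lambda>(s, x). map (\<lambda>(t, y). (s * t, x(j := y))) a) c)"

lemma ev_subst_coord: "ev F (subst_coord j a c) = ev (\<lambda>x. ev (\<lambda>y. F (x(j := y))) a) c"
proof -
  have "ev F (map (\<lambda>(t, y). (s * t, x(j := y))) a) = s * ev (\<lambda>y. F (x(j := y))) a" for s x
    by (induction a) (simp_all add: case_prod_unfold distrib_left mult.assoc)
  then show ?thesis by (induction c) (auto simp: subst_coord_def)
qed

lemma combs_subst_coord:
  assumes "c \<in> combs X" "a \<in> combs D" "j \<ge> 1"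
  shows "subst_coord j a c \<in> combs X"
proof -
  have "map (\<lambda>(t, y). (s * t, x(j := y))) a \<in> combs X" if "x \<in> X" for s x
    using assms(2) by (induction a) (simp_all add: case_prod_unfold update_mem_X[OF that assms(3)])
  with assms(1) show ?thesis by (induction c) (auto simp: subst_coord_def)
qed

text \<open>
  Applying approximate anchors in the coordinates \<open>J\<close> to the point evaluation at \<open>b\<close> gains a factor
  \<open>\<theta>\<close> for each coordinate of \<open>J\<close> on which the kernel depends, and is invisible to functions that do
  not depend on \<open>J\<close>.
\<close>

lemma anchored_functional:
  assumes b: "b \<in> X" and \<theta>: "0 < \<theta>" "\<theta> \<le> 1" and J: "finite J" "J \<subseteq> {1..}"
  obtains A where "A \<in> combs X"
    "\<And>v. v \<in> fin_sets \<Longrightarrow> pairing (k_u k v) A A \<le> \<theta> ^ card (v \<inter> J) * k_u k v b b"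
    "\<And>f w. depends_on w f \<Longrightarrow> w \<inter> J = {} \<Longrightarrow> ev f A = f b"
proof -
  have "\<exists>A\<in>combs X. (\<forall>v\<in>fin_sets. pairing (k_u k v) A A \<le> \<theta> ^ card (v \<inter> J) * k_u k v b b) \<and>
      (\<forall>f w. depends_on w f \<longrightarrow> w \<inter> J = {} \<longrightarrow> ev f A = f b)"
    using J
  proof (induction J)
    case empty
    show ?case using b by (intro bexI[of _ "[(1, b)]"]) (auto simp: pairing_def)
  next
    case (insert j J)
    then obtain A where A: "A \<in> combs X"
      and en: "\<And>v. v \<in> fin_sets \<Longrightarrow> pairing (k_u k v) A A \<le> \<theta> ^ card (v \<inter> J) * k_u k v b b"
      and ev: "\<And>f w. depends_on w f \<Longrightarrow> w \<inter> J = {} \<Longrightarrow> ev f A = f b" by auto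
    have j: "j \<ge> 1" "j \<notin> J" using insert by auto
    obtain a where a: "a \<in> combs D" "ev (\<lambda>_. 1) a = 1" "pairing k a a \<le> \<theta> * k (b j) (b j)"
      using approximate_anchor[OF X_coord[OF b j(1)] \<theta>] by blast
    have ev_const: "ev (\<lambda>_. r) a = r" for r using ev_mult[of r "\<lambda>_. 1" a] a(2) by simp
    let ?B = "subst_coord j a A"
    have "pairing (k_u k v) ?B ?B \<le> \<theta> ^ card (v \<inter> insert j J) * k_u k v b b" if v: "v \<in> fin_sets" for v
    proof (cases "j \<in> v")
      case True
      have fin: "finite v" using v by (simp add: fin_sets_def)
      have v': "v - {j} \<in> fin_sets" using v by (auto simp: fin_sets_def)
      have ku: "k_u k v (x(j := s)) (y(j := t)) = k s t * k_u k (v - {j}) x y" for x y s t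
        unfolding k_u_def by (subst prod.remove[OF fin True]) (simp cong: prod.cong_simp)
      have kub: "k_u k v b b = k (b j) (b j) * k_u k (v - {j}) b b"
        unfolding k_u_def by (subst prod.remove[OF fin True]) simp
      have "pairing (k_u k v) ?B ?B = pairing k a a * pairing (k_u k (v - {j})) A A"
        by (simp add: pairing_def ev_subst_coord ku ev_mult ev_mult_right)
      also have "\<dots> \<le> (\<theta> * k (b j) (b j)) * (\<theta> ^ card ((v - {j}) \<inter> J) * k_u k (v - {j}) b b)"
        using \<theta> by (intro mult_mono a(3) en v' mult_nonneg_nonneg k.diag_nonneg X_coord[OF b j(1)]
            psd_kernel.psd[OF psd_u[OF v'] A]) auto
      also have "(v - {j}) \<inter> J = v \<inter> J" using j by auto
      also have "(\<theta> * k (b j) (b j)) * (\<theta> ^ card (v \<inter> J) * k_u k (v - {j}) b b)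
          = \<theta> ^ Suc (card (v \<inter> J)) * k_u k v b b" by (simp add: kub)
      also have "Suc (card (v \<inter> J)) = card (v \<inter> insert j J)"
        using True j fin by (simp add: Int_insert_right_if1 card_insert_disjoint)
      finally show ?thesis .
    next
      case False
      then have ku: "k_u k v (x(j := s)) (y(j := t)) = k_u k v x y" for x y s t
        unfolding k_u_def by (intro prod.cong) auto
      have "pairing (k_u k v) ?B ?B = pairing (k_u k v) A A"
        by (simp add: pairing_def ev_subst_coord ku ev_const)
      then show ?thesis using en[OF v] False by simp
    qed
    moreover have "ev f ?B = f b" if f: "depends_on w f" "w \<inter> insert j J = {}" for f w
    proof -
      have "ev f ?B = ev (\<lambda>x. ev (\<lambda>y. f (x(j := y))) a) A" by (rule ev_subst_coord)
      also have "\<dots> = ev (\<lambda>x. ev (\<lambda>y. f x) a) A"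
      proof (intro ev_cong[OF A] ev_cong[OF a(1)])
        fix x y assume "x \<in> X" "y \<in> D"
        moreover have "\<forall>i\<in>w. (x(j := y)) i = x i" using f(2) by auto
        ultimately show "f (x(j := y)) = f x"
          using f(1) update_mem_X[OF _ j(1)] unfolding depends_on_def by blast
      qed
      also have "\<dots> = f b" using ev[OF f(1)] f(2) by (simp add: ev_const)
      finally show ?thesis .
    qed
    ultimately show ?case using combs_subst_coord[OF A a(1) j(1)] by blast
  qed
  with that show ?thesis by blast
qed

text \<open>
  Hence no nonzero function of the coordinates \<open>w\<close> lies in a sum of spaces \<open>H\<^sub>v\<close> with \<open>v\<close> not
  contained in \<open>w\<close>, even for infinitely many \<open>v\<close>: finitely many terms of the energy at \<open>b\<close> are
  made small by anchoring, the remaining ones are a small tail.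
\<close>

lemma depends_on_imp_zero:
  assumes G: "good_family c V" and nsub: "\<And>v. v \<in> V \<Longrightarrow> \<not> v \<subseteq> w"
    and f: "f \<in> elems (rkhs X (fam_kernel k c V))" and dep: "depends_on w f"
  shows "f = (\<lambda>_. 0)"
proof
  fix b
  interpret G: psd_kernel X "fam_kernel k c V" by (rule psd_fam[OF G])
  note Vf = G[unfolded good_family_def, THEN conjunct1]
    and cpos = G[unfolded good_family_def, THEN conjunct2, THEN conjunct1, rule_format]
  show "f b = 0"
  proof (cases "b \<in> X")
    case b: True
    define e where "e v = c v * k_u k v b b" for v
    define S where "S = fam_kernel k c V b b"
    have S: "(e has_sum S) V" unfolding S_def e_def by (rule fam_has_sum[OF G b b])
    have e0: "0 \<le> e v" if "v \<in> V" for v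
      unfolding e_def using that Vf cpos[OF that] psd_kernel.diag_nonneg[OF psd_u b, of v] by auto
    have S0: "0 \<le> S" using has_sum_nonneg[OF S] e0 by blast
    have "(f b)\<^sup>2 \<le> ip G.H f f * (S + 1) * \<epsilon>" if \<epsilon>: "0 < \<epsilon>" "\<epsilon> \<le> 1" for \<epsilon>
    proof -
      obtain F where F: "finite F" "F \<subseteq> V" "S - \<epsilon> \<le> sum e F"
        using has_sum_finite_approximation[OF S \<epsilon>(1)] by (auto simp: dist_real_def)
      define J where "J = \<Union>F - w"
      have J: "finite J" "J \<subseteq> {1..}" using F Vf by (auto simp: J_def fin_sets_def subset_iff)
      obtain A where A: "A \<in> combs X"
        and en: "\<And>v. v \<in> fin_sets \<Longrightarrow> pairing (k_u k v) A A \<le> \<epsilon> ^ card (v \<inter> J) * k_u k v b b"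
        and evA: "\<And>f w. depends_on w f \<Longrightarrow> w \<inter> J = {} \<Longrightarrow> ev f A = f b"
        using anchored_functional[OF b \<epsilon> J] by blast
      have bound: "c v * pairing (k_u k v) A A \<le> e v - (if v \<in> F then (1 - \<epsilon>) * e v else 0)"
        if v: "v \<in> V" for v
      proof -
        have "c v * pairing (k_u k v) A A \<le> c v * (\<epsilon> ^ card (v \<inter> J) * k_u k v b b)"
          using en v Vf cpos[OF v] by (intro mult_left_mono) auto
        then have 1: "c v * pairing (k_u k v) A A \<le> \<epsilon> ^ card (v \<inter> J) * e v"
          by (simp add: e_def mult_ac)
        have "\<epsilon> ^ card (v \<inter> J) \<le> (if v \<in> F then \<epsilon> else 1)"
        proof (cases "v \<in> F")
          case True
          with nsub[OF v] have "v \<inter> J \<noteq> {}" by (auto simp: J_def)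
          with J have "1 \<le> card (v \<inter> J)" by (simp add: Suc_le_eq card_gt_0_iff)
          then have "\<epsilon> ^ card (v \<inter> J) \<le> \<epsilon> ^ 1" using \<epsilon> by (intro power_decreasing) auto
          with True show ?thesis by simp
        qed (use \<epsilon> in \<open>simp add: power_le_one\<close>)
        from mult_right_mono[OF this e0[OF v]] 1 show ?thesis by (auto simp: algebra_simps)
      qed
      have "((\<lambda>v. if v \<in> F then (1 - \<epsilon>) * e v else 0) has_sum (\<Sum>v\<in>F. (1 - \<epsilon>) * e v)) V"
        using F by (intro has_sum_finite_neutralI) auto
      then have "((\<lambda>v. (if v \<in> F then (1 - \<epsilon>) * e v else 0) * (-1)) has_sum (\<Sum>v\<in>F. (1 - \<epsilon>) * e v) * (-1)) V"
        by (rule has_sum_cmult_left)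
      from has_sum_add[OF S this]
      have "((\<lambda>v. e v - (if v \<in> F then (1 - \<epsilon>) * e v else 0)) has_sum (S - (1 - \<epsilon>) * sum e F)) V"
        by (simp add: sum_distrib_left)
      from has_sum_mono[OF fam_energy[OF G A] this bound]
      have "pairing (fam_kernel k c V) A A \<le> S - (1 - \<epsilon>) * sum e F" .
      also have "\<dots> \<le> S - (1 - \<epsilon>) * (S - \<epsilon>)" using F(3) \<epsilon> by (intro diff_left_mono mult_left_mono) auto
      also have "\<dots> \<le> (S + 1) * \<epsilon>" using \<epsilon> by (simp add: algebra_simps)
      finally have "ip G.H f f * pairing (fam_kernel k c V) A A \<le> ip G.H f f * ((S + 1) * \<epsilon>)"
        by (intro mult_left_mono G.ip_nonneg)
      moreover have "ev f A = f b" using evA[OF dep] by (auto simp: J_def)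
      ultimately show ?thesis using G.dominated_sq[OF G.dominated_self[OF f] A] by (simp add: mult.assoc)
    qed
    then have "\<forall>\<^sub>F \<epsilon> in at_right 0. (f b)\<^sup>2 \<le> ip G.H f f * (S + 1) * \<epsilon>"
      unfolding eventually_at_right_field by (intro exI[of _ 1]) auto
    moreover have "((\<lambda>\<epsilon>. ip G.H f f * (S + 1) * \<epsilon>) \<longlongrightarrow> ip G.H f f * (S + 1) * 0) (at_right 0)"
      by (intro tendsto_intros)
    ultimately have "(f b)\<^sup>2 \<le> ip G.H f f * (S + 1) * 0"
      by (intro tendsto_lowerbound[where F = "at_right (0::real)"]) auto
    then show ?thesis by simp
  qed (use G.outside[OF f] in simp)
qed

end

context weighted_kernel
begin

lemma depends_on_kernel:
  assumes K: "psd_kernel X K" and f: "f \<in> elems (rkhs X K)"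
    and eq: "\<And>x y z. x \<in> X \<Longrightarrow> y \<in> X \<Longrightarrow> \<forall>j\<in>w. x j = y j \<Longrightarrow> K z x = K z y"
  shows "depends_on w f"
  unfolding depends_on_def
proof (intro ballI impI)
  fix x y assume xy: "x \<in> X" "y \<in> X" "\<forall>j\<in>w. x j = y j"
  interpret psd_kernel X K by (rule K)
  have "kernel_section X K x = kernel_section X K y"
    using eq[OF xy] by (intro ext) (simp add: kernel_section_def)
  then show "f x = f y" using ip_section[OF xy(1) f] ip_section[OF xy(2) f] by simp
qed

lemma k_u_cong: "\<forall>j\<in>w. x j = y j \<Longrightarrow> u \<subseteq> w \<Longrightarrow> k_u k u z x = k_u k u z y"
  unfolding k_u_def by (intro prod.cong) auto

lemma depends_on_fam:
  assumes "good_family c V" "\<And>v. v \<in> V \<Longrightarrow> v \<subseteq> w" "f \<in> elems (rkhs X (fam_kernel k c V))"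
  shows "depends_on w f"
proof (rule depends_on_kernel[OF psd_fam[OF assms(1)] assms(3)])
  fix x y z :: "nat \<Rightarrow> 'a" assume "\<forall>j\<in>w. x j = y j"
  then show "fam_kernel k c V z x = fam_kernel k c V z y"
    unfolding fam_kernel_def using assms(2) by (intro infsum_cong) (simp add: k_u_cong[of w])
qed

lemma sum_mem_fam:
  assumes G: "good_family c V" and W: "W \<subseteq> V"
    and g: "\<And>v. v \<in> W \<Longrightarrow> g v \<in> elems (rkhs X (k_u k v))"
  shows "(\<lambda>x. \<Sum>v\<in>W. g v x) \<in> elems (rkhs X (fam_kernel k c V))"
proof -
  interpret G: psd_kernel X "fam_kernel k c V" by (rule psd_fam[OF G])
  show ?thesis using W by (intro G.sum_mem mem_fam[OF G _ g]) auto
qed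

lemma Pow_fin_sets: "u \<in> fin_sets \<Longrightarrow> Pow u \<subseteq> fin_sets"
  by (auto simp: fin_sets_def intro: finite_subset)

lemma sum_space_mem_fam:
  assumes "good_family c V" "Pow u \<subseteq> V" "h \<in> sum_space \<rho> \<gamma> k u"
  shows "h \<in> elems (rkhs X (fam_kernel k c V))"
proof -
  from assms(3) obtain g where g: "\<forall>v\<in>Pow u. g v \<in> elems (rkhs X (k_u k v))"
    and h: "h = (\<lambda>x. \<Sum>v\<in>Pow u. g v x)" by (auto simp: sum_space_def H_u_def)
  show ?thesis unfolding h using g by (intro sum_mem_fam[OF assms(1,2)]) auto
qed

text \<open>
  In a decomposition over subsets of \<open>u\<close>, the part \<open>r\<close> that belongs to sets not contained in \<open>w\<close> is a
  difference of functions of the coordinates \<open>w\<close>, hence zero.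
\<close>

lemma sum_space_Int:
  assumes u: "u \<in> fin_sets" and w: "w \<in> fin_sets"
    and hu: "h \<in> sum_space \<rho> \<gamma> k u" and hw: "h \<in> sum_space \<rho> \<gamma> k w"
  shows "h \<in> sum_space \<rho> \<gamma> k (u \<inter> w)"
proof -
  from hu obtain g where g: "\<And>v. v \<in> Pow u \<Longrightarrow> g v \<in> elems (rkhs X (k_u k v))"
    and h: "h = (\<lambda>x. \<Sum>v\<in>Pow u. g v x)" by (auto simp: sum_space_def H_u_def)
  define r where "r x = (\<Sum>v\<in>Pow u - Pow w. g v x)" for x
  define p where "p x = (\<Sum>v\<in>Pow (u \<inter> w). g v x)" for x
  have fin: "finite u" using u by (simp add: fin_sets_def)
  have split: "h x = p x + r x" for x
  proof -
    have "Pow u = Pow (u \<inter> w) \<union> (Pow u - Pow w)" by auto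
    then have "h x = (\<Sum>v\<in>Pow (u \<inter> w) \<union> (Pow u - Pow w). g v x)" by (simp add: h)
    also have "\<dots> = p x + r x"
      unfolding p_def r_def using fin by (intro sum.union_disjoint) auto
    finally show ?thesis .
  qed
  let ?V = "Pow u - Pow w"
  have "?V \<subseteq> fin_sets" using Pow_fin_sets[OF u] by auto
  then have G: "good_family (\<lambda>_. 1) ?V" using fin by (intro good_family_finite) auto
  have r: "r \<in> elems (rkhs X (fam_kernel k (\<lambda>_. 1) ?V))"
    unfolding r_def using g by (intro sum_mem_fam[OF G order_refl]) auto
  have Gw: "good_family (\<lambda>_. 1) (Pow w)"
    using Pow_fin_sets[OF w] w by (intro good_family_finite) (auto simp: fin_sets_def)
  have "h \<in> elems (rkhs X (fam_kernel k (\<lambda>_. 1) (Pow w)))"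
    by (rule sum_space_mem_fam[OF Gw order_refl hw])
  moreover have "p \<in> elems (rkhs X (fam_kernel k (\<lambda>_. 1) (Pow w)))"
    unfolding p_def using g by (intro sum_mem_fam[OF Gw]) auto
  ultimately have "depends_on w h" "depends_on w p" by (auto intro: depends_on_fam[OF Gw])
  then have dep: "depends_on w r" using split unfolding depends_on_def by (metis add_left_cancel)
  have "r = (\<lambda>_. 0)" by (rule depends_on_imp_zero[OF G _ r dep]) auto
  then have "h = (\<lambda>x. \<Sum>v\<in>Pow (u \<inter> w). g v x)" using split by (auto simp: p_def fun_eq_iff)
  moreover have "\<forall>v\<in>Pow (u \<inter> w). g v \<in> elems (rkhs X (k_u k v))" using g by auto
  ultimately show ?thesis unfolding sum_space_def H_u_def by blast
qed

text \<open>
  Closure under intersection makes a set with fewest elements the least one.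
\<close>

lemma active_vars:
  assumes u: "u \<in> fin_sets" and h: "h \<in> sum_space \<rho> \<gamma> k u"
  shows "active_vars \<rho> \<gamma> k h \<in> fin_sets" and "h \<in> sum_space \<rho> \<gamma> k (active_vars \<rho> \<gamma> k h)"
    and "active_vars \<rho> \<gamma> k h \<subseteq> u"
proof -
  define P where "P w \<longleftrightarrow> w \<in> fin_sets \<and> h \<in> sum_space \<rho> \<gamma> k w" for w
  have "P u" using u h by (simp add: P_def)
  from ex_has_least_nat[of P, OF this, of card]
  obtain w where w: "P w" and least: "\<And>v. P v \<Longrightarrow> card w \<le> card v" by blast
  have sub: "w \<le> v" if v: "P v" for v
  proof -
    have "P (w \<inter> v)" using w v sum_space_Int by (auto simp: P_def fin_sets_def)
    from least[OF this] have "w \<inter> v = w"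
      using w by (intro card_seteq) (auto simp: P_def fin_sets_def)
    then show ?thesis by auto
  qed
  have "active_vars \<rho> \<gamma> k h = w"
    unfolding active_vars_def P_def[symmetric] using w sub by (rule Least_equality)
  with w sub[OF \<open>P u\<close>] show "active_vars \<rho> \<gamma> k h \<in> fin_sets"
    "h \<in> sum_space \<rho> \<gamma> k (active_vars \<rho> \<gamma> k h)" "active_vars \<rho> \<gamma> k h \<subseteq> u"
    by (auto simp: P_def)
qed

lemma H_gamma_eq: "H_gamma \<rho> \<gamma> k = rkhs X (fam_kernel k (weight \<gamma>) fin_sets)"
  by (simp add: H_gamma_def K_gamma_eq)

sublocale \<Gamma>: psd_kernel X "fam_kernel k (weight \<gamma>) fin_sets"
  by (rule psd_fam[OF good_family_weight[OF order_refl]])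

text \<open>
  The subsets of \<open>u\<close> and the remaining finite sets split \<open>K\<^sub>\<gamma>\<close> into two kernels whose spaces meet only
  in zero, so these spaces are orthogonal.
\<close>

lemma ip_sum_space_zero:
  assumes u: "u \<in> fin_sets" and h: "h \<in> sum_space \<rho> \<gamma> k u"
    and V: "V \<subseteq> fin_sets" "\<And>v. v \<in> V \<Longrightarrow> \<not> v \<subseteq> u"
    and f: "f \<in> elems (rkhs X (fam_kernel k (weight \<gamma>) V))"
  shows "f \<in> elems (H_gamma \<rho> \<gamma> k)"
    and "ip (H_gamma \<rho> \<gamma> k) f f \<le> ip (rkhs X (fam_kernel k (weight \<gamma>) V)) f f"
    and "ip (H_gamma \<rho> \<gamma> k) f h = 0"
proof -
  have GP: "good_family (weight \<gamma>) (Pow u)"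
    using Pow_fin_sets[OF u] by (rule good_family_weight)
  let ?U = "{v \<in> fin_sets. \<not> v \<subseteq> u}"
  have GU: "good_family (weight \<gamma>) ?U" by (rule good_family_weight) auto
  have split: "fam_kernel k (weight \<gamma>) (A \<union> B) x y = fam_kernel k (weight \<gamma>) A x y + fam_kernel k (weight \<gamma>) B x y"
    if A: "A \<subseteq> fin_sets" and B: "B \<subseteq> fin_sets" and AB: "A \<inter> B = {}" and x: "x \<in> X" and y: "y \<in> X" for A B x y
  proof -
    have "A \<union> B \<subseteq> fin_sets" using A B by auto
    note 1 = fam_has_sum[OF good_family_weight[OF this] x y]
    note 2 = has_sum_Un_disjoint[OF fam_has_sum[OF good_family_weight[OF A] x y]
      fam_has_sum[OF good_family_weight[OF B] x y] AB]
    from has_sum_unique[OF 1 2] show ?thesis .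
  qed
  \<comment> \<open>The family \<open>V\<close> is enlarged to all sets not contained in \<open>u\<close>, the complement of \<open>Pow u\<close>.\<close>
  interpret A: two_kernels X "fam_kernel k (weight \<gamma>) V" "fam_kernel k (weight \<gamma>) (?U - V)"
    unfolding two_kernels_def by (intro conjI psd_fam good_family_weight) (use V in auto)
  have subU: "?U - V \<subseteq> fin_sets" "?U \<subseteq> fin_sets" and disjU: "V \<inter> (?U - V) = {}" "Pow u \<inter> ?U = {}"
    by auto
  have VU: "V \<union> (?U - V) = ?U" using V by auto
  have "A.K12 x y = fam_kernel k (weight \<gamma>) ?U x y" if "x \<in> X" "y \<in> X" for x y
    using split[OF V(1) subU(1) disjU(1) that] by (simp only: VU)
  then have eqA: "rkhs X A.K12 = rkhs X (fam_kernel k (weight \<gamma>) ?U)" by (rule rkhs_cong)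
  interpret B: two_kernels X "fam_kernel k (weight \<gamma>) (Pow u)" "fam_kernel k (weight \<gamma>) ?U"
    unfolding two_kernels_def by (intro conjI psd_fam GP GU)
  have PU: "Pow u \<union> ?U = fin_sets" using Pow_fin_sets[OF u] by auto
  have "B.K12 x y = fam_kernel k (weight \<gamma>) fin_sets x y" if "x \<in> X" "y \<in> X" for x y
    using split[OF Pow_fin_sets[OF u] subU(2) disjU(2) that] by (simp only: PU)
  then have eqB: "rkhs X B.K12 = H_gamma \<rho> \<gamma> k" unfolding H_gamma_eq by (rule rkhs_cong)
  have fU: "f \<in> elems (rkhs X (fam_kernel k (weight \<gamma>) ?U))"
    and leU: "ip (rkhs X (fam_kernel k (weight \<gamma>) ?U)) f f \<le> ip (rkhs X (fam_kernel k (weight \<gamma>) V)) f f"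
    using A.left_mem f by (simp_all add: eqA)
  show "f \<in> elems (H_gamma \<rho> \<gamma> k)"
    using B.right_mem(1)[OF fU] by (simp only: eqB)
  show "ip (H_gamma \<rho> \<gamma> k) f f \<le> ip (rkhs X (fam_kernel k (weight \<gamma>) V)) f f"
    using B.right_mem(2)[OF fU] leU by (simp only: eqB)
  have h1: "h \<in> elems (rkhs X (fam_kernel k (weight \<gamma>) (Pow u)))"
    by (rule sum_space_mem_fam[OF GP order_refl h])
  have "ip (rkhs X B.K12) h f = 0"
  proof (rule B.orthogonal[OF _ h1 fU])
    fix g assume g: "g \<in> elems (rkhs X (fam_kernel k (weight \<gamma>) (Pow u)))"
      "g \<in> elems (rkhs X (fam_kernel k (weight \<gamma>) ?U))"
    have "depends_on u g" by (rule depends_on_fam[OF GP _ g(1)]) auto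
    with g(2) show "g = (\<lambda>_. 0)" by (intro depends_on_imp_zero[OF GU _ g(2)]) auto
  qed
  then show "ip (H_gamma \<rho> \<gamma> k) f h = 0"
    using B.K12.ip_commute[of h f] by (simp only: eqB)
qed

text \<open>
  The section at the constant sequence \<open>t\<close> of the kernel formed by the singletons in \<open>J\<close>; this gives its
  norm, and it is orthogonal to all functions of other coordinates.
\<close>

definition singleton_fun :: "nat set \<Rightarrow> 'a \<Rightarrow> (nat \<Rightarrow> 'a) \<Rightarrow> real" where
  "singleton_fun J t = (\<lambda>x. if x \<in> X then \<Sum>j\<in>J. \<gamma> j * k (x j) t else 0)"

lemma singleton_fun:
  assumes J: "finite J" "J \<subseteq> {1..}" and t: "t \<in> D"
  defines "R \<equiv> rkhs X (fam_kernel k (weight \<gamma>) ((\<lambda>j. {j}) ` J))"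
  shows "singleton_fun J t \<in> elems R"
    and "ip R (singleton_fun J t) (singleton_fun J t) = (\<Sum>j\<in>J. \<gamma> j) * k t t"
proof -
  let ?V = "(\<lambda>j. {j}) ` J"
  let ?K = "fam_kernel k (weight \<gamma>) ?V"
  let ?t = "\<lambda>j\<in>{1..}. t"
  have V: "?V \<subseteq> fin_sets" using J by (auto simp: fin_sets_def)
  interpret R: psd_kernel X ?K by (rule psd_fam[OF good_family_weight[OF V]])
  have K: "?K x y = (\<Sum>j\<in>J. \<gamma> j * k (x j) (y j))" for x y
    using J by (simp add: fam_kernel_def sum.reindex weight_def k_u_def o_def)
  have Kt: "?K x ?t = (\<Sum>j\<in>J. \<gamma> j * k (x j) t)" for x
    unfolding K using J by (intro sum.cong) auto
  have eq: "singleton_fun J t = kernel_section X ?K ?t"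
    by (intro ext) (simp only: singleton_fun_def kernel_section_def Kt)
  note tX = const_mem_X[OF t]
  show "singleton_fun J t \<in> elems R" unfolding R_def eq by (rule R.section_mem[OF tX])
  have "ip R (singleton_fun J t) (singleton_fun J t) = ?K ?t ?t"
    unfolding R_def eq using R.ip_section[OF tX R.section_mem[OF tX]] tX by (simp add: kernel_section_def)
  also have "\<dots> = (\<Sum>j\<in>J. \<gamma> j * k t t)" unfolding Kt using J by (intro sum.cong) auto
  finally show "ip R (singleton_fun J t) (singleton_fun J t) = (\<Sum>j\<in>J. \<gamma> j) * k t t"
    by (simp add: sum_distrib_right)
qed

end

section \<open>Integration over the sequence space\<close>

(* The index set {1..} of the product measure has to keep this form under simplification. *)
declare One_nat_def [simp del]

lemma bounded_multiples_imp_zero: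
  fixes a W :: real
  assumes "0 \<le> a" and bound: "\<And>r. \<bar>r\<bar> * a \<le> W"
  shows "a = 0"
proof (rule ccontr)
  assume "a \<noteq> 0"
  with \<open>0 \<le> a\<close> have "\<bar>(W + 1) / a\<bar> * a = \<bar>W + 1\<bar>" by simp
  with bound[of "(W + 1) / a"] show False by auto
qed

locale weighted_measure = weighted_kernel \<rho> \<gamma> k \<phi> + prob_space \<rho>
  for \<rho> :: "'a measure" and \<gamma> :: "nat \<Rightarrow> real" and k :: "'a \<Rightarrow> 'a \<Rightarrow> real"
    and \<phi> :: "nat \<Rightarrow> 'a \<Rightarrow> real" +
  fixes U :: "nat \<Rightarrow> nat set"
  assumes diag_integrable: "integrable \<rho> (\<lambda>x. k x x)"
    and enum: "bij_betw U UNIV fin_sets"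
begin

sublocale PM: product_prob_space "\<lambda>_::nat. \<rho>" "{1..}"
  by unfold_locales

abbreviation PM where "PM \<equiv> \<Pi>\<^sub>M j\<in>{1..}. \<rho>"
abbreviation N where "N \<equiv> prod_meas \<rho> \<gamma> k"
abbreviation H\<gamma> where "H\<gamma> \<equiv> H_gamma \<rho> \<gamma> k"

lemma coordinate_product:
  fixes F :: "nat \<Rightarrow> 'a \<Rightarrow> real"
  assumes J: "finite J" "J \<subseteq> {1..}" and F: "\<And>j. j \<in> J \<Longrightarrow> integrable \<rho> (F j)"
  shows "integrable PM (\<lambda>x. \<Prod>j\<in>J. F j (x j))"
    and "(\<integral>x. (\<Prod>j\<in>J. F j (x j)) \<partial>PM) = (\<Prod>j\<in>J. \<integral>t. F j t \<partial>\<rho>)"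
proof -
  let ?P = "\<Pi>\<^sub>M j\<in>J. \<rho>"
  have D: "distr PM ?P (\<lambda>x. restrict x J) = ?P" by (rule PM.distr_PiM_restrict_finite[OF J])
  have r: "(\<lambda>x. restrict x J) \<in> measurable PM ?P" using J by (intro measurable_restrict_subset)
  have m: "(\<lambda>x. \<Prod>j\<in>J. F j (x j)) \<in> borel_measurable ?P"
    using F[THEN borel_measurable_integrable]
    by (intro borel_measurable_prod) (auto intro: measurable_compose[OF measurable_component_singleton])
  have eq: "(\<Prod>j\<in>J. F j (restrict x J j)) = (\<Prod>j\<in>J. F j (x j))" for x by (intro prod.cong) auto
  have "integrable ?P (\<lambda>x. \<Prod>j\<in>J. F j (x j))" by (rule PM.product_integrable_prod[OF J(1) F])
  then show "integrable PM (\<lambda>x. \<Prod>j\<in>J. F j (x j))"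
    using integrable_distr_eq[OF r m] by (simp only: D eq)
  have "(\<integral>x. (\<Prod>j\<in>J. F j (x j)) \<partial>?P) = (\<Prod>j\<in>J. \<integral>t. F j t \<partial>\<rho>)"
    by (rule PM.product_integral_prod[OF J(1) F])
  then show "(\<integral>x. (\<Prod>j\<in>J. F j (x j)) \<partial>PM) = (\<Prod>j\<in>J. \<integral>t. F j t \<partial>\<rho>)"
    using integral_distr[OF r m] by (simp only: D eq)
qed

lemma coordinate:
  fixes F :: "'a \<Rightarrow> real" and j :: nat
  assumes "j \<ge> 1" "integrable \<rho> F"
  shows "integrable PM (\<lambda>x. F (x j))" and "(\<integral>x. F (x j) \<partial>PM) = (\<integral>t. F t \<partial>\<rho>)"
  using coordinate_product[of "{j}" "\<lambda>_. F"] assms by auto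

text \<open>
  The diagonal of \<open>K\<^sub>\<gamma>\<close> as an extended real function on all sequences, summed along the enumeration \<open>U\<close>.
  The domain is the set where it is finite. Since its integral is finite, the domain is measurable and
  has full measure, and the diagonal is integrable.
\<close>

definition diag_term :: "nat \<Rightarrow> (nat \<Rightarrow> 'a) \<Rightarrow> real" where
  "diag_term n x = (\<Prod>j\<in>U n. \<gamma> j * k (x j) (x j))"

definition diag_sum :: "(nat \<Rightarrow> 'a) \<Rightarrow> ennreal" where
  "diag_sum x = (\<Sum>n. ennreal (diag_term n x))"

lemma U_fin: "U n \<in> fin_sets" "finite (U n)" "U n \<subseteq> {1..}"
  using enum by (auto simp: bij_betw_def fin_sets_def)

lemma space_PM: "space PM = {1..} \<rightarrow>\<^sub>E D"
  by (simp add: space_PiM)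

lemma diag_term_nonneg: "x \<in> space PM \<Longrightarrow> 0 \<le> diag_term n x"
  unfolding diag_term_def space_PM using U_fin(3)[of n] gamma_pos
  by (intro prod_nonneg mult_nonneg_nonneg k.diag_nonneg) (auto simp: PiE_iff less_imp_le subset_iff)

lemma diag_term_integrable: "integrable PM (diag_term n)"
  and diag_term_integral: "(\<integral>x. diag_term n x \<partial>PM) = (\<Prod>j\<in>U n. \<gamma> j * (\<integral>t. k t t \<partial>\<rho>))"
  using coordinate_product[OF U_fin(2,3), of n "\<lambda>j t. \<gamma> j * k t t"] diag_integrable
  by (simp_all add: diag_term_def[abs_def])

lemma diag_sum_measurable [measurable]: "diag_sum \<in> borel_measurable PM"
  unfolding diag_sum_def[abs_def]
  by (intro borel_measurable_suminf_order measurable_compose[OF borel_measurable_integrable[OF diag_term_integrable]]) simp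

lemma diag_mean_nonneg: "0 \<le> (\<integral>t. k t t \<partial>\<rho>)"
  using k.diag_nonneg by (intro integral_nonneg_AE) auto

lemma diag_sum_integral: "(\<integral>\<^sup>+x. diag_sum x \<partial>PM) < \<infinity>"
proof -
  let ?t = "\<lambda>j. \<gamma> j * (\<integral>t. k t t \<partial>\<rho>)"
  have t0: "0 \<le> ?t j" if "j \<ge> 1" for j using gamma_pos[OF that] diag_mean_nonneg by simp
  have "(\<lambda>u. \<Prod>j\<in>u. ?t j) summable_on fin_sets"
    using summable_on_fin_sets_iff[of ?t, OF t0] summable_on_cmult_left[OF gamma_summable] by blast
  then have "(\<lambda>n. \<Prod>j\<in>U n. ?t j) summable_on UNIV"
    using summable_on_reindex_bij_betw[OF enum, of "\<lambda>u. \<Prod>j\<in>u. ?t j"] by simp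
  then have s: "summable (\<lambda>n. \<Prod>j\<in>U n. ?t j)" by (rule summable_on_imp_summable)
  have "(\<integral>\<^sup>+x. diag_sum x \<partial>PM) = (\<Sum>n. \<integral>\<^sup>+x. ennreal (diag_term n x) \<partial>PM)"
    unfolding diag_sum_def
    by (intro nn_integral_suminf measurable_compose[OF borel_measurable_integrable[OF diag_term_integrable]]) simp
  also have "\<dots> = (\<Sum>n. ennreal (\<Prod>j\<in>U n. ?t j))"
    by (intro suminf_cong, subst nn_integral_eq_integral[OF diag_term_integrable])
      (auto simp: diag_term_integral intro!: AE_I2 diag_term_nonneg)
  also have "\<dots> < \<infinity>"
  proof -
    have "0 \<le> (\<Prod>j\<in>U n. ?t j)" for n
      using U_fin(3)[of n] by (intro prod_nonneg t0) auto
    from ennreal_suminf_neq_top[OF s this] show ?thesis by (simp add: less_top)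
  qed
  finally show ?thesis .
qed

lemma diag_sum_on_X:
  assumes "x \<in> X"
  shows "diag_sum x = ennreal (fam_kernel k (weight \<gamma>) fin_sets x x)"
proof -
  have xs: "x \<in> space PM" using assms by (simp add: space_PM X_dom_def)
  have "((\<lambda>u. weight \<gamma> u * k_u k u x x) has_sum fam_kernel k (weight \<gamma>) fin_sets x x) fin_sets"
    by (rule fam_has_sum[OF good_family_weight[OF order_refl] assms assms])
  then have "((\<lambda>n. diag_term n x) has_sum fam_kernel k (weight \<gamma>) fin_sets x x) UNIV"
    using has_sum_reindex_bij_betw[OF enum, of "\<lambda>u. weight \<gamma> u * k_u k u x x"]
    by (simp add: weighted_diag diag_term_def)
  from has_sum_imp_sums[OF this] show ?thesis
    unfolding diag_sum_def by (intro suminf_ennreal_eq diag_term_nonneg[OF xs])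
qed

lemma mem_X_diag_sum: "x \<in> X \<longleftrightarrow> x \<in> space PM \<and> diag_sum x \<noteq> \<infinity>"
proof
  assume "x \<in> X"
  then show "x \<in> space PM \<and> diag_sum x \<noteq> \<infinity>"
    using diag_sum_on_X[of x] by (simp add: space_PM X_dom_def)
next
  assume x: "x \<in> space PM \<and> diag_sum x \<noteq> \<infinity>"
  then have "summable (\<lambda>n. diag_term n x)"
    unfolding diag_sum_def by (intro summable_suminf_not_top diag_term_nonneg) auto
  then have "(\<lambda>n. diag_term n x) summable_on UNIV"
    using x by (intro summable_nonneg_imp_summable_on) (auto intro: diag_term_nonneg)
  then have "(\<lambda>u. weight \<gamma> u * k_u k u x x) summable_on fin_sets"
    using summable_on_reindex_bij_betw[OF enum, of "\<lambda>u. weight \<gamma> u * k_u k u x x"]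
    by (simp add: weighted_diag diag_term_def)
  with x show "x \<in> X" by (simp add: space_PM X_dom_def)
qed

lemma X_sets [measurable]: "X \<in> sets PM"
proof -
  have "X = {x \<in> space PM. diag_sum x \<noteq> \<infinity>}" using mem_X_diag_sum by auto
  also have "\<dots> \<in> sets PM" by measurable
  finally show ?thesis .
qed

lemma X_space: "X \<subseteq> space PM"
  using mem_X_diag_sum by auto

lemma AE_X: "AE x in PM. x \<in> X"
  using nn_integral_PInf_AE[OF diag_sum_measurable] diag_sum_integral AE_space
  by (auto simp: mem_X_diag_sum)

lemma space_N: "space N = X"
  using X_space by (auto simp: prod_meas_def space_restrict_space)

lemma measurable_N: "f \<in> borel_measurable PM \<Longrightarrow> f \<in> borel_measurable N"
  unfolding prod_meas_def by (rule measurable_restrict_space1)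

lemma X_Int_sets: "X \<inter> space PM \<in> sets PM"
  by measurable

lemma integrable_N:
  fixes f :: "_ \<Rightarrow> real"
  assumes "integrable PM f" shows "integrable N f"
  unfolding prod_meas_def
  by (subst integrable_restrict_space[OF X_Int_sets]) (intro integrable_mult_indicator X_sets assms)

lemma integral_N:
  fixes f :: "_ \<Rightarrow> real"
  assumes "f \<in> borel_measurable PM" shows "(\<integral>x. f x \<partial>N) = (\<integral>x. f x \<partial>PM)"
proof -
  have "(\<integral>x. f x \<partial>N) = (\<integral>x. indicator X x *\<^sub>R f x \<partial>PM)"
    unfolding prod_meas_def by (rule integral_restrict_space[OF X_Int_sets])
  also have "\<dots> = (\<integral>x. f x \<partial>PM)"
    using AE_X by (intro integral_cong_AE) (use assms in \<open>auto simp: indicator_def\<close>)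
  finally show ?thesis .
qed

lemma kernel_diag_integrable: "integrable N (\<lambda>x. fam_kernel k (weight \<gamma>) fin_sets x x)"
proof -
  have "integrable PM (\<lambda>x. enn2real (diag_sum x))"
  proof (rule integrableI_nonneg)
    have "(\<integral>\<^sup>+x. ennreal (enn2real (diag_sum x)) \<partial>PM) \<le> (\<integral>\<^sup>+x. diag_sum x \<partial>PM)"
      by (intro nn_integral_mono) (auto simp: ennreal_enn2real_if)
    with diag_sum_integral show "(\<integral>\<^sup>+x. ennreal (enn2real (diag_sum x)) \<partial>PM) < \<infinity>"
      by (rule le_less_trans[rotated])
  qed simp_all
  from integrable_N[OF this] have "integrable N (\<lambda>x. enn2real (diag_sum x))" .
  also have "?this \<longleftrightarrow> ?thesis"
  proof (rule Bochner_Integration.integrable_cong[OF refl])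
    fix x assume "x \<in> space N"
    then have x: "x \<in> X" by (simp add: space_N)
    show "enn2real (diag_sum x) = fam_kernel k (weight \<gamma>) fin_sets x x"
      unfolding diag_sum_on_X[OF x] using \<Gamma>.diag_nonneg[OF x] by simp
  qed
  finally show ?thesis .
qed

subsection \<open>The worst-case error is a finite supremum\<close>

abbreviation unit_ball where "unit_ball \<equiv> {f \<in> elems H\<gamma>. hnorm H\<gamma> f \<le> 1}"

lemma H\<gamma>: "hilbert_functions X H\<gamma>"
  unfolding H_gamma_eq by (rule \<Gamma>.hilbert_functions_axioms)

sublocale H\<gamma>: hilbert_functions X H\<gamma> by (rule H\<gamma>)

lemma unit_ball_iff: "f \<in> unit_ball \<longleftrightarrow> f \<in> elems H\<gamma> \<and> ip H\<gamma> f f \<le> 1"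
  by (simp add: hnorm_def)

text \<open>
  If the square of \<open>f\<close> is not integrable, its integral has the value zero and the bound is trivial.
\<close>

lemma L2_norm_le:
  assumes B: "integrable M B" and le: "\<And>x. x \<in> space M \<Longrightarrow> (f x)\<^sup>2 \<le> B x"
  shows "L2_norm M f \<le> sqrt (\<integral>x. B x \<partial>M)"
  unfolding L2_norm_def real_sqrt_le_iff
proof (cases "integrable M (\<lambda>x. (f x)\<^sup>2)")
  case True
  then show "(\<integral>x. (f x)\<^sup>2 \<partial>M) \<le> (\<integral>x. B x \<partial>M)" by (intro integral_mono B le)
next
  case False
  have "0 \<le> B x" if "x \<in> space M" for x using le[OF that] by (rule order_trans[OF zero_le_power2])
  then have "0 \<le> (\<integral>x. B x \<partial>M)" by (intro integral_nonneg_AE AE_I2)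
  with False show "(\<integral>x. (f x)\<^sup>2 \<partial>M) \<le> (\<integral>x. B x \<partial>M)" by (simp add: not_integrable_integral_eq)
qed

text \<open>
  The supremum of an unbounded set of real numbers is unspecified. Before \<open>wc_error\<close> can be compared
  with the error for a single function, the errors on the unit ball have to be bounded.
\<close>

lemma algorithm_bound:
  assumes "\<forall>(h, g)\<in>set A. g \<in> L2 N"
  shows "\<exists>B. integrable N B \<and> (\<forall>f\<in>unit_ball. \<forall>x. (apply_alg H\<gamma> A f x)\<^sup>2 \<le> B x)"
  using assms
proof (induction A)
  case Nil
  show ?case by (intro exI[of _ "\<lambda>_. 0"]) (simp add: apply_alg_def)
next
  case (Cons p A)
  obtain h g where p: "p = (h, g)" by (cases p)
  from Cons obtain B where B: "integrable N B" "\<And>f x. f \<in> unit_ball \<Longrightarrow> (apply_alg H\<gamma> A f x)\<^sup>2 \<le> B x"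
    by auto
  have g: "integrable N (\<lambda>x. (g x)\<^sup>2)" using Cons.prems p by (simp add: L2_def)
  let ?B = "\<lambda>x. 2 * ip H\<gamma> h h * (g x)\<^sup>2 + 2 * B x"
  have "(apply_alg H\<gamma> (p # A) f x)\<^sup>2 \<le> ?B x" if f: "f \<in> unit_ball" for f x
  proof -
    have "(ip H\<gamma> f h)\<^sup>2 \<le> ip H\<gamma> f f * ip H\<gamma> h h" by (rule H\<gamma>.Cauchy_Schwarz)
    also have "\<dots> \<le> 1 * ip H\<gamma> h h"
      using f unfolding unit_ball_iff by (intro mult_right_mono H\<gamma>.ip_nonneg) simp
    finally have 1: "(ip H\<gamma> f h * g x)\<^sup>2 \<le> ip H\<gamma> h h * (g x)\<^sup>2"
      by (simp add: power_mult_distrib mult_right_mono)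
    have 2: "apply_alg H\<gamma> (p # A) f x = ip H\<gamma> f h * g x + apply_alg H\<gamma> A f x"
      by (simp add: p apply_alg_def)
    have "(a + b)\<^sup>2 \<le> 2 * a\<^sup>2 + 2 * b\<^sup>2" for a b :: real
      using zero_le_power2[of "a - b"] by (simp add: power2_eq_square algebra_simps)
    from this[of "ip H\<gamma> f h * g x" "apply_alg H\<gamma> A f x"] 1 B(2)[OF f, of x] show ?thesis
      unfolding 2 by linarith
  qed
  moreover have "integrable N ?B" using g B(1) by simp
  ultimately show ?case by blast
qed

lemma error_bdd_above:
  assumes "admissible \<rho> \<gamma> k A"
  shows "bdd_above ((\<lambda>f. L2_norm N (\<lambda>x. f x - apply_alg H\<gamma> A f x)) ` unit_ball)"
proof -
  have "\<forall>(h, g)\<in>set A. g \<in> L2 N" using assms by (auto simp: admissible_def)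
  from algorithm_bound[OF this] obtain B where B: "integrable N B"
    "\<And>f x. f \<in> unit_ball \<Longrightarrow> (apply_alg H\<gamma> A f x)\<^sup>2 \<le> B x" by blast
  let ?B = "\<lambda>x. 2 * fam_kernel k (weight \<gamma>) fin_sets x x + 2 * B x"
  have "L2_norm N (\<lambda>x. f x - apply_alg H\<gamma> A f x) \<le> sqrt (\<integral>x. ?B x \<partial>N)" if f: "f \<in> unit_ball" for f
  proof (rule L2_norm_le)
    show "integrable N ?B" using B(1) kernel_diag_integrable by simp
    fix x assume "x \<in> space N"
    then have x: "x \<in> X" by (simp add: space_N)
    have f': "f \<in> elems \<Gamma>.H" "ip \<Gamma>.H f f \<le> 1" using f[unfolded unit_ball_iff] unfolding H_gamma_eq by auto
    have "(f x)\<^sup>2 \<le> ip \<Gamma>.H f f * fam_kernel k (weight \<gamma>) fin_sets x x" by (rule \<Gamma>.mem_sq_le[OF f'(1) x])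
    also have "\<dots> \<le> 1 * fam_kernel k (weight \<gamma>) fin_sets x x"
      by (intro mult_right_mono f'(2) \<Gamma>.diag_nonneg[OF x])
    finally have 1: "(f x)\<^sup>2 \<le> fam_kernel k (weight \<gamma>) fin_sets x x" by simp
    have "(f x - apply_alg H\<gamma> A f x)\<^sup>2 \<le> 2 * (f x)\<^sup>2 + 2 * (apply_alg H\<gamma> A f x)\<^sup>2"
      using zero_le_power2[of "f x + apply_alg H\<gamma> A f x"] by (simp add: power2_eq_square algebra_simps)
    with 1 B(2)[OF f, of x] show "(f x - apply_alg H\<gamma> A f x)\<^sup>2 \<le> ?B x" by linarith
  qed
  then show ?thesis by (intro bdd_aboveI2)
qed

lemma error_ge:
  assumes "admissible \<rho> \<gamma> k A" "f \<in> unit_ball"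
  shows "L2_norm N (\<lambda>x. f x - apply_alg H\<gamma> A f x) \<le> wc_error \<rho> \<gamma> k A"
  unfolding wc_error_def Let_def by (rule cSUP_upper[OF assms(2) error_bdd_above[OF assms(1)]])

lemma zero_unit_ball: "(\<lambda>_. 0) \<in> unit_ball"
  by (simp add: hnorm_def)

lemma error_nonneg: "admissible \<rho> \<gamma> k A \<Longrightarrow> 0 \<le> wc_error \<rho> \<gamma> k A"
  by (rule order_trans[OF _ error_ge[OF _ zero_unit_ball]]) (simp_all add: L2_norm_def)

lemma error_le:
  assumes "\<And>f. f \<in> elems H\<gamma> \<Longrightarrow> ip H\<gamma> f f \<le> 1 \<Longrightarrow> L2_norm N (\<lambda>x. f x - apply_alg H\<gamma> A f x) \<le> C"
  shows "wc_error \<rho> \<gamma> k A \<le> C"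
  unfolding wc_error_def Let_def
proof (rule cSUP_least)
  show "unit_ball \<noteq> {}" using zero_unit_ball by blast
  show "L2_norm N (\<lambda>x. f x - apply_alg H\<gamma> A f x) \<le> C" if "f \<in> unit_ball" for f
    using assms that unfolding unit_ball_iff by blast
qed

lemma min_error_le:
  assumes "admissible \<rho> \<gamma> k A" "nested_cost \<rho> \<gamma> k c A \<le> real n"
  shows "min_error \<rho> \<gamma> k c n \<le> wc_error \<rho> \<gamma> k A"
  unfolding min_error_def by (rule cINF_lower) (use assms error_nonneg in \<open>auto intro!: bdd_belowI2[where m = 0]\<close>)

lemma min_error_ge:
  assumes "\<And>A. admissible \<rho> \<gamma> k A \<Longrightarrow> nested_cost \<rho> \<gamma> k c A \<le> real n \<Longrightarrow> C \<le> wc_error \<rho> \<gamma> k A"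
  shows "C \<le> min_error \<rho> \<gamma> k c n"
proof -
  have "[] \<in> {A. admissible \<rho> \<gamma> k A \<and> nested_cost \<rho> \<gamma> k c A \<le> real n}"
    by (simp add: admissible_def nested_cost_def)
  then show ?thesis unfolding min_error_def using assms by (intro cINF_greatest) auto
qed

lemma min_error_nonneg: "0 \<le> min_error \<rho> \<gamma> k c n"
  by (rule min_error_ge) (rule error_nonneg)

subsection \<open>Functions of single coordinates that the algorithm cannot see\<close>

text \<open>
  The \<open>L\<^sup>2\<close> norm dominates the mean, and the means of the summands add up.
\<close>

lemma singleton_fun_L2:
  assumes J: "finite J" "J \<subseteq> {1..}" and t: "(\<lambda>y. k y t) \<in> L2 \<rho>"
  shows "(\<Sum>j\<in>J. \<gamma> j) * \<bar>\<integral>y. k y t \<partial>\<rho>\<bar> \<le> L2_norm N (singleton_fun J t)"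
proof -
  define s where "s x = (\<Sum>j\<in>J. \<gamma> j * k (x j) t)" for x :: "nat \<Rightarrow> 'a"
  have m: "(\<lambda>y. k y t) \<in> borel_measurable \<rho>" and sq: "integrable \<rho> (\<lambda>y. (k y t)\<^sup>2)"
    using t by (auto simp: L2_def)
  have int: "integrable \<rho> (\<lambda>y. k y t)" by (rule square_integrable_imp_integrable[OF m sq])
  have jJ: "j \<ge> 1" if "j \<in> J" for j using J that by auto
  have s_int: "integrable PM s"
    unfolding s_def[abs_def] using coordinate(1)[OF jJ int] by simp
  have s_sq: "integrable PM (\<lambda>x. (s x)\<^sup>2)"
  proof (rule Bochner_Integration.integrable_bound)
    show "integrable PM (\<lambda>x. (\<Sum>j\<in>J. (\<gamma> j)\<^sup>2) * (\<Sum>j\<in>J. (k (x j) t)\<^sup>2))"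
      using coordinate(1)[OF jJ sq] by simp
    show "(\<lambda>x. (s x)\<^sup>2) \<in> borel_measurable PM" using s_int by measurable
    show "AE x in PM. norm ((s x)\<^sup>2) \<le> norm ((\<Sum>j\<in>J. (\<gamma> j)\<^sup>2) * (\<Sum>j\<in>J. (k (x j) t)\<^sup>2))"
      unfolding s_def using Cauchy_Schwarz_ineq_sum[of \<gamma> _ J]
      by (intro AE_I2) (simp add: abs_mult sum_nonneg)
  qed
  have mean: "(\<integral>x. s x \<partial>PM) = (\<Sum>j\<in>J. \<gamma> j) * (\<integral>y. k y t \<partial>\<rho>)"
    unfolding s_def using coordinate[OF jJ int] by (subst Bochner_Integration.integral_sum) (auto simp: sum_distrib_right)
  have "(\<integral>x. s x \<partial>PM)\<^sup>2 \<le> (\<integral>x. (s x)\<^sup>2 \<partial>PM)"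
    using PM.variance_eq[OF s_int s_sq] PM.variance_positive[of s] by simp
  also have "\<dots> = (\<integral>x. (s x)\<^sup>2 \<partial>N)" by (rule integral_N[symmetric]) (use s_sq in measurable)
  also have "\<dots> = (\<integral>x. (singleton_fun J t x)\<^sup>2 \<partial>N)"
    by (intro Bochner_Integration.integral_cong) (auto simp: space_N singleton_fun_def s_def)
  finally have "\<bar>\<integral>x. s x \<partial>PM\<bar> \<le> L2_norm N (singleton_fun J t)"
    unfolding L2_norm_def by (intro real_le_rsqrt) simp
  moreover have "0 \<le> (\<Sum>j\<in>J. \<gamma> j)" using gamma_pos[OF jJ] by (intro sum_nonneg) (auto simp: less_imp_le)
  ultimately show ?thesis by (simp add: mean abs_mult)
qed

text \<open>
  An algorithm whose functionals only involve the coordinates \<open>1, \<dots>, d\<close> returns zero on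
  \<open>singleton_fun J t\<close> when \<open>J\<close> lies beyond \<open>d\<close>. For a kernel whose mean does not vanish, the
  contributions of the different coordinates to the \<open>L\<^sup>2\<close> norm add up instead of being orthogonal.
\<close>

lemma error_lower_bound:
  assumes A: "admissible \<rho> \<gamma> k A" and act: "\<And>h g. (h, g) \<in> set A \<Longrightarrow> active_vars \<rho> \<gamma> k h \<subseteq> {1..d}"
    and J: "finite J" "J \<subseteq> {Suc d..}" and t: "t \<in> D" "(\<lambda>y. k y t) \<in> L2 \<rho>"
  shows "sqrt (\<Sum>j\<in>J. \<gamma> j) * \<bar>\<integral>y. k y t \<partial>\<rho>\<bar> \<le> sqrt (k t t) * wc_error \<rho> \<gamma> k A"
proof -
  let ?f = "singleton_fun J t" and ?V = "(\<lambda>j. {j}) ` J" and ?m = "\<bar>\<integral>y. k y t \<partial>\<rho>\<bar>"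
  define G where "G = (\<Sum>j\<in>J. \<gamma> j)"
  have J1: "J \<subseteq> {1..}" using J by auto
  have G0: "0 \<le> G" unfolding G_def using gamma_pos J1 by (intro sum_nonneg) (auto simp: less_imp_le)
  have V: "?V \<subseteq> fin_sets" using J1 by (auto simp: fin_sets_def)
  note f = singleton_fun[OF J(1) J1 t(1)]
  have zero: "ip H\<gamma> ?f h = 0" if "(h, g) \<in> set A" for h g
  proof -
    from A that obtain u where u: "u \<in> fin_sets" "h \<in> sum_space \<rho> \<gamma> k u" by (auto simp: admissible_def)
    have "\<not> v \<subseteq> active_vars \<rho> \<gamma> k h" if v: "v \<in> ?V" for v
    proof -
      from v obtain j where "j \<in> J" "v = {j}" by auto
      then have "j \<notin> {1..d}" using J by auto
      with act[OF \<open>(h, g) \<in> set A\<close>] \<open>v = {j}\<close> show ?thesis by blast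
    qed
    then show ?thesis by (rule ip_sum_space_zero(3)[OF active_vars(1,2)[OF u] V _ f(1)])
  qed
  have e: "{} \<in> fin_sets" by (simp add: fin_sets_def)
  have h0: "(\<lambda>_. 0) \<in> sum_space \<rho> \<gamma> k {}"
    using psd_kernel.is_rkhs[OF psd_u[OF e]] unfolding sum_space_def H_u_def
    by (auto simp: is_rkhs_def hilbert_fun_space_def intro!: exI[of _ "\<lambda>_ _. 0"])
  have fH: "?f \<in> elems H\<gamma>" and fn: "ip H\<gamma> ?f ?f \<le> G * k t t"
    using ip_sum_space_zero(1,2)[OF e h0 V _ f(1)] f(2) by (auto simp: G_def)
  have key: "L2_norm N (\<lambda>x. r * ?f x) \<le> wc_error \<rho> \<gamma> k A" if r: "r\<^sup>2 * (G * k t t) \<le> 1" for r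
  proof -
    have "ip H\<gamma> (\<lambda>x. r * ?f x) (\<lambda>x. r * ?f x) = r\<^sup>2 * ip H\<gamma> ?f ?f"
      using fH by (simp add: H\<gamma>.ip_mult H\<gamma>.ip_mult_right H\<gamma>.mult power2_eq_square)
    also have "\<dots> \<le> r\<^sup>2 * (G * k t t)" using fn by (intro mult_left_mono) auto
    finally have ub: "(\<lambda>x. r * ?f x) \<in> unit_ball"
      using r fH unfolding unit_ball_iff by (auto intro: H\<gamma>.mult)
    have "ip H\<gamma> (\<lambda>x. r * ?f x) h = 0" if "(h, g) \<in> set A" for h g
    proof (cases "h \<in> elems H\<gamma>")
      case True
      then show ?thesis using zero[OF that] fH by (simp add: H\<gamma>.ip_mult)
    qed (use H\<gamma>.ip_outside in blast)
    then have "apply_alg H\<gamma> A (\<lambda>x. r * ?f x) y = 0" for y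
      unfolding apply_alg_def by (intro sum_list_nonneg_eq_0_iff[THEN iffD2]) auto
    with error_ge[OF A ub] show ?thesis by simp
  qed
  have L2m: "L2_norm N (\<lambda>x. r * ?f x) = \<bar>r\<bar> * L2_norm N ?f" for r
    by (simp add: L2_norm_def power_mult_distrib real_sqrt_mult)
  have kt: "0 \<le> k t t" by (rule k.diag_nonneg[OF t(1)])
  show ?thesis
  proof (cases "G * k t t = 0")
    case True
    have "\<bar>r\<bar> * (G * ?m) \<le> wc_error \<rho> \<gamma> k A" for r
    proof -
      have "r\<^sup>2 * (G * k t t) \<le> 1" unfolding True by simp
      from key[OF this] have "\<bar>r\<bar> * L2_norm N ?f \<le> wc_error \<rho> \<gamma> k A" by (simp only: L2m)
      moreover have "\<bar>r\<bar> * (G * ?m) \<le> \<bar>r\<bar> * L2_norm N ?f"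
        unfolding G_def by (intro mult_left_mono singleton_fun_L2[OF J(1) J1 t(2)]) simp
      ultimately show ?thesis by linarith
    qed
    then have "G * ?m = 0" using G0 by (intro bounded_multiples_imp_zero[of "G * ?m"]) auto
    then have "sqrt G * ?m = 0" by auto
    moreover have "0 \<le> sqrt (k t t) * wc_error \<rho> \<gamma> k A" using error_nonneg[OF A] kt by simp
    ultimately show ?thesis unfolding G_def by linarith
  next
    case False
    with G0 kt have pos: "0 < G" "0 < k t t" by (auto simp: less_le)
    define r where "r = 1 / sqrt (G * k t t)"
    have rp: "0 \<le> r" using pos by (simp add: r_def)
    have "r\<^sup>2 * (G * k t t) = 1" using pos by (simp add: r_def power_divide)
    with key[of r] have "r * L2_norm N ?f \<le> wc_error \<rho> \<gamma> k A" using L2m[of r] rp by simp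
    with mult_left_mono[OF singleton_fun_L2[OF J(1) J1 t(2)] rp]
    have "r * (G * ?m) \<le> wc_error \<rho> \<gamma> k A" by (simp add: G_def)
    then have "sqrt (k t t) * (r * (G * ?m)) \<le> sqrt (k t t) * wc_error \<rho> \<gamma> k A"
      using kt by (intro mult_left_mono) auto
    moreover have "sqrt (k t t) * (r * (G * ?m)) = sqrt G * ?m"
      using pos by (simp add: r_def real_sqrt_mult field_simps)
    ultimately show ?thesis unfolding G_def by linarith
  qed
qed

end

section \<open>The spectral algorithm for kernels of mean zero\<close>

lemma integrable_mult_of_squares:
  fixes f g :: "'x \<Rightarrow> real"
  assumes m: "f \<in> borel_measurable M" "g \<in> borel_measurable M"
    and sq: "integrable M (\<lambda>x. (f x)\<^sup>2)" "integrable M (\<lambda>x. (g x)\<^sup>2)"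
  shows "integrable M (\<lambda>x. f x * g x)"
proof (rule Bochner_Integration.integrable_bound)
  show "integrable M (\<lambda>x. (f x)\<^sup>2 + (g x)\<^sup>2)" using sq by simp
  have "\<bar>a * b\<bar> \<le> a\<^sup>2 + b\<^sup>2" for a b :: real
    using zero_le_power2[of "\<bar>a\<bar> - \<bar>b\<bar>"] mult_nonneg_nonneg[of "\<bar>a\<bar>" "\<bar>b\<bar>"]
    by (simp add: abs_mult power2_diff del: mult_nonneg_nonneg)
  then show "AE x in M. norm (f x * g x) \<le> norm ((f x)\<^sup>2 + (g x)\<^sup>2)" by simp
qed (use m in simp)

text \<open>
  The squared norms are only bounded by \<open>\<mu>\<close>, because one function of the system constructed below is
  zero.
\<close>

locale anova_frame = weighted_measure \<rho> \<gamma> k \<phi> U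
  for \<rho> :: "'a measure" and \<gamma> :: "nat \<Rightarrow> real" and k :: "'a \<Rightarrow> 'a \<Rightarrow> real"
    and \<phi> :: "nat \<Rightarrow> 'a \<Rightarrow> real" and U :: "nat \<Rightarrow> nat set" +
  fixes \<mu> :: "nat \<Rightarrow> real"
  assumes phi_meas [measurable]: "\<phi> i \<in> borel_measurable \<rho>"
    and phi_sq: "integrable \<rho> (\<lambda>x. (\<phi> i x)\<^sup>2)"
    and phi_mean: "(\<integral>x. \<phi> i x \<partial>\<rho>) = 0"
    and phi_orth: "i \<noteq> j \<Longrightarrow> (\<integral>x. \<phi> i x * \<phi> j x \<partial>\<rho>) = 0"
    and phi_norm: "(\<integral>x. (\<phi> i x)\<^sup>2 \<partial>\<rho>) \<le> \<mu> i"
    and mu_nonneg: "0 \<le> \<mu> i"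
begin

definition Idx :: "(nat set \<times> (nat \<Rightarrow> nat)) set" where
  "Idx = Sigma fin_sets (\<lambda>u. PiE u (\<lambda>_. UNIV))"

definition eta :: "nat set \<times> (nat \<Rightarrow> nat) \<Rightarrow> (nat \<Rightarrow> 'a) \<Rightarrow> real" where
  "eta a x = sqrt (weight \<gamma> (fst a)) * frame_u (fst a) (snd a) x"

definition lam :: "nat set \<times> (nat \<Rightarrow> nat) \<Rightarrow> real" where
  "lam a = weight \<gamma> (fst a) * (\<Prod>j\<in>fst a. \<mu> (snd a j))"

lemma Idx_fst: "a \<in> Idx \<Longrightarrow> fst a \<in> fin_sets"
  by (auto simp: Idx_def)

lemma eta_mult: "u \<in> fin_sets \<Longrightarrow> eta (u, i) x * eta (u, i) y = weight \<gamma> u * (frame_u u i x * frame_u u i y)"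
proof -
  assume "u \<in> fin_sets"
  then have "sqrt (weight \<gamma> u) * sqrt (weight \<gamma> u) = weight \<gamma> u" using weight_pos[of u] by simp
  then show ?thesis by (simp add: eta_def mult_ac)
qed

lemma eta_series_u:
  assumes "u \<in> fin_sets" "x \<in> X" "y \<in> X"
  shows "((\<lambda>i. eta (u, i) x * eta (u, i) y) has_sum weight \<gamma> u * k_u k u x y) (PiE u (\<lambda>_. UNIV))"
  unfolding eta_mult[OF assms(1)] by (intro has_sum_cmult_right frame_u_series assms)

lemma eta_series:
  assumes x: "x \<in> X" and y: "y \<in> X"
  shows "((\<lambda>a. eta a x * eta a y) has_sum fam_kernel k (weight \<gamma>) fin_sets x y) Idx"
proof -
  have sq: "(\<lambda>a. eta a z * eta a z) summable_on Idx" if z: "z \<in> X" for z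
    unfolding Idx_def
    by (rule summable_on_SigmaI[where g = "\<lambda>u. weight \<gamma> u * k_u k u z z"])
      (use eta_series_u z diag_summable in auto)
  have nm: "(\<lambda>a. norm (eta a z * eta a z)) summable_on Idx" if z: "z \<in> X" for z
    using sq[OF z] by (rule summable_on_iff_abs_summable_on_real[THEN iffD1])
  have "(\<lambda>a. norm (eta a x * eta a y)) summable_on Idx"
    by (rule abs_summable_product[OF nm[OF x] nm[OF y]])
  then have "(\<lambda>a. eta a x * eta a y) summable_on Idx"
    by (rule summable_on_iff_abs_summable_on_real[THEN iffD2])
  then show ?thesis
    unfolding Idx_def using eta_series_u[OF _ x y] fam_has_sum[OF good_family_weight[OF order_refl] x y]
    by (intro has_sum_SigmaI) auto
qed

sublocale \<eta>: kernel_series X "fam_kernel k (weight \<gamma>) fin_sets" Idx eta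
  by unfold_locales (simp_all add: eta_series, simp add: eta_def frame_u_def)

lemma phi_mult_integrable: "integrable \<rho> (\<lambda>x. \<phi> i x * \<phi> j x)"
  by (intro integrable_mult_of_squares phi_meas phi_sq)

lemma phi_integrable: "integrable \<rho> (\<phi> i)"
  by (rule square_integrable_imp_integrable[OF phi_meas phi_sq])

text \<open>
  Different indices \<open>(u, i)\<close> and \<open>(v, l)\<close> are separated by a coordinate: either it lies in only one
  of the sets \<open>u\<close>, \<open>v\<close>, where the mean vanishes, or two different elements of the one-dimensional
  orthogonal system meet there.
\<close>

lemma eta_inner:
  assumes a: "a \<in> Idx" and b: "b \<in> Idx"
  shows "integrable N (\<lambda>x. eta a x * eta b x)"
    and "a \<noteq> b \<Longrightarrow> (\<integral>x. eta a x * eta b x \<partial>N) = 0"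
    and "a = b \<Longrightarrow> (\<integral>x. eta a x * eta b x \<partial>N) \<le> lam a"
proof -
  obtain u i v l where ab: "a = (u, i)" "b = (v, l)" by (cases a, cases b) auto
  have uv: "u \<in> fin_sets" "v \<in> fin_sets" "i \<in> PiE u (\<lambda>_. UNIV)" "l \<in> PiE v (\<lambda>_. UNIV)"
    using a b by (auto simp: ab Idx_def)
  define F where "F j t = (if j \<in> u then \<phi> (i j) t else 1) * (if j \<in> v then \<phi> (l j) t else 1)" for j t
  define P where "P x = (\<Prod>j\<in>u \<union> v. F j (x j))" for x
  let ?c = "sqrt (weight \<gamma> u) * sqrt (weight \<gamma> v)"
  have fin: "finite (u \<union> v)" "u \<union> v \<subseteq> {1..}" using uv by (auto simp: fin_sets_def)
  have F: "integrable \<rho> (F j)" for j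
    using phi_mult_integrable[of "i j" "l j"] phi_integrable[of "i j"] phi_integrable[of "l j"]
    unfolding F_def[abs_def] by (cases "j \<in> u"; cases "j \<in> v") simp_all
  have P: "integrable PM P" "(\<integral>x. P x \<partial>PM) = (\<Prod>j\<in>u \<union> v. \<integral>t. F j t \<partial>\<rho>)"
    unfolding P_def[abs_def] using coordinate_product[OF fin F] by auto
  have eq: "eta a x * eta b x = ?c * P x" if "x \<in> X" for x
  proof -
    have "(\<Prod>j\<in>u. \<phi> (i j) (x j)) = (\<Prod>j\<in>u \<union> v. if j \<in> u then \<phi> (i j) (x j) else 1)"
      using fin by (intro prod.mono_neutral_cong_left) auto
    moreover have "(\<Prod>j\<in>v. \<phi> (l j) (x j)) = (\<Prod>j\<in>u \<union> v. if j \<in> v then \<phi> (l j) (x j) else 1)"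
      using fin by (intro prod.mono_neutral_cong_left) auto
    ultimately show ?thesis using that
      by (simp add: ab eta_def frame_u_def P_def F_def prod.distrib mult_ac)
  qed
  have cP: "integrable PM (\<lambda>x. ?c * P x)" using P(1) by simp
  have "integrable N (\<lambda>x. eta a x * eta b x) \<longleftrightarrow> integrable N (\<lambda>x. ?c * P x)"
    by (intro Bochner_Integration.integrable_cong refl eq) (simp add: space_N)
  then show "integrable N (\<lambda>x. eta a x * eta b x)" using integrable_N[OF cP] by simp
  have "(\<integral>x. eta a x * eta b x \<partial>N) = (\<integral>x. ?c * P x \<partial>N)"
    by (intro Bochner_Integration.integral_cong refl eq) (simp add: space_N)
  also have "\<dots> = (\<integral>x. ?c * P x \<partial>PM)" by (rule integral_N[OF borel_measurable_integrable[OF cP]])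
  also have "\<dots> = ?c * (\<Prod>j\<in>u \<union> v. \<integral>t. F j t \<partial>\<rho>)" by (simp add: P(2))
  finally have I: "(\<integral>x. eta a x * eta b x \<partial>N) = ?c * (\<Prod>j\<in>u \<union> v. \<integral>t. F j t \<partial>\<rho>)" .
  show "(\<integral>x. eta a x * eta b x \<partial>N) = 0" if ne: "a \<noteq> b"
  proof -
    have "\<exists>j\<in>u \<union> v. (\<integral>t. F j t \<partial>\<rho>) = 0"
    proof (cases "u = v")
      case True
      with ne ab uv obtain j where "j \<in> u" "i j \<noteq> l j" by (metis PiE_ext)
      then show ?thesis using True by (intro bexI[of _ j]) (simp_all add: F_def phi_orth)
    next
      case False
      then obtain j where "j \<in> u \<and> j \<notin> v \<or> j \<in> v \<and> j \<notin> u" by auto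
      then show ?thesis by (intro bexI[of _ j]) (auto simp: F_def phi_mean)
    qed
    then have "(\<Prod>j\<in>u \<union> v. \<integral>t. F j t \<partial>\<rho>) = 0" using fin by (simp add: prod_zero_iff)
    then show ?thesis by (simp add: I)
  qed
  show "(\<integral>x. eta a x * eta b x \<partial>N) \<le> lam a" if e: "a = b"
  proof -
    have "(\<Prod>j\<in>u \<union> v. \<integral>t. F j t \<partial>\<rho>) \<le> (\<Prod>j\<in>u. \<mu> (i j))"
      using e ab phi_norm by (auto simp: F_def power2_eq_square intro!: prod_mono)
    moreover have "?c = weight \<gamma> u" using e ab weight_pos[OF uv(1)] by simp
    ultimately show ?thesis unfolding I
      using weight_pos[OF uv(1)] by (simp add: lam_def ab mult_left_mono)
  qed
qed

lemma eta_sq_integral: "a \<in> Idx \<Longrightarrow> (\<integral>x. (eta a x)\<^sup>2 \<partial>N) \<le> lam a"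
  using eta_inner(3)[of a a] by (simp add: power2_eq_square)

lemma eta_measurable: "a \<in> Idx \<Longrightarrow> eta a \<in> borel_measurable N"
proof -
  assume a: "a \<in> Idx"
  then have "fst a \<subseteq> {1..}" using Idx_fst by (auto simp: fin_sets_def)
  then have "(\<lambda>x. \<phi> (snd a j) (x j)) \<in> borel_measurable PM" if "j \<in> fst a" for j
    using that by (intro measurable_compose[OF measurable_component_singleton[of j "{1..}" "\<lambda>_. \<rho>"] phi_meas]) auto
  then have "(\<lambda>x. sqrt (weight \<gamma> (fst a)) * (\<Prod>j\<in>fst a. \<phi> (snd a j) (x j))) \<in> borel_measurable PM"
    by (intro borel_measurable_times borel_measurable_const borel_measurable_prod)
  from measurable_N[OF this] show ?thesis
    by (rule measurable_cong[THEN iffD1, rotated]) (simp add: space_N eta_def frame_u_def)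
qed

lemma eta_L2: "a \<in> Idx \<Longrightarrow> eta a \<in> L2 N"
  using eta_measurable eta_inner(1)[of a a] by (simp add: L2_def power2_eq_square)

lemma countable_Idx: "countable Idx"
proof -
  have "countable fin_sets" using enum by (metis bij_betw_imp_surj_on countableI_type countable_image)
  then show ?thesis
    unfolding Idx_def by (intro countable_SIGMA countable_PiE) (auto simp: fin_sets_def)
qed

lemma finite_part_norm:
  assumes G: "finite G" "G \<subseteq> Idx" and lam: "\<And>a. a \<in> G \<Longrightarrow> lam a \<le> \<epsilon>" and e: "0 \<le> \<epsilon>"
  shows "integrable N (\<lambda>x. (\<Sum>a\<in>G. c a * eta a x)\<^sup>2)"
    and "(\<integral>x. (\<Sum>a\<in>G. c a * eta a x)\<^sup>2 \<partial>N) \<le> \<epsilon> * (\<Sum>a\<in>G. (c a)\<^sup>2)"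
proof -
  have sq: "(\<Sum>a\<in>G. c a * eta a x)\<^sup>2 = (\<Sum>a\<in>G. \<Sum>b\<in>G. c a * c b * (eta a x * eta b x))" for x
    by (simp add: power2_eq_square sum_product mult_ac)
  have int: "integrable N (\<lambda>x. c a * c b * (eta a x * eta b x))" if "a \<in> G" "b \<in> G" for a b
    using that G by (intro integrable_mult_right eta_inner(1)) (blast dest: subsetD)+
  then show "integrable N (\<lambda>x. (\<Sum>a\<in>G. c a * eta a x)\<^sup>2)"
    unfolding sq by (intro Bochner_Integration.integrable_sum) auto
  have "(\<integral>x. (\<Sum>a\<in>G. c a * eta a x)\<^sup>2 \<partial>N) = (\<Sum>a\<in>G. \<integral>x. (\<Sum>b\<in>G. c a * c b * (eta a x * eta b x)) \<partial>N)"
    unfolding sq by (intro Bochner_Integration.integral_sum Bochner_Integration.integrable_sum int)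
  also have "\<dots> = (\<Sum>a\<in>G. \<Sum>b\<in>G. \<integral>x. c a * c b * (eta a x * eta b x) \<partial>N)"
    by (intro sum.cong refl Bochner_Integration.integral_sum int)
  also have "\<dots> = (\<Sum>a\<in>G. \<Sum>b\<in>G. if a = b then (c a)\<^sup>2 * (\<integral>x. (eta a x)\<^sup>2 \<partial>N) else 0)"
  proof (intro sum.cong refl)
    fix a b assume "a \<in> G" "b \<in> G"
    then have "a \<in> Idx" "b \<in> Idx" using G by auto
    from eta_inner(2)[OF this]
    show "(\<integral>x. c a * c b * (eta a x * eta b x) \<partial>N) = (if a = b then (c a)\<^sup>2 * (\<integral>x. (eta a x)\<^sup>2 \<partial>N) else 0)"
      by (auto simp: power2_eq_square)
  qed
  also have "\<dots> = (\<Sum>a\<in>G. (c a)\<^sup>2 * (\<integral>x. (eta a x)\<^sup>2 \<partial>N))" using G by (simp add: sum.delta)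
  also have "\<dots> \<le> (\<Sum>a\<in>G. (c a)\<^sup>2 * \<epsilon>)"
    using order_trans[OF eta_sq_integral lam] G by (intro sum_mono mult_left_mono) (blast, simp)
  finally show "(\<integral>x. (\<Sum>a\<in>G. c a * eta a x)\<^sup>2 \<partial>N) \<le> \<epsilon> * (\<Sum>a\<in>G. (c a)\<^sup>2)"
    by (simp add: sum_distrib_left mult.commute)
qed

text \<open>
  The remainder \<open>\<Sum>\<^bsub>a\<notin>F\<^esub> \<langle>f, \<eta>\<^sub>a\<rangle> \<eta>\<^sub>a\<close> is only known to converge pointwise, so its norm is bounded with
  Fatou's lemma from those of its finite partial sums.
\<close>

lemma spectral_remainder:
  assumes F: "finite F" "F \<subseteq> Idx" and lam: "\<And>a. a \<in> Idx - F \<Longrightarrow> lam a \<le> \<epsilon>" and e: "0 \<le> \<epsilon>"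
    and f: "f \<in> elems H\<gamma>" "ip H\<gamma> f f \<le> 1"
  shows "L2_norm N (\<lambda>x. f x - (\<Sum>a\<in>F. ip H\<gamma> f (eta a) * eta a x)) \<le> sqrt \<epsilon>"
proof (cases "Idx = {}")
  case True
  have "{} \<in> fin_sets" by (simp add: fin_sets_def)
  with True show ?thesis by (auto simp: Idx_def)
next
  case False
  define c where "c a = ip H\<gamma> f (eta a)" for a
  define G where "G n = from_nat_into Idx ` {..<n} - F" for n
  define g where "g x = f x - (\<Sum>a\<in>F. c a * eta a x)" for x
  define gn where "gn n x = (\<Sum>a\<in>G n. c a * eta a x)" for n x
  have G: "finite (G n)" "G n \<subseteq> Idx - F" for n
    using from_nat_into[OF False] by (auto simp: G_def)
  have f': "f \<in> elems \<Gamma>.H" "ip \<Gamma>.H f f \<le> 1" using f unfolding H_gamma_eq by auto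
  have lim: "(\<lambda>n. gn n x) \<longlonglongrightarrow> g x" if x: "x \<in> X" for x
  proof -
    have "((\<lambda>a. c a * eta a x) has_sum f x) Idx"
      unfolding c_def H_gamma_eq by (rule \<eta>.expansion[OF f'(1) x])
    from has_sum_Diff[OF this has_sum_finite[OF F(1)] F(2)]
    have hs: "((\<lambda>a. c a * eta a x) has_sum g x) (Idx - F)" by (simp add: g_def)
    have "filterlim G (finite_subsets_at_top (Idx - F)) sequentially"
      unfolding filterlim_finite_subsets_at_top
    proof (intro allI impI)
      fix Y assume Y: "finite Y \<and> Y \<subseteq> Idx - F"
      then have "\<forall>y\<in>Y. \<exists>m. from_nat_into Idx m = y"
        using from_nat_into_surj[OF countable_Idx] by blast
      then obtain m where m: "\<And>y. y \<in> Y \<Longrightarrow> from_nat_into Idx (m y) = y" by metis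
      have "Y \<subseteq> G n" if n: "n \<ge> Suc (Max (insert 0 (m ` Y)))" for n
      proof
        fix y assume y: "y \<in> Y"
        have "m y \<le> Max (insert 0 (m ` Y))" using Y y by (intro Max_ge) auto
        then have "m y < n" using n by simp
        then show "y \<in> G n" using m[OF y] y Y by (auto simp: G_def intro!: image_eqI[of _ _ "m y"])
      qed
      then show "\<forall>\<^sub>F n in sequentially. finite (G n) \<and> Y \<subseteq> G n \<and> G n \<subseteq> Idx - F"
        using G by (intro eventually_sequentiallyI[of "Suc (Max (insert 0 (m ` Y)))"]) auto
    qed
    from filterlim_compose[OF hs[unfolded has_sum_def] this] show ?thesis by (simp add: gn_def[abs_def])
  qed
  have meas: "gn n \<in> borel_measurable N" for n
    unfolding gn_def[abs_def] using G[of n]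
    by (intro borel_measurable_sum borel_measurable_times borel_measurable_const eta_measurable) blast
  have g_meas: "g \<in> borel_measurable N"
    by (rule borel_measurable_LIMSEQ_real[where u = gn, OF _ meas]) (simp add: space_N lim)
  have bound: "(\<integral>\<^sup>+x. ennreal ((gn n x)\<^sup>2) \<partial>N) \<le> ennreal \<epsilon>" for n
  proof -
    have GI: "G n \<subseteq> Idx" using G by auto
    have le: "lam a \<le> \<epsilon>" if "a \<in> G n" for a using G[of n] that by (intro lam) auto
    note fp = finite_part_norm[OF G(1) GI le e, of c]
    have "(\<Sum>a\<in>G n. (c a)\<^sup>2) \<le> 1"
      using \<eta>.bessel[OF G(1) GI f'(1)] f'(2) unfolding c_def H_gamma_eq by linarith
    then have "\<epsilon> * (\<Sum>a\<in>G n. (c a)\<^sup>2) \<le> \<epsilon>" using e by (simp add: mult_left_le)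
    with fp(2) have "(\<integral>x. (gn n x)\<^sup>2 \<partial>N) \<le> \<epsilon>" unfolding gn_def by linarith
    moreover have "(\<integral>\<^sup>+x. ennreal ((gn n x)\<^sup>2) \<partial>N) = ennreal (\<integral>x. (gn n x)\<^sup>2 \<partial>N)"
      using fp(1) by (intro nn_integral_eq_integral) (auto simp: gn_def)
    ultimately show ?thesis by (simp add: ennreal_leI)
  qed
  have "(\<integral>\<^sup>+x. ennreal ((g x)\<^sup>2) \<partial>N) = (\<integral>\<^sup>+x. liminf (\<lambda>n. ennreal ((gn n x)\<^sup>2)) \<partial>N)"
  proof (rule nn_integral_cong)
    fix x assume "x \<in> space N"
    then have "(\<lambda>n. ennreal ((gn n x)\<^sup>2)) \<longlonglongrightarrow> ennreal ((g x)\<^sup>2)"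
      by (intro tendsto_intros lim) (simp_all add: space_N)
    from lim_imp_Liminf[OF _ this] show "ennreal ((g x)\<^sup>2) = liminf (\<lambda>n. ennreal ((gn n x)\<^sup>2))" by simp
  qed
  also have "\<dots> \<le> liminf (\<lambda>n. \<integral>\<^sup>+x. ennreal ((gn n x)\<^sup>2) \<partial>N)"
    by (intro nn_integral_liminf) (use meas in measurable)
  also have "\<dots> \<le> ennreal \<epsilon>"
    by (intro Liminf_le always_eventually allI bound sequentially_bot)
  finally have nn: "(\<integral>\<^sup>+x. ennreal ((g x)\<^sup>2) \<partial>N) \<le> ennreal \<epsilon>" .
  have "(\<integral>x. (g x)\<^sup>2 \<partial>N) = enn2real (\<integral>\<^sup>+x. ennreal ((g x)\<^sup>2) \<partial>N)"
    using g_meas by (intro integral_eq_nn_integral) auto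
  also have "\<dots> \<le> \<epsilon>" using enn2real_mono[OF nn] e by simp
  finally show ?thesis unfolding L2_norm_def g_def c_def by simp
qed

lemma eta_sum_space: "a \<in> Idx \<Longrightarrow> eta a \<in> sum_space \<rho> \<gamma> k (fst a)"
proof -
  assume a: "a \<in> Idx"
  then have u: "fst a \<in> fin_sets" and i: "snd a \<in> PiE (fst a) (\<lambda>_. UNIV)" by (auto simp: Idx_def)
  interpret u: kernel_series X "k_u k (fst a)" "PiE (fst a) (\<lambda>_. UNIV)" "frame_u (fst a)"
    by (rule kernel_series_u[OF u])
  have mem: "eta a \<in> elems (rkhs X (k_u k (fst a)))"
    unfolding eta_def[abs_def] by (intro u.mult u.eta_mem i)
  define g where "g v = (if v = fst a then eta a else (\<lambda>_. 0))" for v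
  have "\<forall>v\<in>Pow (fst a). g v \<in> elems (H_u \<rho> \<gamma> k v)"
  proof
    fix v assume "v \<in> Pow (fst a)"
    then have "v \<in> fin_sets" using Pow_fin_sets[OF u] by auto
    then interpret v: psd_kernel X "k_u k v" by (rule psd_u)
    show "g v \<in> elems (H_u \<rho> \<gamma> k v)" using mem by (auto simp: g_def H_u_def)
  qed
  moreover have "eta a = (\<lambda>x. \<Sum>v\<in>Pow (fst a). g v x)"
  proof
    fix x
    have "finite (Pow (fst a))" using u by (simp add: fin_sets_def)
    moreover have "g v x = (if v = fst a then eta a x else 0)" for v by (simp add: g_def)
    ultimately show "eta a x = (\<Sum>v\<in>Pow (fst a). g v x)" by (simp add: sum.delta)
  qed
  ultimately show ?thesis unfolding sum_space_def by blast
qed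

definition max_coord :: "nat set \<Rightarrow> nat" where
  "max_coord u = Max (insert 0 u)"

text \<open>
  The algorithm evaluates the inner products with \<open>\<eta>\<^sub>a\<close> for \<open>a\<close> in \<open>F\<close>. The functional for \<open>(u, i)\<close> only
  involves coordinates in \<open>u\<close>.
\<close>

lemma spectral_algorithm:
  assumes F: "finite F" "F \<subseteq> Idx" and lam: "\<And>a. a \<in> Idx - F \<Longrightarrow> lam a \<le> \<epsilon>" and e: "0 \<le> \<epsilon>"
    and c: "mono c" and cost: "(\<Sum>a\<in>F. c (max_coord (fst a))) \<le> real n"
  shows "min_error \<rho> \<gamma> k c n \<le> sqrt \<epsilon>"
proof -
  obtain as where as: "set as = F" "distinct as" using finite_distinct_list[OF F(1)] by blast
  define A where "A = map (\<lambda>a. (eta a, eta a)) as"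
  have adm: "admissible \<rho> \<gamma> k A"
  proof -
    have "(\<exists>u\<in>fin_sets. eta a \<in> sum_space \<rho> \<gamma> k u) \<and> eta a \<in> L2 N" if "a \<in> F" for a
      using eta_sum_space[of a] eta_L2[of a] Idx_fst[of a] that F(2) by blast
    then show ?thesis by (auto simp: admissible_def A_def as(1))
  qed
  have app: "apply_alg H\<gamma> A f x = (\<Sum>a\<in>F. ip H\<gamma> f (eta a) * eta a x)" for f x
    by (simp add: apply_alg_def A_def o_def sum_list_distinct_conv_sum_set[OF as(2)] as(1))
  have "nested_cost \<rho> \<gamma> k c A = (\<Sum>a\<in>F. c (Max (insert 0 (active_vars \<rho> \<gamma> k (eta a)))))"
    by (simp add: nested_cost_def A_def o_def sum_list_distinct_conv_sum_set[OF as(2)] as(1))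
  also have "\<dots> \<le> (\<Sum>a\<in>F. c (max_coord (fst a)))"
  proof (intro sum_mono monoD[OF c])
    fix a assume "a \<in> F"
    then have a: "a \<in> Idx" using F by auto
    show "Max (insert 0 (active_vars \<rho> \<gamma> k (eta a))) \<le> max_coord (fst a)"
      unfolding max_coord_def
      using active_vars(3)[OF Idx_fst[OF a] eta_sum_space[OF a]] Idx_fst[OF a]
      by (intro Max_mono) (auto simp: fin_sets_def)
  qed
  finally have "nested_cost \<rho> \<gamma> k c A \<le> real n" using cost by linarith
  from min_error_le[OF adm this] have "min_error \<rho> \<gamma> k c n \<le> wc_error \<rho> \<gamma> k A" .
  also have "\<dots> \<le> sqrt \<epsilon>"
    by (rule error_le, unfold app) (rule spectral_remainder[OF F lam e])
  finally show ?thesis .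
qed

text \<open>
  The factor \<open>c (max u)\<close> is absorbed into the product over \<open>u\<close> through
  \<open>c (max u) \<le> c 0 \<Prod>\<^bsub>j\<in>u\<^esub> (1 + c j)\<close>, after which the sum over all \<open>u\<close> is at most an exponential.
\<close>

lemma weighted_eigenvalue_sum:
  assumes F: "finite F" "F \<subseteq> Idx" and \<tau>: "0 < \<tau>"
    and M: "\<And>B. finite B \<Longrightarrow> (\<Sum>i\<in>B. \<mu> i powr \<tau>) \<le> M"
    and c: "\<And>m. 1 \<le> c m"
    and T: "\<And>J. finite J \<Longrightarrow> J \<subseteq> {1..} \<Longrightarrow> (\<Sum>j\<in>J. (1 + c j) * (M * \<gamma> j powr \<tau>)) \<le> T"
  shows "(\<Sum>a\<in>F. lam a powr \<tau> * c (max_coord (fst a))) \<le> c 0 * exp T"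
proof -
  define W where "W = fst ` F"
  define B where "B = (\<Union>a\<in>F. snd a ` fst a)"
  let ?t = "\<lambda>j. (1 + c j) * (M * \<gamma> j powr \<tau>)"
  have M0: "0 \<le> M" using M[of "{}"] by simp
  have c0: "0 \<le> c m" for m using c[of m] by linarith
  have W: "finite W" "W \<subseteq> fin_sets" using F Idx_fst by (auto simp: W_def)
  have B: "finite B"
    unfolding B_def using F Idx_fst by (intro finite_UN_I finite_imageI) (auto simp: fin_sets_def subset_iff)
  have fW: "finite u" if "u \<in> W" for u using W that by (auto simp: fin_sets_def)
  have sub: "F \<subseteq> Sigma W (\<lambda>u. PiE u (\<lambda>_. B))"
  proof
    fix a assume a: "a \<in> F"
    then have "snd a \<in> extensional (fst a)" using F by (auto simp: Idx_def PiE_def)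
    moreover have "snd a j \<in> B" if "j \<in> fst a" for j using a that by (auto simp: B_def)
    ultimately show "a \<in> Sigma W (\<lambda>u. PiE u (\<lambda>_. B))"
      using a by (cases a) (auto simp: W_def PiE_iff image_iff intro!: bexI[of _ a])
  qed
  have cprod: "c (max_coord u) \<le> c 0 * (\<Prod>j\<in>u. 1 + c j)" if "finite u" for u
  proof (cases "u = {}")
    case True
    then show ?thesis by (simp add: max_coord_def)
  next
    case False
    have mx: "Max u \<in> u" and eq: "max_coord u = Max u"
      using that False by (auto simp: max_coord_def Max_insert)
    have "c (Max u) \<le> (1 + c (Max u)) * 1" by simp
    also have "\<dots> \<le> (1 + c (Max u)) * (\<Prod>j\<in>u - {Max u}. 1 + c j)"
      using c0 by (intro mult_left_mono prod_ge_1) (auto simp: add_nonneg_nonneg)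
    also have "\<dots> = (\<Prod>j\<in>u. 1 + c j)" using that mx by (simp add: prod.remove)
    also have "\<dots> \<le> c 0 * (\<Prod>j\<in>u. 1 + c j)"
    proof -
      have "0 \<le> (\<Prod>j\<in>u. 1 + c j)" using c0 by (intro prod_nonneg) (simp add: add_nonneg_nonneg)
      from mult_right_mono[OF c[of 0] this] show ?thesis by simp
    qed
    finally show ?thesis by (simp add: eq)
  qed
  have lamp: "lam (u, i) powr \<tau> = (\<Prod>j\<in>u. \<gamma> j powr \<tau>) * (\<Prod>j\<in>u. \<mu> (i j) powr \<tau>)" if "u \<in> W" for u i
  proof -
    have "0 \<le> \<gamma> j" if "j \<in> u" for j using gamma_pos[of j] W \<open>u \<in> W\<close> that by (force simp: fin_sets_def)
    then show ?thesis
      by (simp add: lam_def weight_def powr_mult prod_nonneg mu_nonneg prod_powr_distrib)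
  qed
  have "(\<Sum>a\<in>F. lam a powr \<tau> * c (max_coord (fst a)))
     \<le> (\<Sum>a\<in>Sigma W (\<lambda>u. PiE u (\<lambda>_. B)). lam a powr \<tau> * c (max_coord (fst a)))"
    using W B fW c0 by (intro sum_mono2 sub finite_SigmaI finite_PiE) auto
  also have "\<dots> = (\<Sum>u\<in>W. \<Sum>i\<in>PiE u (\<lambda>_. B). lam (u, i) powr \<tau> * c (max_coord u))"
    using W B fW by (subst sum.Sigma) (auto simp: case_prod_unfold intro!: finite_PiE)
  also have "\<dots> = (\<Sum>u\<in>W. c (max_coord u) * (\<Prod>j\<in>u. \<gamma> j powr \<tau>) * (\<Prod>j\<in>u. \<Sum>i\<in>B. \<mu> i powr \<tau>))"
  proof (intro sum.cong refl)
    fix u assume u: "u \<in> W"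
    show "(\<Sum>i\<in>PiE u (\<lambda>_. B). lam (u, i) powr \<tau> * c (max_coord u))
      = c (max_coord u) * (\<Prod>j\<in>u. \<gamma> j powr \<tau>) * (\<Prod>j\<in>u. \<Sum>i\<in>B. \<mu> i powr \<tau>)"
      using prod_sum_PiE[OF fW[OF u], of "\<lambda>_. B" "\<lambda>_ i. \<mu> i powr \<tau>"] B
      by (simp add: lamp[OF u] sum_distrib_left mult_ac)
  qed
  also have "\<dots> \<le> (\<Sum>u\<in>W. c 0 * (\<Prod>j\<in>u. ?t j))"
  proof (intro sum_mono)
    fix u assume u: "u \<in> W"
    have "(\<Prod>j\<in>u. \<Sum>i\<in>B. \<mu> i powr \<tau>) \<le> (\<Prod>j\<in>u. M)"
      using M[OF B] by (intro prod_mono) (auto intro!: sum_nonneg)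
    then have "c (max_coord u) * (\<Prod>j\<in>u. \<gamma> j powr \<tau>) * (\<Prod>j\<in>u. \<Sum>i\<in>B. \<mu> i powr \<tau>)
      \<le> (c 0 * (\<Prod>j\<in>u. 1 + c j)) * (\<Prod>j\<in>u. \<gamma> j powr \<tau>) * (\<Prod>j\<in>u. M)"
      using cprod[OF fW[OF u]] c0
      by (intro mult_mono mult_nonneg_nonneg prod_nonneg) (auto intro!: sum_nonneg add_nonneg_nonneg)
    also have "\<dots> = c 0 * (\<Prod>j\<in>u. ?t j)" by (simp only: prod.distrib mult_ac)
    finally show "c (max_coord u) * (\<Prod>j\<in>u. \<gamma> j powr \<tau>) * (\<Prod>j\<in>u. \<Sum>i\<in>B. \<mu> i powr \<tau>)
      \<le> c 0 * (\<Prod>j\<in>u. ?t j)" .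
  qed
  also have "\<dots> = c 0 * (\<Sum>u\<in>W. \<Prod>j\<in>u. ?t j)" by (simp add: sum_distrib_left)
  also have "\<dots> \<le> c 0 * exp T"
    using M0 c0 by (intro mult_left_mono sum_fin_sets_le_exp[OF W _ T]) (auto simp: add_nonneg_nonneg)
  finally show ?thesis .
qed

text \<open>
  The cost of all functionals with eigenvalue above \<open>\<epsilon>\<close> is at most \<open>\<epsilon>\<^bsup>-\<tau>\<^esup>\<close> times the sum bounded in
  \<open>weighted_eigenvalue_sum\<close>; the threshold \<open>\<epsilon>\<close> is the one for which this equals the budget \<open>n\<close>.
\<close>

lemma anova_error_bound:
  assumes \<tau>: "0 < \<tau>" and mono: "mono c" and c: "\<And>m. 1 \<le> c m"
    and M: "\<And>B. finite B \<Longrightarrow> (\<Sum>i\<in>B. \<mu> i powr \<tau>) \<le> M"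
    and T: "\<And>J. finite J \<Longrightarrow> J \<subseteq> {1..} \<Longrightarrow> (\<Sum>j\<in>J. (1 + c j) * (M * \<gamma> j powr \<tau>)) \<le> T"
    and n: "1 \<le> n"
  shows "min_error \<rho> \<gamma> k c n \<le> (c 0 * exp T / real n) powr (1 / (2 * \<tau>))"
proof -
  define C where "C = c 0 * exp T"
  define \<epsilon> where "\<epsilon> = (C / real n) powr (1 / \<tau>)"
  define F where "F = {a \<in> Idx. lam a > \<epsilon>}"
  have C: "C > 0" using c[of 0] by (simp add: C_def)
  have e: "\<epsilon> > 0" using C n by (simp add: \<epsilon>_def)
  have e\<tau>: "\<epsilon> powr \<tau> = C / real n" using C n \<tau> by (simp add: \<epsilon>_def powr_powr)
  have cost: "(\<Sum>a\<in>G. c (max_coord (fst a))) \<le> real n" if G: "finite G" "G \<subseteq> F" for G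
  proof -
    have "\<epsilon> powr \<tau> * (\<Sum>a\<in>G. c (max_coord (fst a))) = (\<Sum>a\<in>G. \<epsilon> powr \<tau> * c (max_coord (fst a)))"
      by (simp add: sum_distrib_left)
    also have "\<dots> \<le> (\<Sum>a\<in>G. lam a powr \<tau> * c (max_coord (fst a)))"
    proof (intro sum_mono mult_right_mono powr_mono2)
      fix a assume "a \<in> G"
      then show "\<epsilon> \<le> lam a" using G by (auto simp: F_def)
      show "0 \<le> c (max_coord (fst a))" using c[of "max_coord (fst a)"] by linarith
    qed (use \<tau> e in auto)
    also have "\<dots> \<le> C"
      unfolding C_def using G by (intro weighted_eigenvalue_sum[OF _ _ \<tau> M c T]) (auto simp: F_def)
    finally have "C / real n * (\<Sum>a\<in>G. c (max_coord (fst a))) \<le> C" by (simp add: e\<tau>)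
    then show ?thesis using C n by (simp add: field_simps)
  qed
  have "finite F"
  proof (rule ccontr)
    assume "infinite F"
    then obtain G where G: "finite G" "card G = Suc n" "G \<subseteq> F" using infinite_arbitrarily_large by blast
    have "real (Suc n) = (\<Sum>a\<in>G. 1)" using G by simp
    also have "\<dots> \<le> (\<Sum>a\<in>G. c (max_coord (fst a)))" by (intro sum_mono c)
    also have "\<dots> \<le> real n" by (rule cost[OF G(1,3)])
    finally show False by simp
  qed
  then have "min_error \<rho> \<gamma> k c n \<le> sqrt \<epsilon>"
    by (rule spectral_algorithm) (use mono cost e \<open>finite F\<close> in \<open>auto simp: F_def not_less\<close>)
  also have "sqrt \<epsilon> = \<epsilon> powr (1 / 2)" using e by (simp add: powr_half_sqrt)
  also have "\<dots> = (C / real n) powr (1 / (2 * \<tau>))" by (simp add: \<epsilon>_def powr_powr mult.commute)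
  finally show ?thesis by (simp add: C_def)
qed

end

section \<open>An orthonormal basis for the kernel without constants\<close>

locale onb_kernel = prob_space \<rho>
  for \<rho> :: "'a measure" +
  fixes k :: "'a \<Rightarrow> 'a \<Rightarrow> real" and e :: "nat \<Rightarrow> 'a \<Rightarrow> real"
  assumes repr: "reproducing_kernel (space \<rho>) k"
    and disjoint: "elems (rkhs (space \<rho>) (\<lambda>_ _. 1)) \<inter> elems (rkhs (space \<rho>) k) = {\<lambda>_. 0}"
    and e_mem: "j \<ge> 1 \<Longrightarrow> e j \<in> elems (rkhs (space \<rho>) (one_plus k))"
    and e_orth: "i \<ge> 1 \<Longrightarrow> j \<ge> 1 \<Longrightarrow> ip (rkhs (space \<rho>) (one_plus k)) (e i) (e j) = (if i = j then 1 else 0)"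
    and e_total: "f \<in> elems (rkhs (space \<rho>) (one_plus k)) \<Longrightarrow>
      \<forall>j\<ge>1. ip (rkhs (space \<rho>) (one_plus k)) f (e j) = 0 \<Longrightarrow> f = (\<lambda>_. 0)"
begin

abbreviation D where "D \<equiv> space \<rho>"
abbreviation H1 where "H1 \<equiv> rkhs D (one_plus k)"

lemma psd_k: "psd_kernel D k"
  using repr is_rkhs_imp_psd_kernel by (auto simp: reproducing_kernel_def)

sublocale C: psd_kernel D "\<lambda>_ _. 1"
  using psd_rank_one[of D "\<lambda>_. 1"] by simp

sublocale k: psd_kernel D k by (rule psd_k)

sublocale S: two_kernels D "\<lambda>_ _. 1" k ..

lemma H1_eq: "rkhs D S.K12 = H1"
  by (simp add: one_plus_def[abs_def])

lemma psd_H1: "psd_kernel D (one_plus k)"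
  unfolding one_plus_def[abs_def] by (rule S.K12.psd_kernel_axioms)

sublocale H1: psd_kernel D "one_plus k" by (rule psd_H1)

definition one :: "'a \<Rightarrow> real" where
  "one x = (if x \<in> D then 1 else 0)"

lemma one_section: "x \<in> D \<Longrightarrow> one = kernel_section D (\<lambda>_ _. 1) x"
  by (intro ext) (simp add: one_def kernel_section_def)

lemma one_mem_C: "one \<in> elems C.H"
proof -
  obtain x where "x \<in> D" using not_empty by blast
  then show ?thesis using one_section C.section_mem by metis
qed

lemma one_nonzero: "one \<noteq> (\<lambda>_. 0)"
  using not_empty by (auto simp: one_def fun_eq_iff)

lemma one_not_mem_k: "one \<notin> elems k.H"
  using disjoint one_mem_C one_nonzero by blast

lemma one_mem: "one \<in> elems H1"
  using S.left_mem(1)[OF one_mem_C] by (simp only: H1_eq)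

lemma ip_one_k: assumes "f \<in> elems k.H" shows "ip H1 one f = 0"
proof -
  have "ip (rkhs D S.K12) one f = 0"
    by (rule S.orthogonal[OF _ one_mem_C assms]) (use disjoint in blast)
  then show ?thesis by (simp only: H1_eq)
qed

lemma k_mem: "f \<in> elems k.H \<Longrightarrow> f \<in> elems H1"
  using S.right_mem(1)[of f] by (simp only: H1_eq)

lemma section_split:
  "x \<in> D \<Longrightarrow> kernel_section D (one_plus k) x = (\<lambda>y. one y + kernel_section D k x y)"
  by (intro ext) (simp add: kernel_section_def one_def one_plus_def)

text \<open>
  The constants are orthogonal to \<open>H(k)\<close> in \<open>H(1 + k)\<close>, so pairing \<open>1\<close> with a section of \<open>1 + k\<close> gives its
  norm.
\<close>

lemma ip_one_one: "ip H1 one one = 1"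
proof -
  obtain x where x: "x \<in> D" using not_empty by blast
  have "1 = ip H1 one (kernel_section D (one_plus k) x)"
    using H1.ip_section[OF x one_mem] x by (simp add: one_def)
  also have "\<dots> = ip H1 one one + ip H1 one (kernel_section D k x)"
    unfolding section_split[OF x] by (intro H1.ip_add_right one_mem k_mem k.section_mem x)
  also have "ip H1 one (kernel_section D k x) = 0" by (intro ip_one_k k.section_mem x)
  finally show ?thesis by simp
qed

definition m :: "nat \<Rightarrow> real" where
  "m j = ip H1 one (e j)"

lemma parseval:
  assumes "f \<in> elems H1" "g \<in> elems H1"
  shows "((\<lambda>j. ip H1 f (e j) * ip H1 g (e j)) has_sum ip H1 f g) {1..}"
  by (rule H1.parseval) (fact e_mem e_orth e_total assms)+

lemma m_sq: "((\<lambda>j. m j * m j) has_sum 1) {1..}"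
  unfolding m_def using parseval[OF one_mem one_mem] by (simp only: ip_one_one)

lemma m_e: assumes x: "x \<in> D" shows "((\<lambda>j. m j * e j x) has_sum 1) {1..}"
proof -
  have "((\<lambda>j. ip H1 one (e j) * ip H1 (kernel_section D (one_plus k) x) (e j))
      has_sum ip H1 one (kernel_section D (one_plus k) x)) {1..}"
    by (rule parseval[OF one_mem H1.section_mem[OF x]])
  moreover have "ip H1 one (kernel_section D (one_plus k) x) = 1"
    using H1.ip_section[OF x one_mem] x by (simp add: one_def)
  moreover have "ip H1 one (e j) * ip H1 (kernel_section D (one_plus k) x) (e j) = m j * e j x"
    if "j \<in> {1..}" for j
    using that H1.ip_section[OF x e_mem] by (simp add: m_def H1.ip_commute[of _ "e j"] H1.ip_commute[of one])
  ultimately show ?thesis by (metis (no_types, lifting) has_sum_cong)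
qed

lemma e_e:
  assumes x: "x \<in> D" and y: "y \<in> D"
  shows "((\<lambda>j. e j x * e j y) has_sum (1 + k x y)) {1..}"
proof -
  let ?s = "kernel_section D (one_plus k)"
  have "((\<lambda>j. ip H1 (?s y) (e j) * ip H1 (?s x) (e j)) has_sum ip H1 (?s y) (?s x)) {1..}"
    by (intro parseval H1.section_mem x y)
  moreover have "ip H1 (?s y) (?s x) = 1 + k x y"
    using H1.ip_section[OF x H1.section_mem[OF y]] x by (simp add: kernel_section_def one_plus_def)
  moreover have "ip H1 (?s y) (e j) * ip H1 (?s x) (e j) = e j x * e j y" if "j \<in> {1..}" for j
    using that H1.ip_section[OF x e_mem] H1.ip_section[OF y e_mem] by (simp add: H1.ip_commute[of _ "e j"])
  ultimately show ?thesis by (metis (no_types, lifting) has_sum_cong)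
qed

text \<open>
  The Householder reflection that exchanges the unit vectors \<open>one\<close> and \<open>\<sigma> e\<^sub>a\<close> maps the other \<open>e\<^sub>j\<close> to
  an orthonormal basis of the complement of the constants. The sign \<open>\<sigma>\<close> keeps the denominator at
  least one; position \<open>a\<close>, which is mapped to the constants, is filled with zero. Indices start
  at zero from here on.
\<close>

definition sgn_at :: "nat \<Rightarrow> real" where
  "sgn_at a = (if m a \<le> 0 then 1 else -1)"

definition reflected :: "nat \<Rightarrow> nat \<Rightarrow> 'a \<Rightarrow> real" where
  "reflected a i x = (if Suc i = a then 0
     else e (Suc i) x - m (Suc i) * (1 / (1 - sgn_at a * m a)) * (1 - sgn_at a * e a x))"

lemma reflected_series:
  assumes a: "a \<ge> 1" and x: "x \<in> D" and y: "y \<in> D"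
  shows "((\<lambda>i. reflected a i x * reflected a i y) has_sum k x y) UNIV"
proof -
  define s where "s = sgn_at a * m a"
  define b where "b = 1 / (1 - s)"
  define E where "E z = sgn_at a * e a z" for z
  have sg: "sgn_at a * sgn_at a = 1" by (simp add: sgn_at_def)
  have s: "1 - s \<noteq> 0" by (auto simp: s_def sgn_at_def)
  have prods: "m a * m a = s * s" "m a * e a z = s * E z" "e a z * e a z' = E z * E z'" for z z'
    using sg by (auto simp: s_def E_def sgn_at_def)
  let ?J = "{1..} - {a}"
  have del: "((\<lambda>j. g j) has_sum (S - g a)) ?J" if "(g has_sum S) {1..}" for g :: "nat \<Rightarrow> real" and S
    using has_sum_Diff[OF that has_sum_finite[of "{a}" g]] a by simp
  have "((\<lambda>j. e j x * e j y + (m j * e j x) * (- b * (1 - E y)) + (m j * e j y) * (- b * (1 - E x))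
        + (m j * m j) * (b * b * (1 - E x) * (1 - E y)))
      has_sum (1 + k x y - e a x * e a y + (1 - m a * e a x) * (- b * (1 - E y))
        + (1 - m a * e a y) * (- b * (1 - E x)) + (1 - m a * m a) * (b * b * (1 - E x) * (1 - E y)))) ?J"
    by (intro has_sum_add has_sum_cmult_left del e_e m_e m_sq x y)
  also have "1 + k x y - e a x * e a y + (1 - m a * e a x) * (- b * (1 - E y))
        + (1 - m a * e a y) * (- b * (1 - E x)) + (1 - m a * m a) * (b * b * (1 - E x) * (1 - E y)) = k x y"
    unfolding prods b_def using s by (simp add: divide_simps) algebra
  finally have "((\<lambda>j. e j x * e j y + (m j * e j x) * (- b * (1 - E y)) + (m j * e j y) * (- b * (1 - E x))
        + (m j * m j) * (b * b * (1 - E x) * (1 - E y))) has_sum k x y) ?J" .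
  then have "((\<lambda>j. reflected a (j - 1) x * reflected a (j - 1) y) has_sum k x y) {1..}"
  proof (rule has_sum_cong_neutral[THEN iffD1, rotated -1])
    fix j assume "j \<in> ?J \<inter> {1..}"
    then have "Suc (j - 1) = j" "j \<noteq> a" by auto
    then have r: "reflected a (j - 1) z = e j z - m j * b * (1 - E z)" for z
      by (simp add: reflected_def b_def s_def E_def)
    show "e j x * e j y + (m j * e j x) * (- b * (1 - E y)) + (m j * e j y) * (- b * (1 - E x))
        + (m j * m j) * (b * b * (1 - E x) * (1 - E y)) = reflected a (j - 1) x * reflected a (j - 1) y"
      unfolding r by (simp add: algebra_simps)
  qed (use a in \<open>auto simp: reflected_def\<close>)
  then show ?thesis
    using has_sum_reindex_bij_betw[OF bij_betw_Suc, of "\<lambda>j. reflected a (j - 1) x * reflected a (j - 1) y" "k x y"]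
    by simp
qed

end

subsection \<open>Mean zero makes the constants eigenfunctions\<close>

locale onb_eigen = onb_kernel \<rho> k e
  for \<rho> :: "'a measure" and k :: "'a \<Rightarrow> 'a \<Rightarrow> real" and e :: "nat \<Rightarrow> 'a \<Rightarrow> real" +
  fixes lam :: "nat \<Rightarrow> real"
  assumes k_meas: "elems (rkhs (space \<rho>) k) \<subseteq> borel_measurable \<rho>"
    and diag_int: "integrable \<rho> (\<lambda>x. k x x)"
    and anova: "anova_kernel \<rho> k"
    and eigen: "j \<ge> 1 \<Longrightarrow> emb_W \<rho> (rkhs (space \<rho>) (one_plus k)) (e j) = (\<lambda>x. lam j * e j x)"
begin

lemma one_meas: "one \<in> borel_measurable \<rho>"
proof -
  have "(\<lambda>x. 1) \<in> borel_measurable \<rho>" by simp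
  then show ?thesis by (rule measurable_cong[THEN iffD1, rotated]) (simp add: one_def)
qed

lemma C_scalar: assumes "f \<in> elems C.H" shows "\<exists>c. f = (\<lambda>x. c * one x)"
proof -
  obtain x0 where x0: "x0 \<in> D" using not_empty by blast
  have "f x = f x0 * one x" for x
  proof (cases "x \<in> D")
    case True
    then have "kernel_section D (\<lambda>_ _. 1) x = kernel_section D (\<lambda>_ _. 1::real) x0"
      by (simp add: kernel_section_def)
    then show ?thesis using C.ip_section[OF True assms] C.ip_section[OF x0 assms] True
      by (simp add: one_def)
  qed (use C.outside[OF assms] in \<open>simp add: one_def\<close>)
  then show ?thesis by blast
qed

lemma H1_meas: assumes "f \<in> elems H1" shows "f \<in> borel_measurable \<rho>"
proof -
  from assms have "f \<in> elems S.K12.H" by (simp only: H1_eq)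
  then obtain f1 f2 where f: "f1 \<in> elems C.H" "f2 \<in> elems k.H" "f = (\<lambda>x. f1 x + f2 x)"
    using S.split by blast
  from C_scalar[OF f(1)] obtain c where "f1 = (\<lambda>x. c * one x)" by blast
  then have "f1 \<in> borel_measurable \<rho>" using one_meas by simp
  moreover have "f2 \<in> borel_measurable \<rho>" using k_meas f(2) by blast
  ultimately show ?thesis unfolding f(3) by simp
qed

definition trace_int :: real where
  "trace_int = (\<integral>x. one_plus k x x \<partial>\<rho>)"

lemma diag1_int: "integrable \<rho> (\<lambda>x. one_plus k x x)"
  using diag_int by (simp add: one_plus_def)

lemma trace_nonneg: "0 \<le> trace_int"
  unfolding trace_int_def using H1.diag_nonneg by (intro integral_nonneg_AE AE_I2) auto

lemma H1_sq:
  assumes f: "f \<in> elems H1"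
  shows "integrable \<rho> (\<lambda>x. (f x)\<^sup>2)" and "(\<integral>x. (f x)\<^sup>2 \<partial>\<rho>) \<le> ip H1 f f * trace_int"
proof -
  have b: "(f x)\<^sup>2 \<le> ip H1 f f * one_plus k x x" if "x \<in> space \<rho>" for x
    by (rule H1.mem_sq_le[OF f that])
  have i: "integrable \<rho> (\<lambda>x. ip H1 f f * one_plus k x x)" using diag1_int by simp
  show sq: "integrable \<rho> (\<lambda>x. (f x)\<^sup>2)"
  proof (rule Bochner_Integration.integrable_bound[OF i])
    show "(\<lambda>x. (f x)\<^sup>2) \<in> borel_measurable \<rho>" using H1_meas[OF f] by simp
    show "AE x in \<rho>. norm ((f x)\<^sup>2) \<le> norm (ip H1 f f * one_plus k x x)"
    proof (rule AE_I2)
      fix x assume x: "x \<in> space \<rho>"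
      show "norm ((f x)\<^sup>2) \<le> norm (ip H1 f f * one_plus k x x)"
        using order_trans[OF b[OF x] abs_ge_self] by simp
    qed
  qed
  have "(\<integral>x. (f x)\<^sup>2 \<partial>\<rho>) \<le> (\<integral>x. ip H1 f f * one_plus k x x \<partial>\<rho>)"
    by (intro integral_mono sq i b)
  then show "(\<integral>x. (f x)\<^sup>2 \<partial>\<rho>) \<le> ip H1 f f * trace_int" by (simp add: trace_int_def)
qed

lemma H1_mult_int:
  assumes "f \<in> elems H1" and "g \<in> elems H1"
  shows "integrable \<rho> (\<lambda>x. f x * g x)"
  using assms by (intro integrable_mult_of_squares H1_meas H1_sq(1))

lemma integral_mult_sq_le:
  assumes f: "f \<in> elems H1" and g: "g \<in> elems H1"
  shows "(\<integral>x. f x * g x \<partial>\<rho>)\<^sup>2 \<le> (\<integral>x. (f x)\<^sup>2 \<partial>\<rho>) * (\<integral>x. (g x)\<^sup>2 \<partial>\<rho>)"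
proof (rule quadratic_nonneg_discriminant)
  fix t
  have "0 \<le> (\<integral>x. (t * f x - g x)\<^sup>2 \<partial>\<rho>)" by simp
  also have "(\<lambda>x. (t * f x - g x)\<^sup>2) = (\<lambda>x. t\<^sup>2 * (f x)\<^sup>2 - 2 * t * (f x * g x) + (g x)\<^sup>2)"
    by (intro ext) (simp add: power2_eq_square algebra_simps)
  also have "(\<integral>x. t\<^sup>2 * (f x)\<^sup>2 - 2 * t * (f x * g x) + (g x)\<^sup>2 \<partial>\<rho>)
      = t\<^sup>2 * (\<integral>x. (f x)\<^sup>2 \<partial>\<rho>) - 2 * t * (\<integral>x. f x * g x \<partial>\<rho>) + (\<integral>x. (g x)\<^sup>2 \<partial>\<rho>)"
    using H1_sq(1)[OF f] H1_sq(1)[OF g] H1_mult_int[OF f g] by simp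
  finally show "0 \<le> (\<integral>x. (f x)\<^sup>2 \<partial>\<rho>) * t\<^sup>2 - 2 * (\<integral>x. f x * g x \<partial>\<rho>) * t + (\<integral>x. (g x)\<^sup>2 \<partial>\<rho>)"
    by (simp add: mult_ac)
qed simp

text \<open>
  Multiplication by \<open>g\<close> followed by integration is a bounded functional on \<open>H(1 + k)\<close>; its Riesz
  representer is the value of the adjoint.
\<close>

lemma adjoint:
  assumes g: "g \<in> elems H1"
  shows "emb_adjoint \<rho> H1 g = (\<lambda>x. if x \<in> D then \<integral>y. kernel_section D (one_plus k) x y * g y \<partial>\<rho> else 0)"
    and "emb_adjoint \<rho> H1 g \<in> elems H1"
    and "f \<in> elems H1 \<Longrightarrow> ip H1 f (emb_adjoint \<rho> H1 g) = (\<integral>x. f x * g x \<partial>\<rho>)"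
proof -
  define L where "L f = (\<integral>x. f x * g x \<partial>\<rho>)" for f
  define h where "h = (\<lambda>x. if x \<in> D then L (kernel_section D (one_plus k) x) else 0)"
  have L1: "L (\<lambda>x. f x + f' x) = L f + L f'" if "f \<in> elems H1" "f' \<in> elems H1" for f f'
    using H1_mult_int[OF that(1) g] H1_mult_int[OF that(2) g] by (simp add: L_def distrib_right)
  have L2: "L (\<lambda>x. t * f x) = t * L f" if "f \<in> elems H1" for t f
    by (simp add: L_def mult.assoc)
  have L3: "(L f)\<^sup>2 \<le> trace_int * (\<integral>x. (g x)\<^sup>2 \<partial>\<rho>) * ip H1 f f" if f: "f \<in> elems H1" for f
  proof -
    have "(L f)\<^sup>2 \<le> (\<integral>x. (f x)\<^sup>2 \<partial>\<rho>) * (\<integral>x. (g x)\<^sup>2 \<partial>\<rho>)"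
      unfolding L_def by (rule integral_mult_sq_le[OF f g])
    also have "\<dots> \<le> (ip H1 f f * trace_int) * (\<integral>x. (g x)\<^sup>2 \<partial>\<rho>)"
      by (intro mult_right_mono H1_sq f) simp
    finally show ?thesis by (simp add: mult_ac)
  qed
  have C0: "0 \<le> trace_int * (\<integral>x. (g x)\<^sup>2 \<partial>\<rho>)" using trace_nonneg by simp
  have R1: "h \<in> elems H1"
    unfolding h_def using L1 L2 L3 C0 by (rule H1.riesz(1)[where L = L and C = "trace_int * (\<integral>x. (g x)\<^sup>2 \<partial>\<rho>)"])
  have R2: "ip H1 f h = L f" if "f \<in> elems H1" for f
    unfolding h_def using L1 L2 L3 C0 that
    by (rule H1.riesz(2)[where L = L and C = "trace_int * (\<integral>x. (g x)\<^sup>2 \<partial>\<rho>)"])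
  have "emb_adjoint \<rho> H1 g = h"
    unfolding emb_adjoint_def
  proof (rule the_equality)
    show "h \<in> elems H1 \<and> (\<forall>f\<in>elems H1. ip H1 f h = (\<integral>x. f x * g x \<partial>\<rho>))"
      using R1 R2 by (simp add: L_def)
    fix h' assume h': "h' \<in> elems H1 \<and> (\<forall>f\<in>elems H1. ip H1 f h' = (\<integral>x. f x * g x \<partial>\<rho>))"
    let ?d = "\<lambda>x. h' x - h x"
    have d: "?d \<in> elems H1" using h' R1 by (intro H1.diff) auto
    have "ip H1 ?d h' = ip H1 ?d h" using h' R2[OF d] d by (simp add: L_def)
    then have "ip H1 ?d ?d = 0" using h' R1 d by (simp add: H1.ip_diff_right)
    from H1.ip_definite[OF d this] show "h' = h" by (metis (no_types) eq_iff_diff_eq_0 ext)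
  qed
  then show "emb_adjoint \<rho> H1 g = (\<lambda>x. if x \<in> D then \<integral>y. kernel_section D (one_plus k) x y * g y \<partial>\<rho> else 0)"
    "emb_adjoint \<rho> H1 g \<in> elems H1"
    "f \<in> elems H1 \<Longrightarrow> ip H1 f (emb_adjoint \<rho> H1 g) = (\<integral>x. f x * g x \<partial>\<rho>)"
    using R1 R2 unfolding h_def L_def by simp_all
qed

lemma e_inner: "i \<ge> 1 \<Longrightarrow> j \<ge> 1 \<Longrightarrow> (\<integral>x. e i x * e j x \<partial>\<rho>) = (if i = j then lam j else 0)"
  using adjoint(3)[OF e_mem e_mem, of j i] eigen[of j] e_orth[of i j]
  by (cases "i = j") (simp_all add: emb_W_def H1.ip_mult_right e_mem)

text \<open>
  The sections of \<open>1 + k\<close> have mean one if \<open>k\<close> has mean zero, so the function \<open>1\<close> represents integration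
  and is an eigenfunction with eigenvalue one.
\<close>

lemma integral_eq_ip_one: assumes f: "f \<in> elems H1" shows "(\<integral>x. f x \<partial>\<rho>) = ip H1 one f"
proof -
  have "emb_adjoint \<rho> H1 one = one"
    unfolding adjoint(1)[OF one_mem]
  proof
    fix x
    show "(if x \<in> D then \<integral>y. kernel_section D (one_plus k) x y * one y \<partial>\<rho> else 0) = one x"
    proof (cases "x \<in> D")
      case True
      have ks: "integrable \<rho> (kernel_section D k x)"
        using H1_meas[OF k_mem[OF k.section_mem[OF True]]] H1_sq(1)[OF k_mem[OF k.section_mem[OF True]]]
        by (rule square_integrable_imp_integrable)
      have "(\<integral>y. kernel_section D (one_plus k) x y * one y \<partial>\<rho>) = (\<integral>y. 1 + kernel_section D k x y \<partial>\<rho>)"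
        by (intro Bochner_Integration.integral_cong) (auto simp: section_split[OF True] one_def)
      also have "\<dots> = 1 + (\<integral>y. kernel_section D k x y \<partial>\<rho>)" using ks by (simp add: prob_space)
      also have "(\<integral>y. kernel_section D k x y \<partial>\<rho>) = (\<integral>y. k y x \<partial>\<rho>)"
        by (intro Bochner_Integration.integral_cong) (auto simp: kernel_section_def)
      also have "\<dots> = 0" using anova True by (simp add: anova_kernel_def)
      finally show ?thesis using True by (simp add: one_def)
    qed (simp add: one_def)
  qed
  with adjoint(3)[OF one_mem f] have "ip H1 f one = (\<integral>x. f x * one x \<partial>\<rho>)" by simp
  also have "\<dots> = (\<integral>x. f x \<partial>\<rho>)" by (intro Bochner_Integration.integral_cong) (auto simp: one_def)
  finally show ?thesis by (simp add: H1.ip_commute[of f])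
qed

lemma e_mean: "j \<ge> 1 \<Longrightarrow> (\<integral>x. e j x \<partial>\<rho>) = m j"
  by (simp add: integral_eq_ip_one e_mem m_def)

lemma m_eigen: assumes j: "j \<ge> 1" shows "lam j * m j = m j"
proof -
  have "ip H1 one (emb_adjoint \<rho> H1 (e j)) = (\<integral>x. one x * e j x \<partial>\<rho>)"
    by (rule adjoint(3)[OF e_mem[OF j] one_mem])
  also have "\<dots> = (\<integral>x. e j x \<partial>\<rho>)" by (intro Bochner_Integration.integral_cong) (auto simp: one_def)
  also have "ip H1 one (emb_adjoint \<rho> H1 (e j)) = lam j * m j"
    using eigen[OF j] by (simp add: emb_W_def H1.ip_mult_right e_mem one_mem j m_def)
  finally show ?thesis by (simp add: e_mean[OF j])
qed

text \<open>
  Some \<open>m a\<close> is nonzero, and then \<open>lam a = 1\<close>. The reflection at this position acts inside the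
  eigenspace of the constants, so it preserves the orthogonality in \<open>L\<^sup>2\<close>.
\<close>

lemma orthogonal_frame:
  obtains \<phi> where
    "\<And>x y. x \<in> D \<Longrightarrow> y \<in> D \<Longrightarrow> ((\<lambda>i. \<phi> i x * \<phi> i y) has_sum k x y) UNIV"
    "\<And>i. \<phi> i \<in> borel_measurable \<rho>" "\<And>i. integrable \<rho> (\<lambda>x. (\<phi> i x)\<^sup>2)"
    "\<And>i. (\<integral>x. \<phi> i x \<partial>\<rho>) = 0" "\<And>i j. i \<noteq> j \<Longrightarrow> (\<integral>x. \<phi> i x * \<phi> j x \<partial>\<rho>) = 0"
    "\<And>i. (\<integral>x. (\<phi> i x)\<^sup>2 \<partial>\<rho>) \<le> lam (Suc i)"
proof -
  have "\<exists>a\<ge>1. m a \<noteq> 0"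
  proof (rule ccontr)
    assume "\<not> (\<exists>a\<ge>1. m a \<noteq> 0)"
    then have "((\<lambda>j. m j * m j) has_sum 0) {1..}" by (intro has_sum_0) auto
    from has_sum_unique[OF m_sq this] show False by simp
  qed
  then obtain a where a: "a \<ge> 1" "m a \<noteq> 0" by blast
  have la: "lam a = 1" using m_eigen[OF a(1)] a(2) by simp
  define s where "s = sgn_at a * m a"
  define b where "b = 1 / (1 - s)"
  define w where "w x = one x - sgn_at a * e a x" for x
  define \<psi> where "\<psi> i x = (if Suc i = a then 0 else e (Suc i) x - m (Suc i) * b * w x)" for i x
  have s1: "1 - s \<noteq> 0" by (auto simp: s_def sgn_at_def)
  have b1: "b * (1 - s) = 1" using s1 by (simp add: b_def)
  have sg: "sgn_at a * sgn_at a = 1" by (simp add: sgn_at_def)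
  have reflected: "reflected a i x = \<psi> i x" if "x \<in> D" for i x
    using that by (simp add: reflected_def \<psi>_def b_def s_def w_def one_def)
  have w: "w \<in> elems H1" unfolding w_def[abs_def] by (intro H1.diff H1.mult one_mem e_mem a)
  have psi: "\<psi> i \<in> elems H1" for i
  proof (cases "Suc i = a")
    case True
    then have "\<psi> i = (\<lambda>_. 0)" by (intro ext) (simp add: \<psi>_def)
    then show ?thesis by simp
  next
    case False
    then have "\<psi> i = (\<lambda>x. e (Suc i) x - m (Suc i) * b * w x)" by (intro ext) (simp add: \<psi>_def)
    then show ?thesis by (auto intro!: H1.diff H1.mult e_mem w)
  qed
  have one_e: "(\<integral>x. one x * e j x \<partial>\<rho>) = m j" if "j \<ge> 1" for j
  proof -
    have "(\<integral>x. one x * e j x \<partial>\<rho>) = (\<integral>x. e j x \<partial>\<rho>)"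
      by (intro Bochner_Integration.integral_cong) (auto simp: one_def)
    then show ?thesis by (simp add: e_mean[OF that])
  qed
  have one_one: "(\<integral>x. one x * one x \<partial>\<rho>) = 1"
  proof -
    have "(\<integral>x. one x * one x \<partial>\<rho>) = (\<integral>x. 1 \<partial>\<rho>)"
      by (intro Bochner_Integration.integral_cong) (auto simp: one_def)
    then show ?thesis by (simp add: prob_space)
  qed
  have e_w: "(\<integral>x. e j x * w x \<partial>\<rho>) = m j" if j: "j \<ge> 1" "j \<noteq> a" for j
  proof -
    have "(\<integral>x. e j x * w x \<partial>\<rho>) = (\<integral>x. one x * e j x - sgn_at a * (e j x * e a x) \<partial>\<rho>)"
      by (intro Bochner_Integration.integral_cong) (auto simp: w_def algebra_simps)
    also have "\<dots> = m j"
      using H1_mult_int[OF one_mem e_mem[OF j(1)]] H1_mult_int[OF e_mem[OF j(1)] e_mem[OF a(1)]] j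
      by (simp add: one_e e_inner a)
    finally show ?thesis .
  qed
  have w_w: "(\<integral>x. w x * w x \<partial>\<rho>) = 2 * (1 - s)"
  proof -
    have "(\<integral>x. w x * w x \<partial>\<rho>) = (\<integral>x. one x * one x - 2 * sgn_at a * (one x * e a x)
        + (sgn_at a * sgn_at a) * (e a x * e a x) \<partial>\<rho>)"
      by (intro Bochner_Integration.integral_cong) (auto simp: w_def algebra_simps)
    also have "\<dots> = 1 - 2 * sgn_at a * m a + (sgn_at a * sgn_at a) * lam a"
      using H1_mult_int[OF one_mem one_mem] H1_mult_int[OF one_mem e_mem[OF a(1)]]
        H1_mult_int[OF e_mem[OF a(1)] e_mem[OF a(1)]] by (simp add: one_e e_inner a one_one)
    finally show ?thesis by (simp add: la sg s_def)
  qed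
  have inner: "(\<integral>x. \<psi> i x * \<psi> j x \<partial>\<rho>) = (if i = j then lam (Suc j) else 0)"
    if "Suc i \<noteq> a" "Suc j \<noteq> a" for i j
  proof -
    have "(\<integral>x. \<psi> i x * \<psi> j x \<partial>\<rho>) = (\<integral>x. e (Suc i) x * e (Suc j) x - m (Suc j) * b * (e (Suc i) x * w x)
        - m (Suc i) * b * (e (Suc j) x * w x) + m (Suc i) * m (Suc j) * b * b * (w x * w x) \<partial>\<rho>)"
      using that by (intro Bochner_Integration.integral_cong) (auto simp: \<psi>_def algebra_simps)
    also have "\<dots> = (\<integral>x. e (Suc i) x * e (Suc j) x \<partial>\<rho>) - m (Suc j) * b * m (Suc i)
        - m (Suc i) * b * m (Suc j) + m (Suc i) * m (Suc j) * b * b * (2 * (1 - s))"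
      using H1_mult_int[OF e_mem e_mem, of "Suc i" "Suc j"] H1_mult_int[OF e_mem w, of "Suc i"]
        H1_mult_int[OF e_mem w, of "Suc j"] H1_mult_int[OF w w] that by (simp add: e_w w_w)
    also have "m (Suc i) * m (Suc j) * b * b * (2 * (1 - s)) = 2 * m (Suc i) * m (Suc j) * b"
      using b1 by algebra
    finally show ?thesis using that by (simp add: e_inner)
  qed
  have lam_nonneg: "0 \<le> lam j" if "j \<ge> 1" for j
  proof -
    have "0 \<le> (\<integral>x. e j x * e j x \<partial>\<rho>)" by simp
    then show ?thesis using e_inner[OF that that] by simp
  qed
  have mean: "(\<integral>x. \<psi> i x \<partial>\<rho>) = 0" for i
  proof (cases "Suc i = a")
    case False
    have "ip H1 one (\<psi> i) = m (Suc i) - m (Suc i) * b * (1 - s)"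
    proof -
      have "\<psi> i = (\<lambda>x. e (Suc i) x - (m (Suc i) * b) * w x)" using False by (intro ext) (simp add: \<psi>_def)
      moreover have "ip H1 one w = 1 - s"
        unfolding w_def[abs_def]
        by (simp add: H1.ip_diff_right H1.ip_mult_right H1.mult one_mem e_mem a ip_one_one m_def s_def)
      ultimately show ?thesis
        using e_mem[of "Suc i"] by (simp add: H1.ip_diff_right H1.ip_mult_right H1.mult one_mem w m_def)
    qed
    also have "\<dots> = 0" using b1 by algebra
    finally show ?thesis by (simp add: integral_eq_ip_one psi)
  qed (simp add: \<psi>_def)
  show ?thesis
  proof (rule that[of \<psi>])
    show "((\<lambda>i. \<psi> i x * \<psi> i y) has_sum k x y) UNIV" if "x \<in> D" "y \<in> D" for x y
      using reflected_series[OF a(1) that] by (simp add: reflected that)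
    show "\<psi> i \<in> borel_measurable \<rho>" "integrable \<rho> (\<lambda>x. (\<psi> i x)\<^sup>2)" "(\<integral>x. \<psi> i x \<partial>\<rho>) = 0" for i
      using H1_meas H1_sq(1) psi mean by auto
    show "(\<integral>x. \<psi> i x * \<psi> j x \<partial>\<rho>) = 0" if "i \<noteq> j" for i j
    proof (cases "Suc i = a \<or> Suc j = a")
      case True
      then have "(\<lambda>x. \<psi> i x * \<psi> j x) = (\<lambda>_. 0)" by (intro ext) (auto simp: \<psi>_def)
      then show ?thesis by (simp only: Bochner_Integration.integral_zero)
    qed (use inner that in simp)
    show "(\<integral>x. (\<psi> i x)\<^sup>2 \<partial>\<rho>) \<le> lam (Suc i)" for i
    proof (cases "Suc i = a")
      case True
      then have "(\<lambda>x. (\<psi> i x)\<^sup>2) = (\<lambda>_. 0)" by (intro ext) (simp add: \<psi>_def)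
      then show ?thesis using lam_nonneg[of "Suc i"] by simp
    qed (use inner[of i i] in \<open>simp add: power2_eq_square\<close>)
  qed
qed

end

section \<open>Decay rates\<close>

lemma decay_le:
  assumes p: "0 < p" and c: "0 < c" and lower: "\<And>n. 1 \<le> n \<Longrightarrow> c * real n powr (- p) \<le> x n"
  shows "decay x \<le> ennreal p"
  unfolding decay_def
proof (rule Sup_least)
  fix z assume "z \<in> {ennreal \<alpha> |\<alpha>. 0 < \<alpha> \<and> summable (\<lambda>j. x (Suc j) powr (1 / \<alpha>))}"
  then obtain \<alpha> where z: "z = ennreal \<alpha>" and \<alpha>: "0 < \<alpha>" and s: "summable (\<lambda>j. x (Suc j) powr (1 / \<alpha>))"
    by blast
  have "\<alpha> \<le> p"
  proof (rule ccontr)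
    assume "\<not> \<alpha> \<le> p"
    then have lt: "p / \<alpha> < 1" using \<alpha> by simp
    have "summable (\<lambda>j. c powr (1 / \<alpha>) * real (Suc j) powr (- (p / \<alpha>)))"
    proof (rule summable_comparison_test'[OF s])
      fix j :: nat assume "j \<ge> 0"
      have "c powr (1 / \<alpha>) * real (Suc j) powr (- (p / \<alpha>)) = (c * real (Suc j) powr (- p)) powr (1 / \<alpha>)"
        by (simp add: powr_mult powr_powr)
      also have "\<dots> \<le> x (Suc j) powr (1 / \<alpha>)"
        using lower[of "Suc j"] \<alpha> c by (intro powr_mono2) auto
      finally show "norm (c powr (1 / \<alpha>) * real (Suc j) powr (- (p / \<alpha>))) \<le> x (Suc j) powr (1 / \<alpha>)"
        by (simp add: abs_mult)
    qed
    then have "summable (\<lambda>j. real (Suc j) powr (- (p / \<alpha>)))" using c by (simp add: summable_cmult_iff)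
    then have "summable (\<lambda>j. real j powr (- (p / \<alpha>)))"
      by (subst (asm) summable_Suc_iff[of "\<lambda>j. real j powr (- (p / \<alpha>))"])
    then show False using lt by (simp add: summable_real_powr_iff)
  qed
  then show "z \<le> ennreal p" by (simp add: z ennreal_leI)
qed

lemma decay_ge:
  assumes p: "0 < \<alpha>" "\<alpha> < p" and C: "0 \<le> C" and nonneg: "\<And>n. 0 \<le> x n"
    and upper: "\<And>n. 1 \<le> n \<Longrightarrow> x n \<le> (C / real n) powr p"
  shows "ennreal \<alpha> \<le> decay x"
  unfolding decay_def
proof (rule Sup_upper, intro CollectI exI conjI refl)
  show "summable (\<lambda>j. x (Suc j) powr (1 / \<alpha>))"
  proof (rule summable_comparison_test')
    have "summable (\<lambda>j. real j powr (- (p / \<alpha>)))" using p by (simp add: summable_real_powr_iff)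
    then show "summable (\<lambda>j. C powr (p / \<alpha>) * real (Suc j) powr (- (p / \<alpha>)))"
      by (intro summable_mult) (subst summable_Suc_iff[of "\<lambda>j. real j powr (- (p / \<alpha>))"])
    fix j :: nat assume "j \<ge> 0"
    have "x (Suc j) powr (1 / \<alpha>) \<le> ((C / real (Suc j)) powr p) powr (1 / \<alpha>)"
      using upper[of "Suc j"] nonneg p by (intro powr_mono2) auto
    also have "\<dots> = C powr (p / \<alpha>) * real (Suc j) powr (- (p / \<alpha>))"
      using C by (simp add: powr_powr powr_divide powr_minus_divide)
    finally show "norm (x (Suc j) powr (1 / \<alpha>)) \<le> C powr (p / \<alpha>) * real (Suc j) powr (- (p / \<alpha>))" by simp
  qed
qed (use p in auto)

text \<open>
  For a decreasing sequence, \<open>n\<close> times the \<open>n\<close>-th term of a summable power is at most the sum of the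
  series.
\<close>

lemma d_low_upper_bound:
  assumes mono: "\<And>j. 1 \<le> j \<Longrightarrow> x (Suc j) \<le> x j" and pos: "\<And>j. 1 \<le> j \<Longrightarrow> 0 < x j"
    and b: "ennreal b < d_low x" "0 < b"
  shows "\<exists>C>0. \<forall>j\<ge>1. x j \<le> C * real j powr (- b)"
proof -
  from b(1) obtain \<alpha> where \<alpha>: "0 < \<alpha>" "ennreal b < ennreal \<alpha>" and s: "summable (\<lambda>j. x (Suc j) powr (1 / \<alpha>))"
    unfolding decay_def less_Sup_iff by blast
  have ba: "b < \<alpha>" using \<alpha> b by (simp add: ennreal_less_iff)
  define T where "T = (\<Sum>j. x (Suc j) powr (1 / \<alpha>))"
  have anti: "x j \<le> x i" if "1 \<le> i" "i \<le> j" for i j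
    using that(2) by (induction rule: dec_induct) (use mono that(1) in \<open>auto intro: order_trans\<close>)
  have key: "real j * x j powr (1 / \<alpha>) \<le> T" if j: "1 \<le> j" for j
  proof -
    have "real j * x j powr (1 / \<alpha>) = (\<Sum>i<j. x j powr (1 / \<alpha>))" by simp
    also have "\<dots> \<le> (\<Sum>i<j. x (Suc i) powr (1 / \<alpha>))"
      using anti pos[OF j] \<alpha> by (intro sum_mono powr_mono2) (auto simp: less_imp_le)
    also have "\<dots> \<le> T" unfolding T_def by (intro sum_le_suminf s) auto
    finally show ?thesis .
  qed
  have "0 < x 1 powr (1 / \<alpha>)" using pos[of 1] by simp
  also have "\<dots> \<le> T" using key[of 1] by simp
  finally have T: "T > 0" .
  have "x j \<le> T powr \<alpha> * real j powr (- b)" if j: "1 \<le> j" for j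
  proof -
    have "x j powr (1 / \<alpha>) \<le> T / real j" using key[OF j] j by (simp add: field_simps)
    then have "(x j powr (1 / \<alpha>)) powr \<alpha> \<le> (T / real j) powr \<alpha>" using \<alpha> by (intro powr_mono2) auto
    then have "x j \<le> (T / real j) powr \<alpha>" using \<alpha> pos[OF j] by (simp add: powr_powr)
    also have "\<dots> = T powr \<alpha> * real j powr (- \<alpha>)"
      using T by (simp add: powr_divide powr_minus_divide)
    also have "\<dots> \<le> T powr \<alpha> * real j powr (- b)"
      using j ba by (intro mult_left_mono powr_mono) auto
    finally show ?thesis .
  qed
  moreover have "T powr \<alpha> > 0" using T by simp
  ultimately show ?thesis by blast
qed

lemma d_up_lower_bound:
  assumes pos: "\<And>j. 1 \<le> j \<Longrightarrow> 0 < x j" and b: "d_up x < ennreal b" "0 < b"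
  shows "\<exists>c>0. \<forall>j\<ge>1. c * real j powr (- b) \<le> x j"
proof -
  from b(1) obtain \<alpha> where \<alpha>: "0 \<le> \<alpha>" "ennreal \<alpha> < ennreal b"
    and inf: "0 < (INF n\<in>{1..}. x n * real n powr \<alpha>)"
    unfolding d_up_def Inf_less_iff by blast
  have ab: "\<alpha> < b" using \<alpha> b by (simp add: ennreal_less_iff)
  define c where "c = (INF n\<in>{1..}. x n * real n powr \<alpha>)"
  have "c * real j powr (- b) \<le> x j" if j: "1 \<le> j" for j
  proof -
    have "c \<le> x j * real j powr \<alpha>"
      unfolding c_def using j pos
      by (intro cINF_lower bdd_belowI2[where m = 0]) (auto intro!: mult_nonneg_nonneg less_imp_le)
    also have "\<dots> \<le> x j * real j powr b" using j ab pos[OF j] by (intro mult_left_mono powr_mono) auto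
    finally have "c * real j powr (- b) \<le> (x j * real j powr b) * real j powr (- b)"
      by (rule mult_right_mono) simp
    also have "\<dots> = x j * (real j powr b * real j powr (- b))" by (simp add: mult.assoc)
    also have "real j powr b * real j powr (- b) = 1" using j by (simp add: powr_add[symmetric])
    finally show ?thesis by simp
  qed
  with inf show ?thesis unfolding c_def by blast
qed

lemma summable_on_of_powr_bound:
  fixes x :: "nat \<Rightarrow> real"
  assumes pos: "\<And>j. 1 \<le> j \<Longrightarrow> 0 \<le> x j" and C: "\<And>j. 1 \<le> j \<Longrightarrow> x j \<le> C * real j powr (- b)" and b: "1 < b"
  shows "x summable_on {1..}"
proof -
  have "summable (\<lambda>j. C * real j powr (- b))" using b by (intro summable_mult) (simp add: summable_real_powr_iff)
  then have "summable (\<lambda>j. C * real (Suc j) powr (- b))"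
    by (subst summable_Suc_iff[of "\<lambda>j. C * real j powr (- b)"])
  then have "summable (\<lambda>j. x (Suc j))"
  proof (rule summable_comparison_test'[where N = 0])
    show "norm (x (Suc n)) \<le> C * real (Suc n) powr (- b)" for n
      using pos[of "Suc n"] C[of "Suc n"] by (simp del: of_nat_Suc)
  qed
  then have "(\<lambda>j. x (Suc j)) summable_on UNIV"
    by (intro summable_nonneg_imp_summable_on) (use pos in auto)
  then show ?thesis using summable_on_reindex_bij_betw[OF bij_betw_Suc, of x] by simp
qed

subsection \<open>The two rates\<close>

text \<open>
  With budget \<open>n\<close> the coordinates up to \<open>d \<approx> n\<^bsup>1/s\<^esup>\<close> can be reached, and the weights of the next \<open>d\<close>
  coordinates sum to at least a constant times \<open>d\<^bsup>1-b\<^esup>\<close>. The error is bounded below by the square root of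
  this sum.
\<close>

lemma (in weighted_measure) nonzero_mean_rate:
  assumes L2: "\<And>t. t \<in> D \<Longrightarrow> (\<lambda>y. k y t) \<in> L2 \<rho>" and not_anova: "\<not> anova_kernel \<rho> k"
    and \<gamma>_mono: "\<And>j. 1 \<le> j \<Longrightarrow> \<gamma> (Suc j) \<le> \<gamma> j"
    and cg: "0 < cg" "\<And>j. 1 \<le> j \<Longrightarrow> cg * real j powr (- b) \<le> \<gamma> j" and b: "1 < b"
    and s: "0 < s" and cost: "0 < c1" "\<And>m. 1 \<le> m \<Longrightarrow> c1 * real m powr s \<le> c m" "\<And>m. 0 \<le> c m"
  shows "r_infty \<rho> \<gamma> k c \<le> ennreal ((b - 1) / (2 * s))"
proof -
  from not_anova obtain t where t: "t \<in> D" "(\<integral>y. k y t \<partial>\<rho>) \<noteq> 0" by (auto simp: anova_kernel_def)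
  define \<kappa> where "\<kappa> = \<bar>\<integral>y. k y t \<partial>\<rho>\<bar>"
  have \<kappa>: "\<kappa> > 0" using t by (simp add: \<kappa>_def)
  have ktt: "k t t > 0"
  proof (rule ccontr)
    assume "\<not> 0 < k t t"
    then have "k t t = 0" using k.diag_nonneg[OF t(1)] by simp
    have "k y t = 0" if y: "y \<in> D" for y
    proof -
      have "(kernel_section D k t y)\<^sup>2 \<le> ip k.H (kernel_section D k t) (kernel_section D k t) * k y y"
        by (rule k.mem_sq_le[OF k.section_mem[OF t(1)] y])
      also have "ip k.H (kernel_section D k t) (kernel_section D k t) = k t t"
        using k.ip_section[OF t(1) k.section_mem[OF t(1)]] t(1) by (simp add: kernel_section_def)
      finally show ?thesis using \<open>k t t = 0\<close> y by (simp add: kernel_section_def)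
    qed
    then have "(\<integral>y. k y t \<partial>\<rho>) = (\<integral>y. 0 \<partial>\<rho>)" by (intro Bochner_Integration.integral_cong) auto
    with t(2) show False by simp
  qed
  define q where "q = c1 powr (- 1 / s) + 1"
  have q: "q > 0" by (simp add: q_def add_nonneg_pos)
  define c' where "c' = sqrt (cg * 2 powr (- b) * q powr (1 - b)) * \<kappa> / sqrt (k t t)"
  have c': "c' > 0" using cg \<kappa> ktt q by (simp add: c'_def)
  have main: "c' * real n powr (- ((b - 1) / (2 * s))) \<le> min_error \<rho> \<gamma> k c n" if n: "1 \<le> n" for n
  proof (rule min_error_ge)
    fix A assume A: "admissible \<rho> \<gamma> k A" "nested_cost \<rho> \<gamma> k c A \<le> real n"
    define r where "r = (real n / c1) powr (1 / s)"
    \<comment> \<open>No coordinate beyond \<open>r\<close> is affordable.\<close>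
    define d where "d = nat \<lfloor>r\<rfloor> + 1"
    have r0: "0 \<le> r" by (simp add: r_def)
    have d: "1 \<le> d" "r \<le> real d" "real d \<le> r + 1" using r0 by (auto simp: d_def)
    have act: "active_vars \<rho> \<gamma> k h \<subseteq> {1..d}" if hg: "(h, g) \<in> set A" for h g
    proof
      fix j assume j: "j \<in> active_vars \<rho> \<gamma> k h"
      from A(1) hg obtain u where "u \<in> fin_sets" "h \<in> sum_space \<rho> \<gamma> k u" by (auto simp: admissible_def)
      then have av: "active_vars \<rho> \<gamma> k h \<in> fin_sets" by (rule active_vars(1))
      define M where "M = Max (insert 0 (active_vars \<rho> \<gamma> k h))"
      have jM: "j \<le> M" unfolding M_def using av j by (intro Max_ge) (auto simp: fin_sets_def)
      have j1: "1 \<le> j" using av j by (auto simp: fin_sets_def)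
      have "c M \<le> nested_cost \<rho> \<gamma> k c A"
        unfolding nested_cost_def M_def using hg cost(3)
        by (intro member_le_sum_list) (auto simp: image_iff intro!: bexI[of _ "(h, g)"])
      with A(2) cost(2)[of M] jM j1 have "c1 * real M powr s \<le> real n" by simp
      then have "real M powr s \<le> real n / c1" using cost(1) by (simp add: field_simps)
      then have "(real M powr s) powr (1 / s) \<le> (real n / c1) powr (1 / s)" using s by (intro powr_mono2) auto
      then have "real M \<le> r" using s by (simp add: r_def powr_powr)
      with d jM j1 show "j \<in> {1..d}" by simp
    qed
    define G where "G = (\<Sum>j\<in>{Suc d..2 * d}. \<gamma> j)"
    have "sqrt G * \<kappa> \<le> sqrt (k t t) * wc_error \<rho> \<gamma> k A"
      unfolding G_def \<kappa>_def using act by (intro error_lower_bound[OF A(1) _ _ _ t(1) L2[OF t(1)]]) auto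
    then have 1: "sqrt G * \<kappa> / sqrt (k t t) \<le> wc_error \<rho> \<gamma> k A" using ktt by (simp add: field_simps)
    have anti: "\<gamma> j \<le> \<gamma> i" if "1 \<le> i" "i \<le> j" for i j
      using that(2) by (induction rule: dec_induct) (use \<gamma>_mono that(1) in \<open>auto intro: order_trans\<close>)
    have "cg * 2 powr (- b) * real d powr (1 - b) = real d * (cg * real (2 * d) powr (- b))"
      using d(1) by (simp add: powr_mult powr_diff powr_minus field_simps)
    also have "\<dots> \<le> real d * \<gamma> (2 * d)" using cg(2)[of "2 * d"] d(1) by (intro mult_left_mono) auto
    also have "\<dots> = (\<Sum>j\<in>{Suc d..2 * d}. \<gamma> (2 * d))" by simp
    also have "\<dots> \<le> G" unfolding G_def using d(1) by (intro sum_mono anti) auto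
    finally have 2: "cg * 2 powr (- b) * real d powr (1 - b) \<le> G" .
    have "real d \<le> q * real n powr (1 / s)"
    proof -
      have "r = c1 powr (- 1 / s) * real n powr (1 / s)"
        using powr_minus_divide[of c1 "1 / s"] by (simp add: r_def powr_divide)
      moreover have "1 \<le> real n powr (1 / s)" using n s by (intro ge_one_powr_ge_zero) auto
      ultimately show ?thesis using d(3) by (simp add: q_def algebra_simps)
    qed
    then have "(q * real n powr (1 / s)) powr (1 - b) \<le> real d powr (1 - b)"
      using d(1) b by (intro powr_mono2') auto
    then have "cg * 2 powr (- b) * (q * real n powr (1 / s)) powr (1 - b) \<le> cg * 2 powr (- b) * real d powr (1 - b)"
      using cg(1) by (intro mult_left_mono) auto
    with 2 have "cg * 2 powr (- b) * (q * real n powr (1 / s)) powr (1 - b) \<le> G" by linarith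
    then have "sqrt (cg * 2 powr (- b) * (q * real n powr (1 / s)) powr (1 - b)) \<le> sqrt G" by simp
    moreover have "(q * real n powr (1 / s)) powr (1 - b) = q powr (1 - b) * real n powr ((1 - b) / s)"
      by (simp add: powr_mult powr_powr)
    moreover have "sqrt (real n powr ((1 - b) / s)) = real n powr (- ((b - 1) / (2 * s)))"
    proof -
      have "sqrt (real n powr ((1 - b) / s)) = (real n powr ((1 - b) / s)) powr (1 / 2)"
        by (simp add: powr_half_sqrt)
      also have "\<dots> = real n powr ((1 - b) / s * (1 / 2))" by (rule powr_powr)
      also have "(1 - b) / s * (1 / 2) = - ((b - 1) / (2 * s))" using s by (simp add: field_simps)
      finally show ?thesis .
    qed
    ultimately have "sqrt (cg * 2 powr (- b) * q powr (1 - b)) * real n powr (- ((b - 1) / (2 * s))) \<le> sqrt G"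
      by (simp add: real_sqrt_mult mult.assoc)
    then have "sqrt (cg * 2 powr (- b) * q powr (1 - b)) * real n powr (- ((b - 1) / (2 * s))) * (\<kappa> / sqrt (k t t))
      \<le> sqrt G * (\<kappa> / sqrt (k t t))" using \<kappa> ktt by (intro mult_right_mono) auto
    with 1 show "c' * real n powr (- ((b - 1) / (2 * s))) \<le> wc_error \<rho> \<gamma> k A"
      by (simp add: c'_def mult_ac)
  qed
  show ?thesis
    unfolding r_infty_def by (rule decay_le[OF _ c' main]) (use b s in auto)
qed

text \<open>
  With \<open>c j\<close> of order \<open>j\<^sup>s\<close> and \<open>\<gamma>\<^sub>j\<close> of order \<open>j\<^bsup>-b\<^esup>\<close> the weighted eigenvalue sum is finite as soon as
  \<open>\<tau> b > s + 1\<close>.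
\<close>

lemma (in anova_frame) zero_mean_rate:
  assumes \<tau>: "1 \<le> \<tau>" and \<mu>: "summable \<mu>"
    and Cg: "0 < Cg" "\<And>j. 1 \<le> j \<Longrightarrow> \<gamma> j \<le> Cg * real j powr (- b)" and b: "s + 1 < \<tau> * b"
    and s: "0 < s" and cost: "mono c" "\<And>m. 1 \<le> c m" "\<And>m. 1 \<le> m \<Longrightarrow> c m \<le> c2 * real m powr s"
    and \<alpha>: "0 < \<alpha>" "\<alpha> < 1 / (2 * \<tau>)"
  shows "ennreal \<alpha> \<le> r_infty \<rho> \<gamma> k c"
proof -
  \<comment> \<open>The eigenvalues are summable and \<open>\<tau> \<ge> 1\<close>, so their powers are summable as well.\<close>
  define S where "S = suminf \<mu>"
  have S0: "0 \<le> S" unfolding S_def using mu_nonneg by (intro suminf_nonneg \<mu>)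
  define M where "M = (S + 1) powr (\<tau> - 1) * S"
  have M: "(\<Sum>i\<in>B. \<mu> i powr \<tau>) \<le> M" if B: "finite B" for B
  proof -
    have sumB: "sum \<mu> B \<le> S" unfolding S_def using mu_nonneg by (intro sum_le_suminf \<mu> B) auto
    have "\<mu> i powr \<tau> \<le> (S + 1) powr (\<tau> - 1) * \<mu> i" for i
    proof (cases "\<mu> i = 0")
      case False
      then have pos: "\<mu> i > 0" using mu_nonneg[of i] by simp
      have "\<mu> i \<le> S"
        using sum_le_suminf[OF \<mu>, of "{i}"] mu_nonneg by (simp add: S_def)
      then have "\<mu> i powr (\<tau> - 1) \<le> (S + 1) powr (\<tau> - 1)" using \<tau> pos by (intro powr_mono2) auto
      then have "\<mu> i powr (\<tau> - 1) * \<mu> i \<le> (S + 1) powr (\<tau> - 1) * \<mu> i" using pos by (intro mult_right_mono) auto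
      moreover have "\<mu> i powr (\<tau> - 1) * \<mu> i = \<mu> i powr \<tau>" using pos by (simp add: powr_diff)
      ultimately show ?thesis by simp
    qed simp
    then have "(\<Sum>i\<in>B. \<mu> i powr \<tau>) \<le> (S + 1) powr (\<tau> - 1) * sum \<mu> B"
      unfolding sum_distrib_left by (intro sum_mono)
    also have "\<dots> \<le> M" unfolding M_def using sumB by (intro mult_left_mono) auto
    finally show ?thesis .
  qed
  have M0: "0 \<le> M" using M[of "{}"] by simp
  have c2: "0 < c2" using cost(2,3)[of 1] by simp
  define y where "y j = (1 + c j) * (M * \<gamma> j powr \<tau>)" for j
  define C where "C = (1 + c2) * (M * Cg powr \<tau>)"
  have y0: "0 \<le> y j" for j
    unfolding y_def using M0 cost(2)[of j] by (intro mult_nonneg_nonneg) auto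
  have y_le: "y j \<le> C * real j powr (- (\<tau> * b - s))" if j: "1 \<le> j" for j
  proof -
    have "1 \<le> real j powr s" using j s by (intro ge_one_powr_ge_zero) auto
    then have 1: "1 + c j \<le> (1 + c2) * real j powr s" using cost(3)[OF j] by (simp add: distrib_right)
    have "\<gamma> j powr \<tau> \<le> (Cg * real j powr (- b)) powr \<tau>"
      using Cg(2)[OF j] gamma_pos[OF j] \<tau> by (intro powr_mono2) auto
    also have "\<dots> = Cg powr \<tau> * real j powr (- (\<tau> * b))" by (simp add: powr_mult powr_powr mult.commute)
    finally have 2: "\<gamma> j powr \<tau> \<le> Cg powr \<tau> * real j powr (- (\<tau> * b))" .
    have "y j \<le> ((1 + c2) * real j powr s) * (M * (Cg powr \<tau> * real j powr (- (\<tau> * b))))"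
      unfolding y_def using 1 2 M0 c2 by (intro mult_mono mult_left_mono mult_nonneg_nonneg) auto
    also have "\<dots> = C * (real j powr s * real j powr (- (\<tau> * b)))" by (simp add: C_def mult_ac)
    also have "real j powr s * real j powr (- (\<tau> * b)) = real j powr (- (\<tau> * b - s))"
      by (simp add: powr_add[symmetric])
    finally show ?thesis .
  qed
  have "y summable_on {1..}"
    by (rule summable_on_of_powr_bound[OF _ y_le]) (use y0 b in auto)
  then have T: "(\<Sum>j\<in>J. (1 + c j) * (M * \<gamma> j powr \<tau>)) \<le> infsum y {1..}" if "finite J" "J \<subseteq> {1..}" for J
    using finite_sum_le_infsum[of y "{1..}" J] that y0 by (simp add: y_def)
  have "0 \<le> c 0" using cost(2)[of 0] by simp
  show ?thesis
    unfolding r_infty_def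
  proof (rule decay_ge[OF \<alpha>])
    show "0 \<le> c 0 * exp (infsum y {1..})" using \<open>0 \<le> c 0\<close> by simp
    show "0 \<le> min_error \<rho> \<gamma> k c n" for n by (rule min_error_nonneg)
    show "min_error \<rho> \<gamma> k c n \<le> (c 0 * exp (infsum y {1..}) / real n) powr (1 / (2 * \<tau>))" if "1 \<le> n" for n
      using \<tau> by (intro anova_error_bound[OF _ cost(1,2) M T that]) auto
  qed
qed

section \<open>The comparison\<close>

text \<open>
  The orthonormal basis of \<open>H(1 + k)\<close> is provided by the eigenfunctions.
\<close>

lemma onb_kernelI:
  assumes "prob_space \<rho>" "standing_kernel \<rho> \<gamma> k" "eigenvalue_sequence \<rho> k lam"
  obtains e where "onb_kernel \<rho> k e"
    "\<And>j. j \<ge> 1 \<Longrightarrow> emb_W \<rho> (rkhs (space \<rho>) (one_plus k)) (e j) = (\<lambda>x. lam j * e j x)"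
proof -
  interpret prob_space \<rho> by fact
  let ?H = "rkhs (space \<rho>) (one_plus k)"
  from assms(3) obtain e where e: "\<forall>j\<ge>1. e j \<in> elems ?H"
    "\<forall>i\<ge>1. \<forall>j\<ge>1. ip ?H (e i) (e j) = (if i = j then 1 else 0)"
    "\<forall>f\<in>elems ?H. (\<forall>j\<ge>1. ip ?H f (e j) = 0) \<longrightarrow> f = (\<lambda>_. 0)"
    "\<forall>j\<ge>1. emb_W \<rho> ?H (e j) = (\<lambda>x. lam j * e j x)"
    unfolding eigenvalue_sequence_def Let_def by blast
  have "onb_kernel \<rho> k e"
  proof
    show "reproducing_kernel (space \<rho>) k"
      "elems (rkhs (space \<rho>) (\<lambda>_ _. 1)) \<inter> elems (rkhs (space \<rho>) k) = {\<lambda>_. 0}"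
      using assms(2) by (simp_all add: standing_kernel_def)
  qed (use e in blast)+
  with e(4) that show ?thesis by blast
qed

lemma weighted_measureI:
  assumes ps: "prob_space \<rho>" and st: "standing_kernel \<rho> \<gamma> k" and onb: "onb_kernel \<rho> k e"
    and pos: "\<And>j. 1 \<le> j \<Longrightarrow> 0 < \<gamma> j" and sm: "\<gamma> summable_on {1..}"
    and frame: "\<And>x y. x \<in> space \<rho> \<Longrightarrow> y \<in> space \<rho> \<Longrightarrow> ((\<lambda>i. \<phi> i x * \<phi> i y) has_sum k x y) UNIV"
  obtains U where "weighted_measure \<rho> \<gamma> k \<phi> U"
proof -
  interpret O: onb_kernel \<rho> k e by (rule onb)
  from st obtain U :: "nat \<Rightarrow> nat set" where U: "bij_betw U UNIV fin_sets"
    unfolding standing_kernel_def by blast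
  have "weighted_measure \<rho> \<gamma> k \<phi> U"
  proof
    show "space \<rho> \<noteq> {}" by (rule O.not_empty)
    show "(\<lambda>x. if x \<in> space \<rho> then 1 else 0) \<notin> elems (rkhs (space \<rho>) k)"
      using O.one_not_mem_k unfolding O.one_def[abs_def] .
    show "integrable \<rho> (\<lambda>x. k x x)" using st by (simp add: standing_kernel_def)
  qed (use pos sm frame U in auto)
  then show ?thesis by (rule that)
qed

theorem corollary2:
  fixes \<rho> :: "'a measure" and kA kN :: "'a \<Rightarrow> 'a \<Rightarrow> real"
    and \<gamma> lamA lamN :: "nat \<Rightarrow> real" and cost :: "nat \<Rightarrow> real" and s :: real
  assumes "prob_space \<rho>"
    and "weight_sequence \<gamma>"
    and "standing_kernel \<rho> \<gamma> kA" and "standing_kernel \<rho> \<gamma> kN"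
    and "anova_kernel \<rho> kA" and "\<not> anova_kernel \<rho> kN"
    and "eigenvalue_sequence \<rho> kA lamA" and "eigenvalue_sequence \<rho> kN lamN"
    and "d_low lamA > 1" and "d_low lamN > 1"
    and "mono cost" and "\<forall>m. cost m \<ge> 1"
    and "s > 0"
    and "\<exists>c1>0. \<exists>c2>0. \<forall>m\<ge>1. c1 * real m powr s \<le> cost m \<and> cost m \<le> c2 * real m powr s"
    and "d_low \<gamma> = d_up \<gamma>"
    and "1 < d_low \<gamma>" and "d_low \<gamma> < 1 + ennreal s"
  shows "r_infty \<rho> \<gamma> kA cost > r_infty \<rho> \<gamma> kN cost"
proof -
  note ps = assms(1) and w = assms(2) and stA = assms(3) and stN = assms(4) and s = assms(13)
  have gpos: "0 < \<gamma> j" and gmono: "\<gamma> (Suc j) \<le> \<gamma> j" if "1 \<le> j" for j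
    using w that by (auto simp: weight_sequence_def)
  obtain c1 c2 where c: "0 < c1" "\<And>m. 1 \<le> m \<Longrightarrow> c1 * real m powr s \<le> cost m"
    "\<And>m. 1 \<le> m \<Longrightarrow> cost m \<le> c2 * real m powr s" using assms(14) by blast
  obtain g where g: "d_low \<gamma> = ennreal g" "1 < g" "g < 1 + s"
  proof -
    have ne: "d_low \<gamma> \<noteq> \<infinity>" using assms(17) by (auto simp: top_unique)
    have eq: "d_low \<gamma> = ennreal (enn2real (d_low \<gamma>))" using ne by (simp add: less_top)
    have "ennreal 1 < ennreal (enn2real (d_low \<gamma>))" using assms(16) eq by simp
    moreover have "ennreal (enn2real (d_low \<gamma>)) < ennreal (1 + s)"
      using assms(17) eq s by (simp add: ennreal_plus)
    ultimately have "1 < enn2real (d_low \<gamma>)" "enn2real (d_low \<gamma>) < 1 + s"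
      by (simp_all only: ennreal_less_iff enn2real_nonneg zero_le_one)
    with that[OF eq] show ?thesis .
  qed
  \<comment> \<open>\<open>g < 1 + s\<close> makes \<open>(s + 1) / g\<close> smaller than \<open>s / (g - 1)\<close>. The exponent \<open>\<tau>\<close> lies between them,
    and \<open>b'\<close>, \<open>\<alpha>\<close>, \<open>b\<close> are chosen in turn so that every strict inequality survives.\<close>
  have "(s + 1) / g < s / (g - 1)" using g s by (simp add: field_simps)
  then obtain \<tau> where \<tau>: "(s + 1) / g < \<tau>" "\<tau> < s / (g - 1)" using dense by blast
  have "1 < (s + 1) / g" using g by (simp add: field_simps)
  then have \<tau>1: "1 < \<tau>" using \<tau> by simp
  have "(s + 1) / \<tau> < g" using \<tau> \<tau>1 g by (simp add: field_simps)
  then obtain b' where b': "max 1 ((s + 1) / \<tau>) < b'" "b' < g" using dense[of "max 1 ((s + 1) / \<tau>)" g] g by auto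
  then have b'1: "1 < b'" "s + 1 < \<tau> * b'" using \<tau>1 by (auto simp: field_simps)
  have "(g - 1) / (2 * s) < 1 / (2 * \<tau>)" using \<tau> \<tau>1 g s by (simp add: field_simps)
  then obtain \<alpha> where \<alpha>: "(g - 1) / (2 * s) < \<alpha>" "\<alpha> < 1 / (2 * \<tau>)" using dense by blast
  have "0 < (g - 1) / (2 * s)" using g s by simp
  then have \<alpha>0: "0 < \<alpha>" using \<alpha> by simp
  have "g < 2 * s * \<alpha> + 1" using \<alpha>(1) s by (simp add: field_simps)
  then obtain b where b: "g < b" "b < 2 * s * \<alpha> + 1" using dense by blast
  then have b1: "1 < b" "(b - 1) / (2 * s) < \<alpha>" using g s by (auto simp: field_simps)
  obtain Cg where Cg: "0 < Cg" "\<And>j. 1 \<le> j \<Longrightarrow> \<gamma> j \<le> Cg * real j powr (- b')"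
    using d_low_upper_bound[of \<gamma> b', OF gmono gpos] g b' b'1 by (auto simp: ennreal_less_iff)
  obtain cg where cg: "0 < cg" "\<And>j. 1 \<le> j \<Longrightarrow> cg * real j powr (- b) \<le> \<gamma> j"
    using d_up_lower_bound[of \<gamma> b, OF gpos] g b b1 assms(15) by (auto simp: ennreal_less_iff)
  have gsum: "\<gamma> summable_on {1..}"
    by (rule summable_on_of_powr_bound[OF less_imp_le[OF gpos] Cg(2) b'1(1)])
  have "r_infty \<rho> \<gamma> kN cost \<le> ennreal ((b - 1) / (2 * s))"
  proof -
    obtain e where e: "onb_kernel \<rho> kN e" by (rule onb_kernelI[OF ps stN assms(8)])
    interpret O: onb_kernel \<rho> kN e by (rule e)
    obtain U where "weighted_measure \<rho> \<gamma> kN (O.reflected 1) U"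
      by (rule weighted_measureI[OF ps stN e gpos gsum O.reflected_series]) auto
    then interpret W: weighted_measure \<rho> \<gamma> kN "O.reflected 1" U .
    have L2: "(\<lambda>y. kN y t) \<in> L2 \<rho>" if "t \<in> space \<rho>" for t
      using stN that by (simp add: standing_kernel_def)
    have c0: "0 \<le> cost m" for m using assms(12) by (auto intro: order_trans[OF zero_le_one])
    show ?thesis by (rule W.nonzero_mean_rate[OF L2 assms(6) gmono cg b1(1) s c(1,2) c0])
  qed
  also have "\<dots> < ennreal \<alpha>" using b1 s \<alpha>0 by (simp add: ennreal_less_iff)
  also have "\<dots> \<le> r_infty \<rho> \<gamma> kA cost"
  proof -
    obtain e where e: "onb_kernel \<rho> kA e"
      and eig: "\<And>j. j \<ge> 1 \<Longrightarrow> emb_W \<rho> (rkhs (space \<rho>) (one_plus kA)) (e j) = (\<lambda>x. lamA j * e j x)"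
      by (rule onb_kernelI[OF ps stA assms(7)]) blast
    interpret O: onb_kernel \<rho> kA e by (rule e)
    interpret E: onb_eigen \<rho> kA e lamA
      by unfold_locales (use stA assms(5) eig in \<open>auto simp: standing_kernel_def\<close>)
    obtain \<phi> where \<phi>: "\<And>x y. x \<in> space \<rho> \<Longrightarrow> y \<in> space \<rho> \<Longrightarrow> ((\<lambda>i. \<phi> i x * \<phi> i y) has_sum kA x y) UNIV"
      "\<And>i. \<phi> i \<in> borel_measurable \<rho>" "\<And>i. integrable \<rho> (\<lambda>x. (\<phi> i x)\<^sup>2)"
      "\<And>i. (\<integral>x. \<phi> i x \<partial>\<rho>) = 0" "\<And>i j. i \<noteq> j \<Longrightarrow> (\<integral>x. \<phi> i x * \<phi> j x \<partial>\<rho>) = 0"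
      "\<And>i. (\<integral>x. (\<phi> i x)\<^sup>2 \<partial>\<rho>) \<le> lamA (Suc i)"
      by (rule E.orthogonal_frame) blast
    obtain U where "weighted_measure \<rho> \<gamma> kA \<phi> U"
      by (rule weighted_measureI[OF ps stA e gpos gsum \<phi>(1)])
    then interpret W: weighted_measure \<rho> \<gamma> kA \<phi> U .
    have lpos: "0 < lamA j" and lmono: "lamA (Suc j) \<le> lamA j" if "1 \<le> j" for j
      using assms(7) that by (auto simp: eigenvalue_sequence_def)
    interpret A: anova_frame \<rho> \<gamma> kA \<phi> U "\<lambda>i. lamA (Suc i)"
      by unfold_locales (use \<phi> lpos in \<open>auto simp: less_imp_le\<close>)
    obtain bl where bl: "ennreal 1 < ennreal bl" "ennreal bl < d_low lamA"
    proof -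
      obtain z where z: "1 < z" "z < d_low lamA" using dense[OF assms(9)] by blast
      then have "z \<noteq> \<infinity>" by auto
      then have "z = ennreal (enn2real z)" by (simp add: less_top)
      with z that[of "enn2real z"] show ?thesis by simp
    qed
    then have "1 < bl" by (simp add: ennreal_less_iff)
    obtain Cl where Cl: "\<And>j. 1 \<le> j \<Longrightarrow> lamA j \<le> Cl * real j powr (- bl)"
      using d_low_upper_bound[of lamA bl, OF lmono lpos bl(2)] \<open>1 < bl\<close> by auto
    have "lamA summable_on {1..}"
      by (rule summable_on_of_powr_bound[OF less_imp_le[OF lpos] Cl \<open>1 < bl\<close>])
    then have "(\<lambda>i. lamA (Suc i)) summable_on UNIV"
      using summable_on_reindex_bij_betw[OF bij_betw_Suc, of lamA] by simp
    then have sl: "summable (\<lambda>i. lamA (Suc i))" by (rule summable_on_imp_summable)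
    have c1: "1 \<le> cost m" for m using assms(12) by simp
    show ?thesis
      by (rule A.zero_mean_rate[OF _ sl Cg b'1(2) s assms(11) c1 c(3) \<alpha>0 \<alpha>(2)]) (use \<tau>1 in auto)
  qed
  finally show ?thesis .
qed

end
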